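(* Let $B$ be a standard Brownian motion on $[0,1]$ with $B(0)=0$, let $h=\max_{0\le u\le 1}B(u)$, and let $\theta$ be the smallest $u\in[0,1]$ with $B(u)=h$. For $0<s<1$, $0<\theta<1$, $h>0$ and $x<h$, the conditional density $p(B(s)=x\mid\theta,h)$ of $B(s)$ at $x$ given $(\theta,h)$ satisfies, for $s<\theta$, $$p(B(s)=x\mid\theta,h)=\frac{(h-x)}{\pi(1-\theta)^{1/2}(\theta-s)^{3/2}}\;g_s(h-x,h)\,\exp\Big(\frac{-(h-x)^2}{2(\theta-s)}\Big),$$ and, for $s>\theta$, the conditional density is $$p(B(s)=x\mid\theta,h)=\frac{h(h-x)}{\pi\,\theta^{3/2}(s-\theta)^{3/2}}\;\mathrm{erf}\Big(\frac{h-x}{\sqrt{2(1-s)}}\Big)\exp\Big(\frac{-(h-x)^2}{2(s-\theta)}-\frac{h^2}{2\theta}\Big).$$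
   Context: Notation: for $\sigma>0$, $\phi_\sigma(x)=(2\pi\sigma)^{-1/2}\exp(-x^2/(2\sigma))$ and $g_\sigma(x,y)=\phi_\sigma(x-y)-\phi_\sigma(x+y)$; $\mathrm{erf}(z)=\frac{2}{\sqrt{\pi}}\int_0^z e^{-u^2}\,du$. The letters $\theta$ and $h$ denote both the random variables (first location of the maximum, and the maximum, of $B$ on $[0,1]$) and their values.
   Formalization: The displayed formulas do not integrate to 1 in x (at θ=1/2, h=1 they give about 0.468); they are proved to be the joint density of (B(s),θ,h), and the conditional density of B(s) given (θ,h) is proved to be each formula divided by its integral over x. *)

theory Defs
  imports "HOL-Probability.Probability"
begin

text \<open>All paths, not only almost all, are continuous and start at 0, so that the maximum and its
  first location are defined at every sample point without completing \<open>M\<close>.\<close>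

definition brownian_motion_01 :: "'a measure \<Rightarrow> (real \<Rightarrow> 'a \<Rightarrow> real) \<Rightarrow> bool" where
  "brownian_motion_01 M B \<longleftrightarrow>
     prob_space M \<and>
     (\<forall>t\<in>{0..1}. B t \<in> borel_measurable M) \<and>
     (\<forall>\<omega>\<in>space M. B 0 \<omega> = 0) \<and>
     (\<forall>\<omega>\<in>space M. continuous_on {0..1} (\<lambda>t. B t \<omega>)) \<and>
     (\<forall>u v. 0 \<le> u \<longrightarrow> u < v \<longrightarrow> v \<le> 1 \<longrightarrow>
        distributed M lborel (\<lambda>\<omega>. B v \<omega> - B u \<omega>) (normal_density 0 (sqrt (v - u)))) \<and>
     (\<forall>(n::nat) t. 0 \<le> t 0 \<longrightarrow> (\<forall>i<n. t i \<le> t (Suc i)) \<longrightarrow> t n \<le> 1 \<longrightarrow>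
        prob_space.indep_vars M (\<lambda>_. borel) (\<lambda>i \<omega>. B (t (Suc i)) \<omega> - B (t i) \<omega>) {..<n})"

definition path_max :: "(real \<Rightarrow> 'a \<Rightarrow> real) \<Rightarrow> 'a \<Rightarrow> real" where
  "path_max B \<omega> = (SUP u\<in>{0..1}. B u \<omega>)"

definition path_argmax :: "(real \<Rightarrow> 'a \<Rightarrow> real) \<Rightarrow> 'a \<Rightarrow> real" where
  "path_argmax B \<omega> = (LEAST u. u \<in> {0..1} \<and> B u \<omega> = path_max B \<omega>)"

definition phi :: "real \<Rightarrow> real \<Rightarrow> real" where
  "phi \<sigma> x = (2 * pi * \<sigma>) powr (-1/2) * exp (- x\<^sup>2 / (2 * \<sigma>))"

definition g :: "real \<Rightarrow> real \<Rightarrow> real \<Rightarrow> real" where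
  "g \<sigma> x y = phi \<sigma> (x - y) - phi \<sigma> (x + y)"

definition erf :: "real \<Rightarrow> real" where
  "erf z = 2 / sqrt pi * (LBINT u=0..z. exp (- u\<^sup>2))"

definition density_before :: "real \<Rightarrow> real \<Rightarrow> real \<Rightarrow> real \<Rightarrow> real" where
  "density_before s x \<theta> h =
     (h - x) / (pi * (1 - \<theta>) powr (1/2) * (\<theta> - s) powr (3/2))
       * g s (h - x) h * exp (- (h - x)\<^sup>2 / (2 * (\<theta> - s)))"

definition density_after :: "real \<Rightarrow> real \<Rightarrow> real \<Rightarrow> real \<Rightarrow> real" where
  "density_after s x \<theta> h =
     h * (h - x) / (pi * \<theta> powr (3/2) * (s - \<theta>) powr (3/2))
       * erf ((h - x) / sqrt (2 * (1 - s)))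
       * exp (- (h - x)\<^sup>2 / (2 * (s - \<theta>)) - h\<^sup>2 / (2 * \<theta>))"

text \<open>The value at \<open>\<theta> = s\<close> is immaterial, since this is a null set.\<close>

definition bm_density :: "real \<Rightarrow> real \<Rightarrow> real \<Rightarrow> real \<Rightarrow> real" where
  "bm_density s x \<theta> h =
     (if 0 < \<theta> \<and> \<theta> < 1 \<and> 0 < h \<and> x < h then
        (if s < \<theta> then density_before s x \<theta> h
         else if \<theta> < s then density_after s x \<theta> h
         else 0)
      else 0)"

text \<open>\<open>bm_density s x \<theta> h\<close> carries the weight of \<open>(\<theta>, h)\<close>: its integral over \<open>x\<close> is the density of
  the pair \<open>(\<theta>, h)\<close>, not 1. It is thus the joint density of \<open>(B(s), \<theta>, h)\<close>, and the normalised
  conditional density of \<open>B(s)\<close> given \<open>(\<theta>, h)\<close> is obtained by dividing by this integral.\<close>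

definition bm_conditional_density :: "real \<Rightarrow> real \<Rightarrow> real \<Rightarrow> real \<Rightarrow> real" where
  "bm_conditional_density s x \<theta> h =
     bm_density s x \<theta> h / (\<integral>y. bm_density s y \<theta> h \<partial>lborel)"

text \<open>\<open>p x y\<close> is a version of the conditional (Lebesgue) density at \<open>x\<close> of \<open>X\<close> given \<open>Y = y\<close>.\<close>

definition is_conditional_density ::
  "'a measure \<Rightarrow> ('a \<Rightarrow> real) \<Rightarrow> 'b measure \<Rightarrow> ('a \<Rightarrow> 'b) \<Rightarrow> (real \<Rightarrow> 'b \<Rightarrow> real) \<Rightarrow> bool" where
  "is_conditional_density M X N Y p \<longleftrightarrow>
     X \<in> borel_measurable M \<and> Y \<in> measurable M N \<and>
     (\<lambda>(x, y). p x y) \<in> borel_measurable (lborel \<Otimes>\<^sub>M N) \<and>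
     (\<forall>x. \<forall>y\<in>space N. 0 \<le> p x y) \<and>
     (\<forall>A\<in>sets borel. \<forall>C\<in>sets N.
        emeasure M {\<omega> \<in> space M. X \<omega> \<in> A \<and> Y \<omega> \<in> C}
          = (\<integral>\<^sup>+y\<in>C. (\<integral>\<^sup>+x\<in>A. ennreal (p x y) \<partial>lborel) \<partial>distr M N Y))"

end

theory Submission
  imports Defs
begin

text \<open>For a fixed time \<open>w\<close>, the path on \<open>[u, v]\<close> splits into two independent pieces, and the first
  maximum is attained before \<open>w\<close> iff the maximum of the second piece, measured from \<open>B w\<close>, does not
  exceed the drop from the maximum of the first piece down to \<open>B w\<close>. The reflection principle gives
  the density of (increment, maximum) for each piece and hence the killed heat kernel \<open>g\<close>. Integrating
  over \<open>B w\<close> yields the distribution function of the location of the maximum as a combination of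
  Gaussian densities and error functions, whose time derivative is the elementary joint density
  \<open>h (h - x) / (\<pi> t\<^sup>3\<^sup>/\<^sup>2 (T - t)\<^sup>3\<^sup>/\<^sup>2) exp (\<dots>)\<close> of (increment, location, maximum); no strong Markov property
  is needed. The theorem follows by splitting \<open>[0, 1]\<close> once more, at \<open>s\<close>: either the first piece
  carries the maximum and the second stays below it (an error function), or conversely (a factor \<open>g\<close>).\<close>

section \<open>The error function and Gaussian kernels\<close>

text \<open>The time of the maximum is not a stopping time, so the path cannot be restarted there; a
  fixed time \<open>w\<close> serves instead, because whether the first maximum lies before
  \<open>w\<close> depends only on two independent pieces. The price is that the location enters
  through a distribution function that must be differentiated. To avoid differentiating under the
  integral sign, the integral over \<open>B w\<close> is evaluated in closed form as
  \<open>arg_cdf\<close>: after completing the square, the integrand is a linear factor times a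
  single Gaussian, hence integrates to a Gaussian term plus error functions. Under the time
  derivative each error function becomes a Gaussian, and all of these share one exponent, which is
  why \<open>triple_density\<close> is elementary. A genuine hitting time occurs only in the
  reflection principle, where a grid of fixed times and continuous test functions stand in for the
  strong Markov property. Joint laws are identified on intersection-stable generators of product
  form, with half-lines in exactly those coordinates that are known only through a distribution
  function.\<close>

lemma has_real_derivative_erf: "(erf has_real_derivative 2 / sqrt pi * exp (- z\<^sup>2)) (at z)"
proof -
  \<comment> \<open>The margins of 1 put both the base point 0 and \<open>z\<close> in the interior
    of \<open>{a..b}\<close>, so that the one-sided statement of the fundamental theorem becomes a
    full derivative at \<open>z\<close>.\<close>
  define a where "a = min 0 z - 1"
  define b where "b = max 0 z + 1"
  have "((\<lambda>u. LBINT y=ereal 0..u. exp (- y\<^sup>2)) has_vector_derivative exp (- z\<^sup>2)) (at z within {a..b})"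
    by (rule interval_integral_FTC2)
      (simp_all add: a_def b_def continuous_on_exp continuous_on_minus continuous_on_power)
  then have "((\<lambda>u. LBINT y=0..u. exp (- y\<^sup>2)) has_real_derivative exp (- z\<^sup>2)) (at z within {a..b})"
    by (simp add: has_real_derivative_iff_has_vector_derivative flip: zero_ereal_def)
  moreover have "at z within {a..b} = at z"
    by (rule at_within_interior) (auto simp: a_def b_def)
  ultimately have "((\<lambda>u. LBINT y=0..u. exp (- y\<^sup>2)) has_real_derivative exp (- z\<^sup>2)) (at z)"
    by simp
  from DERIV_cmult[OF this, of "2 / sqrt pi"] show ?thesis
    unfolding erf_def[abs_def] by simp
qed

lemma DERIV_erf [derivative_intros]:
  assumes "(f has_real_derivative f') (at x)"
  shows "((\<lambda>x. erf (f x)) has_real_derivative 2 / sqrt pi * exp (- (f x)\<^sup>2) * f') (at x)"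
  using DERIV_chain2[OF has_real_derivative_erf assms] .

lemma continuous_on_erf: "continuous_on A erf"
  by (meson DERIV_continuous_on has_field_derivative_at_within has_real_derivative_erf)

lemma borel_measurable_erf [measurable]: "erf \<in> borel_measurable borel"
  by (intro borel_measurable_continuous_onI continuous_on_erf)

lemma erf_0 [simp]: "erf 0 = 0"
  by (simp add: erf_def flip: zero_ereal_def)

lemma erf_minus: "erf (- z) = - erf z"
proof -
  have "((\<lambda>z. erf (- z) + erf z) has_real_derivative 0) (at x)" for x
    by (auto intro!: derivative_eq_intros)
  then have "\<forall>x. DERIV (\<lambda>z. erf (- z) + erf z) x :> 0" by blast
  from DERIV_isconst_all[OF this, of z 0] show ?thesis by simp
qed

lemma erf_nonneg: "0 \<le> z \<Longrightarrow> 0 \<le> erf z"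
proof -
  assume "0 \<le> z"
  then have "erf 0 \<le> erf z"
  proof (rule DERIV_nonneg_imp_nondecreasing)
    show "\<exists>y. DERIV erf x :> y \<and> 0 \<le> y" for x
      using has_real_derivative_erf[of x] by (rule_tac exI conjI | assumption | simp)+
  qed
  then show ?thesis by simp
qed

lemma erf_at_top: "(erf \<longlongrightarrow> 1) at_top"
proof -
  have *: "has_bochner_integral lborel (\<lambda>x. indicator {0..} x *\<^sub>R exp (- x\<^sup>2 :: real)) (sqrt pi / 2)"
    by (rule gaussian_moment_0)
  have "((\<lambda>z. \<integral>x. indicator {..z} x *\<^sub>R (indicator {0..} x *\<^sub>R exp (- x\<^sup>2 :: real)) \<partial>lborel)
      \<longlongrightarrow> (\<integral>x. indicator {0..} x *\<^sub>R exp (- x\<^sup>2 :: real) \<partial>lborel)) at_top"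
    using * by (intro tendsto_integral_at_top) (auto simp: has_bochner_integral_iff)
  then have "((\<lambda>z. 2 / sqrt pi * (\<integral>x. indicator {..z} x *\<^sub>R (indicator {0..} x *\<^sub>R exp (- x\<^sup>2 :: real)) \<partial>lborel))
      \<longlongrightarrow> 2 / sqrt pi * (sqrt pi / 2)) at_top"
    using * by (intro tendsto_mult tendsto_const) (simp only: has_bochner_integral_iff)
  moreover have "\<forall>\<^sub>F z in at_top. 2 / sqrt pi * (\<integral>x. indicator {..z} x *\<^sub>R (indicator {0..} x *\<^sub>R exp (- x\<^sup>2 :: real)) \<partial>lborel)
     = erf z"
    using eventually_ge_at_top[of 0]
  proof eventually_elim
    case (elim z)
    have "(LBINT u=0..z. exp (- u\<^sup>2)) = (LBINT u:{0..z}. exp (- u\<^sup>2))"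
      using elim interval_integral_Icc[of 0 z] by (simp flip: zero_ereal_def)
    also have "\<dots> = (\<integral>x. indicator {..z} x *\<^sub>R (indicator {0..} x *\<^sub>R exp (- x\<^sup>2 :: real)) \<partial>lborel)"
      unfolding set_lebesgue_integral_def by (intro Bochner_Integration.integral_cong) (auto simp: indicator_def)
    finally show ?case by (simp add: erf_def)
  qed
  ultimately show ?thesis
    by (simp add: Lim_transform_eventually)
qed

lemma erf_at_bot: "(erf \<longlongrightarrow> - 1) at_bot"
  unfolding filterlim_at_bot_mirror erf_minus by (intro tendsto_minus erf_at_top)

section \<open>Gaussian kernels, parametrised by variance\<close>

lemma phi_eq_normal_density: "0 < \<sigma> \<Longrightarrow> phi \<sigma> x = normal_density 0 (sqrt \<sigma>) x"
  by (simp add: phi_def normal_density_def powr_minus powr_half_sqrt inverse_eq_divide)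

lemma phi_nonneg: "0 \<le> phi \<sigma> x"
  by (simp add: phi_def)

lemma phi_minus: "phi \<sigma> (- x) = phi \<sigma> x"
  by (simp add: phi_def)

lemma measurable_phi [measurable]: "phi \<sigma> \<in> borel_measurable borel"
  unfolding phi_def[abs_def] by measurable

lemma continuous_on_phi [continuous_intros]:
  "continuous_on A f \<Longrightarrow> continuous_on A (\<lambda>x. phi \<sigma> (f x))"
  unfolding phi_def divide_inverse by (intro continuous_intros)

lemma DERIV_phi [derivative_intros]:
  assumes "(f has_real_derivative f') (at x)"
  shows "((\<lambda>x. phi \<sigma> (f x)) has_real_derivative - f x / \<sigma> * phi \<sigma> (f x) * f') (at x)"
  unfolding phi_def using assms
  by (cases "\<sigma> = 0") (auto intro!: derivative_eq_intros)

lemma phi_antimono: "0 < \<sigma> \<Longrightarrow> \<bar>x\<bar> \<le> \<bar>y\<bar> \<Longrightarrow> phi \<sigma> y \<le> phi \<sigma> x"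
  unfolding phi_def by (intro mult_left_mono) (auto simp: divide_right_mono abs_le_square_iff)

text \<open>With the scaling \<open>sqrt (2 * \<sigma>)\<close> the error function is an
  antiderivative of \<open>2 * phi \<sigma>\<close>; this is how every error function below
  arises.\<close>

lemma DERIV_erf_phi:
  assumes "0 < \<sigma>" and "(f has_real_derivative f') (at x)"
  shows "((\<lambda>x. erf (f x / sqrt (2 * \<sigma>))) has_real_derivative 2 * phi \<sigma> (f x) * f') (at x)"
proof -
  have "((\<lambda>x. erf (f x / sqrt (2 * \<sigma>))) has_real_derivative
      2 / sqrt pi * exp (- (f x / sqrt (2 * \<sigma>))\<^sup>2) * (f' / sqrt (2 * \<sigma>))) (at x)"
    by (intro DERIV_erf DERIV_cdivide assms)
  moreover have "2 / sqrt pi * exp (- (f x / sqrt (2 * \<sigma>))\<^sup>2) * (f' / sqrt (2 * \<sigma>)) = 2 * phi \<sigma> (f x) * f'"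
    using assms(1) by (simp add: phi_def power_divide powr_minus powr_half_sqrt real_sqrt_mult divide_simps)
  ultimately show ?thesis by simp
qed

text \<open>Completing the square. The first factor depends on \<open>x - y\<close> only, so when
  \<open>x\<close> and \<open>y\<close> move together with an integration variable, the whole
  dependence on that variable sits in one Gaussian of variance \<open>s * t / (s + t)\<close>, the
  variance of a Brownian bridge.\<close>

lemma phi_mult_phi:
  assumes "0 < s" "0 < t"
  shows "phi s x * phi t y = phi (s + t) (x - y) * phi (s * t / (s + t)) ((t * x + s * y) / (s + t))"
proof -
  have st: "0 < s + t" using assms by simp
  have 1: "- x\<^sup>2 / (2 * s) + - y\<^sup>2 / (2 * t)
      = - (x - y)\<^sup>2 / (2 * (s + t)) + - ((t * x + s * y) / (s + t))\<^sup>2 / (2 * (s * t / (s + t)))"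
  proof -
    have "- (x - y)\<^sup>2 / (2 * (s + t)) + - ((t * x + s * y) / (s + t))\<^sup>2 / (2 * (s * t / (s + t)))
      = - ((x - y)\<^sup>2 * (s * t) + (t * x + s * y)\<^sup>2) / (2 * (s * t) * (s + t))"
    proof -
      have "- p / (2 * r) + - (u / r)\<^sup>2 / (2 * (q / r)) = - (p * q + u\<^sup>2) / (2 * q * r)"
        if "0 < q" "0 < r" for p q r u :: real
        using that by (simp add: field_simps power2_eq_square)
      from this[OF mult_pos_pos[OF assms] st] show ?thesis .
    qed
    also have "(x - y)\<^sup>2 * (s * t) + (t * x + s * y)\<^sup>2 = (s + t) * (x\<^sup>2 * t + y\<^sup>2 * s)"
      by (simp add: power2_eq_square algebra_simps)
    also have "- ((s + t) * (x\<^sup>2 * t + y\<^sup>2 * s)) / (2 * (s * t) * (s + t)) = - x\<^sup>2 / (2 * s) + - y\<^sup>2 / (2 * t)"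
      using assms st by (simp add: add_divide_distrib diff_divide_distrib)
    finally show ?thesis by simp
  qed
  have "(2 * pi * s) * (2 * pi * t) = (2 * pi * (s + t)) * (2 * pi * (s * t / (s + t)))"
    using st by simp
  then have 2: "(2 * pi * s) powr (-1/2) * (2 * pi * t) powr (-1/2)
     = (2 * pi * (s + t)) powr (-1/2) * (2 * pi * (s * t / (s + t))) powr (-1/2)"
    by (simp only: powr_mult[symmetric])
  have "phi s x * phi t y = ((2 * pi * s) powr (-1/2) * (2 * pi * t) powr (-1/2)) * exp (- x\<^sup>2 / (2 * s) + - y\<^sup>2 / (2 * t))"
    unfolding phi_def exp_add by (simp only: ac_simps)
  also have "\<dots> = phi (s + t) (x - y) * phi (s * t / (s + t)) ((t * x + s * y) / (s + t))"
    unfolding phi_def 1 2 exp_add by (simp only: ac_simps)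
  finally show ?thesis .
qed

section \<open>Closed form for the law of the location of the maximum\<close>

text \<open>The antiderivative is controlled at \<open>a\<close> only through its right limit. This
  matters for \<open>arg_cdf\<close>, which at time 0 takes a value dictated by division by zero and
  in general not equal to its limit. The interval is exhausted from the right by closed
  ones.\<close>

lemma nn_integral_FTC_Ioc:
  fixes f F :: "real \<Rightarrow> real"
  assumes [measurable]: "f \<in> borel_measurable borel" and "a < b"
    and deriv: "\<And>x. a < x \<Longrightarrow> x \<le> b \<Longrightarrow> DERIV F x :> f x"
    and nonneg: "\<And>x. a < x \<Longrightarrow> x \<le> b \<Longrightarrow> 0 \<le> f x"
    and lim: "(F \<longlongrightarrow> A) (at_right a)"
  shows "(\<integral>\<^sup>+x. ennreal (f x) * indicator {a<..b} x \<partial>lborel) = ennreal (F b - A)"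
proof -
  define c where "c n = a + (b - a) / real (Suc n)" for n
  have c: "a < c n" "c n \<le> b" for n
    using \<open>a < b\<close> divide_left_mono[of 1 "real (Suc n)" "b - a"] by (auto simp: c_def)
  have c_lim: "c \<longlonglongrightarrow> a"
    unfolding c_def by real_asymp
  have c_dec: "c n \<le> c m" if "m \<le> n" for m n
    using that \<open>a < b\<close> by (auto simp: c_def intro!: divide_left_mono)
  have "(\<lambda>n. \<integral>\<^sup>+x. ennreal (f x) * indicator {c n..b} x \<partial>lborel)
    \<longlonglongrightarrow> (\<integral>\<^sup>+x. ennreal (f x) * indicator {a<..b} x \<partial>lborel)"
  proof (rule nn_integral_LIMSEQ)
    show "incseq (\<lambda>n x. ennreal (f x) * indicator {c n..b} x)"
    proof (intro monoI le_funI mult_left_mono)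
      fix m n :: nat and x assume "m \<le> n"
      then show "indicator {c m..b} x \<le> (indicator {c n..b} x :: ennreal)"
        using c_dec[of m n] by (simp split: split_indicator)
    qed simp
    fix x
    show "(\<lambda>n. ennreal (f x) * indicator {c n..b} x) \<longlonglongrightarrow> ennreal (f x) * indicator {a<..b} x"
    proof (cases "a < x \<and> x \<le> b")
      case True
      then have "\<forall>\<^sub>F n in sequentially. c n < x"
        using c_lim by (intro order_tendstoD(2)) auto
      then have "\<forall>\<^sub>F n in sequentially. ennreal (f x) * indicator {c n..b} x = ennreal (f x) * indicator {a<..b} x"
        by eventually_elim (use True in auto)
      then show ?thesis
        by (rule tendsto_eventually)
    next
      case False
      then have "indicator {c n..b} x = (0 :: ennreal)" for n
        using c(1)[of n] by (auto split: split_indicator)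
      with False show ?thesis
        by (auto split: split_indicator)
    qed
  qed measurable
  moreover have "(\<integral>\<^sup>+x. ennreal (f x) * indicator {c n..b} x \<partial>lborel) = ennreal (F b - F (c n))" for n
  proof (rule nn_integral_FTC_Icc)
    show "DERIV F x :> f x" "0 \<le> f x" if "x \<in> {c n..b}" for x
      using that c(1)[of n] deriv[of x] nonneg[of x] by auto
  qed (use c in auto)
  moreover have "(\<lambda>n. ennreal (F b - F (c n))) \<longlonglongrightarrow> ennreal (F b - A)"
  proof -
    have "filterlim c (at_right a) sequentially"
      using c c_lim by (intro filterlim_at_withinI) (auto intro!: always_eventually simp: less_imp_neq[THEN not_sym])
    then show ?thesis
      by (intro tendsto_intros filterlim_compose[OF lim])
  qed
  ultimately show ?thesis
    by (auto intro: LIMSEQ_unique)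
qed

text \<open>For a Brownian path of duration \<open>T\<close>, \<open>max_density T x m\<close> is the joint density of increment and
  maximum, \<open>triple_density T x t h\<close> that of increment, location and height of the maximum, and
  \<open>arg_cdf T x t h\<close> the integral of the latter over locations up to \<open>t\<close>.\<close>

definition max_density :: "real \<Rightarrow> real \<Rightarrow> real \<Rightarrow> real" where
  "max_density T x m = (if 0 < m \<and> x < m then 2 * (2 * m - x) / T * phi T (2 * m - x) else 0)"

definition triple_density :: "real \<Rightarrow> real \<Rightarrow> real \<Rightarrow> real \<Rightarrow> real" where
  "triple_density T x t h =
    (if 0 < t \<and> t < T \<and> 0 < h \<and> x < h then
       h * (h - x) / (pi * t powr (3/2) * (T - t) powr (3/2))
         * exp (- (h - x)\<^sup>2 / (2 * (T - t)) - h\<^sup>2 / (2 * t))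
     else 0)"

definition arg_cdf :: "real \<Rightarrow> real \<Rightarrow> real \<Rightarrow> real \<Rightarrow> real" where
  "arg_cdf T x t h =
     (2 * h - x) / T * phi T (2 * h - x) * (1 + erf ((t * (h - x) - (T - t) * h) / sqrt (2 * T * t * (T - t))))
     - x / T * phi T x * (1 - erf ((t * (h - x) + (T - t) * h) / sqrt (2 * T * t * (T - t))))"

lemma measurable_max_density [measurable (raw)]:
  assumes [measurable]: "f \<in> borel_measurable M" "f' \<in> borel_measurable M"
  shows "(\<lambda>w. max_density T (f w) (f' w)) \<in> borel_measurable M"
  unfolding max_density_def by measurable

lemma measurable_triple_density [measurable (raw)]:
  assumes [measurable]: "f \<in> borel_measurable M" "f' \<in> borel_measurable M" "f'' \<in> borel_measurable M"
  shows "(\<lambda>w. triple_density T (f w) (f' w) (f'' w)) \<in> borel_measurable M"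
  unfolding triple_density_def by measurable

lemma triple_density_nonneg: "0 \<le> triple_density T x t h"
  by (simp add: triple_density_def)

text \<open>Differentiating the two error functions produces Gaussians in their arguments.
  Multiplied by their prefactors \<open>phi T (2 * h - x)\<close> and \<open>phi T x\<close>, both
  collapse to the same exponential \<open>E\<close>, so that only rational factors remain to be
  added.\<close>

lemma DERIV_arg_cdf:
  assumes "0 < t" "t < T" "0 < h" "x < h"
  shows "DERIV (\<lambda>t. arg_cdf T x t h) t :> triple_density T x t h"
proof -
  define b where "b = h - x"
  define R where "R = sqrt (t * (T - t))"
  have T: "0 < T" and b: "0 < b" and R: "0 < R" and R2: "R * R = t * (T - t)"
    using assms by (auto simp: R_def b_def)
  have dR: "((\<lambda>t. sqrt (t * (T - t))) has_real_derivative (T - 2 * t) / (2 * R)) (at t)"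
    using assms unfolding R_def
    by (auto intro!: derivative_eq_intros simp: field_simps)
  \<comment> \<open>The arguments of the two error functions are the instances
    \<open>k = - h\<close> and \<open>k = h\<close>, so one computation serves both.\<close>
  have quot: "((\<lambda>t. (t * b + (T - t) * k) / (sqrt (2 * T) * sqrt (t * (T - t)))) has_real_derivative
      T * (b * t - k * (T - t)) / (2 * sqrt (2 * T) * R ^ 3)) (at t)" for k
  proof -
    have "((\<lambda>t. (t * b + (T - t) * k) / (sqrt (2 * T) * sqrt (t * (T - t)))) has_real_derivative
      ((b - k) * (sqrt (2 * T) * R) - (t * b + (T - t) * k) * (sqrt (2 * T) * ((T - 2 * t) / (2 * R))))
        / ((sqrt (2 * T) * R) * (sqrt (2 * T) * R))) (at t)"
      unfolding R_def
      by (rule DERIV_divide[OF _ DERIV_cmult[OF dR[unfolded R_def]]])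
        (use assms T in \<open>auto intro!: derivative_eq_intros\<close>)
    also have "((b - k) * (sqrt (2 * T) * R) - (t * b + (T - t) * k) * (sqrt (2 * T) * ((T - 2 * t) / (2 * R))))
        / ((sqrt (2 * T) * R) * (sqrt (2 * T) * R))
       = (2 * (b - k) * (R * R) - (t * b + (T - t) * k) * (T - 2 * t)) / (2 * sqrt (2 * T) * R ^ 3)"
      using R T by (simp add: field_simps power3_eq_cube)
    also have "2 * (b - k) * (R * R) - (t * b + (T - t) * k) * (T - 2 * t) = T * (b * t - k * (T - t))"
      unfolding R2 by (simp add: algebra_simps)
    finally show ?thesis .
  qed
  define E where "E = exp (- b\<^sup>2 / (2 * (T - t)) - h\<^sup>2 / (2 * t))"
  \<comment> \<open>Completing the square once more; the result depends on \<open>k\<close> only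
    through its square, hence is the same for both signs of \<open>h\<close>.\<close>
  have E: "phi T (b + k) * exp (- ((t * b - (T - t) * k) / (sqrt (2 * T) * R))\<^sup>2)
      = (2 * pi * T) powr (-1/2) * E" if "k\<^sup>2 = h\<^sup>2" for k
  proof -
    have w: "(sqrt (2 * T) * R)\<^sup>2 = 2 * T * (t * (T - t))"
      using T R2 by (simp add: power_mult_distrib power2_eq_square[of R])
    have "- p / (2 * T) + - (u / w)\<^sup>2 = - (p * q + u\<^sup>2) / (2 * T * q)"
      if "w\<^sup>2 = 2 * T * q" "0 < q" for p q u w :: real
      unfolding power_divide that(1) using that(2) T by (simp add: field_simps)
    from this[OF w mult_pos_pos]
    have "- (b + k)\<^sup>2 / (2 * T) + - ((t * b - (T - t) * k) / (sqrt (2 * T) * R))\<^sup>2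
      = - ((b + k)\<^sup>2 * (t * (T - t)) + (t * b - (T - t) * k)\<^sup>2) / (2 * T * (t * (T - t)))"
      using assms by simp
    also have "(b + k)\<^sup>2 * (t * (T - t)) + (t * b - (T - t) * k)\<^sup>2 = T * (b\<^sup>2 * t + k\<^sup>2 * (T - t))"
      by (simp add: power2_eq_square algebra_simps)
    also have "- (T * (b\<^sup>2 * t + k\<^sup>2 * (T - t))) / (2 * T * (t * (T - t))) = - b\<^sup>2 / (2 * (T - t)) - h\<^sup>2 / (2 * t)"
      using T assms that by (simp add: add_divide_distrib diff_divide_distrib)
    finally have "exp (- (b + k)\<^sup>2 / (2 * T)) * exp (- ((t * b - (T - t) * k) / (sqrt (2 * T) * R))\<^sup>2) = E"
      unfolding E_def exp_add[symmetric] by (rule arg_cong)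
    then show ?thesis
      unfolding phi_def by (simp only: mult.assoc)
  qed
  have sq: "sqrt (2 * T * t * (T - t)) = sqrt (2 * T) * sqrt (t * (T - t))" for t
    by (simp add: mult.assoc flip: real_sqrt_mult)
  have x: "x = h - b" by (simp add: b_def)
  have F: "(\<lambda>t. arg_cdf T x t h) = (\<lambda>t.
      (b + h) / T * phi T (b + h) * (1 + erf ((t * b + (T - t) * (- h)) / (sqrt (2 * T) * sqrt (t * (T - t)))))
     - (h - b) / T * phi T (b + - h) * (1 - erf ((t * b + (T - t) * h) / (sqrt (2 * T) * sqrt (t * (T - t))))))"
    unfolding arg_cdf_def sq x by (simp add: add.commute phi_minus[of T "h - b", symmetric])
  define D where "D k = T * (b * t - k * (T - t)) / (2 * sqrt (2 * T) * R ^ 3)" for k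
  have "((\<lambda>t. arg_cdf T x t h) has_real_derivative
      (b + h) / T * phi T (b + h) * (2 / sqrt pi * exp (- ((t * b + (T - t) * (- h)) / (sqrt (2 * T) * R))\<^sup>2) * D (- h))
      - (h - b) / T * phi T (b + - h) * (- (2 / sqrt pi * exp (- ((t * b + (T - t) * h) / (sqrt (2 * T) * R))\<^sup>2) * D h))) (at t)"
    unfolding F R_def D_def
    using DERIV_diff[OF
        DERIV_cmult[OF DERIV_add[OF DERIV_const[of 1] DERIV_erf[OF quot[of "- h"]]], of "(b + h) / T * phi T (b + h)"]
        DERIV_cmult[OF DERIV_diff[OF DERIV_const[of 1] DERIV_erf[OF quot[of h]]], of "(h - b) / T * phi T (b + - h)"]]
    by (simp only: add_0_left diff_0 R_def)
  also have "(b + h) / T * phi T (b + h) * (2 / sqrt pi * exp (- ((t * b + (T - t) * (- h)) / (sqrt (2 * T) * R))\<^sup>2) * D (- h))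
      - (h - b) / T * phi T (b + - h) * (- (2 / sqrt pi * exp (- ((t * b + (T - t) * h) / (sqrt (2 * T) * R))\<^sup>2) * D h))
     = 2 / (T * sqrt pi) * ((b + h) * D (- h) * (phi T (b + h) * exp (- ((t * b - (T - t) * h) / (sqrt (2 * T) * R))\<^sup>2))
        + (h - b) * D h * (phi T (b + - h) * exp (- ((t * b - (T - t) * (- h)) / (sqrt (2 * T) * R))\<^sup>2)))"
  proof -
    have "p / T * P * (2 / q * X * d) - r / T * P' * (- (2 / q * X' * d')) = 2 / (T * q) * (p * d * (P * X) + r * d' * (P' * X'))"
      for p q r P X d P' X' d' :: real
      by (simp add: divide_inverse algebra_simps)
    then show ?thesis by (simp only: mult_minus_right minus_minus diff_minus_eq_add add_uminus_conv_diff)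
  qed
  also have "\<dots> = 2 / (T * sqrt pi) * ((2 * pi * T) powr (-1/2) * E) * ((b + h) * D (- h) + (h - b) * D h)"
  proof -
    have "c * (p * Y + q * Y) = c * Y * (p + q)" for c p q Y :: real
      by (simp add: algebra_simps)
    then show ?thesis unfolding E[OF refl] E[OF power2_minus] .
  qed
  also have "(b + h) * D (- h) + (h - b) * D h = h * b * T\<^sup>2 / (sqrt (2 * T) * R ^ 3)"
  proof -
    have "(b + h) * D (- h) + (h - b) * D h
      = T * ((b + h) * (b * t + h * (T - t)) + (h - b) * (b * t - h * (T - t))) / (2 * sqrt (2 * T) * R ^ 3)"
      unfolding D_def times_divide_eq_right add_divide_distrib[symmetric]
      by (rule arg_cong2[where f="(/)"]) (simp_all add: algebra_simps)
    also have "(b + h) * (b * t + h * (T - t)) + (h - b) * (b * t - h * (T - t)) = 2 * h * b * T"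
      by (simp add: algebra_simps)
    finally show ?thesis using T by (simp add: field_simps power2_eq_square)
  qed
  also have "2 / (T * sqrt pi) * ((2 * pi * T) powr (-1/2) * E) * (h * b * T\<^sup>2 / (sqrt (2 * T) * R ^ 3))
      = h * b / (pi * R ^ 3) * E"
  proof -
    have "(2 * pi * T) powr (-1/2) = 1 / (sqrt pi * sqrt (2 * T))"
      using T by (simp add: powr_minus powr_half_sqrt real_sqrt_mult divide_simps)
    moreover have "2 / (T * p) * (1 / (p * q) * E) * (h * b * T\<^sup>2 / (q * R ^ 3)) = h * b / (p * p * R ^ 3) * E"
      if "0 < p" "0 < q" "q * q = 2 * T" for p q
    proof -
      have "2 / (T * p) * (1 / (p * q) * E) * (h * b * T\<^sup>2 / (q * R ^ 3))
        = (2 * T) * (h * b * T * E) / (T * p * p * (q * q) * R ^ 3)"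
        by (simp add: power2_eq_square ac_simps)
      then show ?thesis using T that by simp
    qed
    ultimately show ?thesis using T by simp
  qed
  also have "R ^ 3 = t powr (3/2) * (T - t) powr (3/2)"
    using assms by (simp add: R_def powr_powr powr_half_sqrt[symmetric] powr_mult flip: powr_realpow)
  finally show ?thesis
    using assms by (simp add: triple_density_def E_def b_def mult.assoc)
qed

section \<open>The killed heat kernel and the integrals of the densities\<close>

lemma g_commute: "g \<sigma> x y = g \<sigma> y x"
  using phi_minus[of \<sigma> "x - y"] by (simp add: g_def add.commute)

lemma g_nonneg: "0 < \<sigma> \<Longrightarrow> 0 \<le> x \<Longrightarrow> 0 \<le> y \<Longrightarrow> 0 \<le> g \<sigma> x y"
  by (simp add: g_def phi_antimono)

lemma measurable_g [measurable (raw)]: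
  assumes [measurable]: "f \<in> borel_measurable M" "f' \<in> borel_measurable M"
  shows "(\<lambda>w. g \<sigma> (f w) (f' w)) \<in> borel_measurable M"
  unfolding g_def by measurable

lemma nn_integral_lborel_reflect:
  fixes f :: "real \<Rightarrow> ennreal"
  assumes [measurable]: "f \<in> borel_measurable borel"
  shows "(\<integral>\<^sup>+x. f (c - x) \<partial>lborel) = (\<integral>\<^sup>+x. f x \<partial>lborel)"
  using nn_integral_real_affine[OF assms, of "-1" c] by simp

lemma nn_integral_lborel_shift:
  fixes f :: "real \<Rightarrow> ennreal"
  assumes [measurable]: "f \<in> borel_measurable borel"
  shows "(\<integral>\<^sup>+x. f (c + x) \<partial>lborel) = (\<integral>\<^sup>+x. f x \<partial>lborel)"
  using nn_integral_real_affine[OF assms, of 1 c] by simp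

text \<open>As \<open>t\<close> decreases to 0 the arguments of the error functions tend to minus
  and plus infinity, because \<open>h\<close> is positive, and both brackets in
  \<open>arg_cdf\<close> vanish.\<close>

lemma arg_cdf_tendsto_0:
  assumes "0 < T" "0 < h" "x < h"
  shows "((\<lambda>t. arg_cdf T x t h) \<longlongrightarrow> 0) (at_right 0)"
proof -
  have "filterlim (\<lambda>t. (t * (h - x) - (T - t) * h) / sqrt (2 * T * t * (T - t))) at_bot (at_right 0)"
    using assms by real_asymp
  from filterlim_compose[OF erf_at_bot this]
  have 1: "((\<lambda>t. erf ((t * (h - x) - (T - t) * h) / sqrt (2 * T * t * (T - t)))) \<longlongrightarrow> -1) (at_right 0)" .
  have "filterlim (\<lambda>t. (t * (h - x) + (T - t) * h) / sqrt (2 * T * t * (T - t))) at_top (at_right 0)"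
    using assms by real_asymp
  from filterlim_compose[OF erf_at_top this]
  have 2: "((\<lambda>t. erf ((t * (h - x) + (T - t) * h) / sqrt (2 * T * t * (T - t)))) \<longlongrightarrow> 1) (at_right 0)" .
  have "((\<lambda>t. arg_cdf T x t h) \<longlongrightarrow>
     (2 * h - x) / T * phi T (2 * h - x) * (1 + (-1)) - x / T * phi T x * (1 - 1)) (at_right 0)"
    unfolding arg_cdf_def by (intro tendsto_intros 1 2)
  then show ?thesis by simp
qed

lemma nn_integral_triple_density_time:
  assumes "0 < t" "t < T" "0 < h" "x < h"
  shows "(\<integral>\<^sup>+u. ennreal (triple_density T x u h) * indicator {..t} u \<partial>lborel) = ennreal (arg_cdf T x t h)"
proof -
  have "(\<integral>\<^sup>+u. ennreal (triple_density T x u h) * indicator {..t} u \<partial>lborel)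
    = (\<integral>\<^sup>+u. ennreal (triple_density T x u h) * indicator {0<..t} u \<partial>lborel)"
    by (intro nn_integral_cong) (auto simp: triple_density_def split: split_indicator)
  also have "\<dots> = ennreal (arg_cdf T x t h - 0)"
    using assms
    by (intro nn_integral_FTC_Ioc arg_cdf_tendsto_0 triple_density_nonneg DERIV_arg_cdf) auto
  finally show ?thesis by simp
qed

text \<open>The origin of \<open>arg_cdf\<close>: the first piece, of duration \<open>t\<close>, has
  maximum \<open>h\<close> and ends at \<open>y\<close>; the second passes from depth
  \<open>h - y\<close> below that level to depth \<open>h - x\<close> without crossing it, with
  density \<open>g\<close>. The integral runs over the intermediate position.\<close>

lemma nn_integral_max_density_g:
  assumes "0 < t" "t < T" "0 < h" "x < h"
  shows "(\<integral>\<^sup>+y. ennreal (max_density t y h) * ennreal (g (T - t) (h - y) (h - x)) \<partial>lborel)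
    = ennreal (arg_cdf T x t h)"
proof -
  define b where "b = h - x"
  define \<tau> where "\<tau> = T - t"
  define \<sigma> where "\<sigma> = t * \<tau> / T"
  define f where "f z = 2 * (h + z) / t * phi t (h + z) * g \<tau> z b" for z
  \<comment> \<open>The antiderivative of \<open>f\<close>, with \<open>z\<close> the depth of the
    intermediate position below the maximum. For \<open>k = b\<close> and \<open>k = - b\<close>,
    \<open>phi_mult_phi\<close> makes \<open>phi t (h + z) * phi \<tau> (z - k)\<close> a Gaussian
    in \<open>z\<close> of variance \<open>\<sigma>\<close> centred at
    \<open>c = (t * k - \<tau> * h) / T\<close>. Writing \<open>h + z\<close> as
    \<open>(z - c) + t * (h + k) / T\<close>, the centred part integrates to the Gaussian term with
    coefficient \<open>- 2 * \<tau> / T\<close>, and the constant part to the error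
    function.\<close>
  define W where "W z = - (2 * \<tau> / T) * phi t (h + z) * g \<tau> z b
     + (h + b) / T * phi T (h + b) * erf ((z - (t * b - \<tau> * h) / T) / sqrt (2 * \<sigma>))
     - (h - b) / T * phi T (h - b) * erf ((z - (- t * b - \<tau> * h) / T) / sqrt (2 * \<sigma>))" for z
  have pos: "0 < T" "0 < \<tau>" "0 < b" "0 < \<sigma>" and T: "t + \<tau> = T"
    using assms by (auto simp: b_def \<tau>_def \<sigma>_def)
  have deriv: "DERIV W z :> f z" for z
  proof -
    define p where "p k = phi t (h + z) * phi \<tau> (z - k)" for k
    have p: "phi T (h + k) * phi \<sigma> (z - (t * k - \<tau> * h) / T) = p k" for k
    proof -
      have "(\<tau> * (h + z) + t * (z - k)) / T = ((\<tau> + t) * z - (t * k - \<tau> * h)) / T"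
        by (simp add: algebra_simps)
      also have "\<dots> = z - (t * k - \<tau> * h) / T"
        using pos T by (simp add: diff_divide_distrib add.commute)
      finally show ?thesis
        using phi_mult_phi[OF \<open>0 < t\<close> \<open>0 < \<tau>\<close>, of "h + z" "z - k"] unfolding T p_def \<sigma>_def by simp
    qed
    have g: "g \<tau> z b = phi \<tau> (z - b) - phi \<tau> (z - - b)" for z
      by (simp add: g_def)
    have d1: "((\<lambda>z. - (2 * \<tau> / T) * phi t (h + z) * phi \<tau> (z - k)) has_real_derivative
        2 / T * p k * (\<tau> * (h + z) / t + (z - k))) (at z)" for k
    proof -
      have "((\<lambda>z. - (2 * \<tau> / T) * phi t (h + z) * phi \<tau> (z - k)) has_real_derivative
        - (2 * \<tau> / T) * (- (h + z) / t * phi t (h + z) * (0 + 1)) * phi \<tau> (z - k)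
        + - (z - k) / \<tau> * phi \<tau> (z - k) * (1 - 0) * (- (2 * \<tau> / T) * phi t (h + z))) (at z)"
        by (intro DERIV_mult DERIV_cmult DERIV_phi DERIV_add DERIV_diff DERIV_ident DERIV_const)
      also have "- (2 * \<tau> / T) * (- (h + z) / t * A * (0 + 1)) * B
        + - (z - k) / \<tau> * B * (1 - 0) * (- (2 * \<tau> / T) * A)
        = 2 / T * (A * B) * (\<tau> * (h + z) / t + (z - k))" for A B
      proof -
        have "- (z - k) / \<tau> * B * (1 - 0) * (- (2 * \<tau> / T) * A) = 2 / T * (A * B) * (z - k)"
          using pos by (simp add: field_simps)
        then show ?thesis by (simp add: divide_inverse algebra_simps)
      qed
      finally show ?thesis unfolding p_def .
    qed
    have d2: "((\<lambda>z. (h + k) / T * phi T (h + k) * erf ((z - (t * k - \<tau> * h) / T) / sqrt (2 * \<sigma>)))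
        has_real_derivative 2 / T * p k * (h + k)) (at z)" for k
    proof -
      have "((\<lambda>z. (h + k) / T * phi T (h + k) * erf ((z - (t * k - \<tau> * h) / T) / sqrt (2 * \<sigma>)))
        has_real_derivative (h + k) / T * phi T (h + k) * (2 * phi \<sigma> (z - (t * k - \<tau> * h) / T) * (1 - 0))) (at z)"
        by (intro DERIV_cmult DERIV_erf_phi DERIV_diff DERIV_ident DERIV_const pos)
      then show ?thesis by (simp add: p[symmetric] ac_simps)
    qed
    have W: "W = (\<lambda>z. (- (2 * \<tau> / T) * phi t (h + z) * phi \<tau> (z - b)
          + (h + b) / T * phi T (h + b) * erf ((z - (t * b - \<tau> * h) / T) / sqrt (2 * \<sigma>)))
        - (- (2 * \<tau> / T) * phi t (h + z) * phi \<tau> (z - - b)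
          + (h + - b) / T * phi T (h + - b) * erf ((z - (t * - b - \<tau> * h) / T) / sqrt (2 * \<sigma>))))"
      unfolding W_def g by (rule ext) (simp add: right_diff_distrib diff_divide_distrib)
    have sum: "2 / T * p k * (\<tau> * (h + z) / t + (z - k)) + 2 / T * p k * (h + k) = 2 * (h + z) / t * p k" for k
    proof -
      have "\<tau> * (h + z) / t + (z - k) + (h + k) = T * (h + z) / t"
        using assms(1) unfolding T[symmetric] by (simp add: field_simps)
      moreover have "2 / T * p k * (\<tau> * (h + z) / t + (z - k)) + 2 / T * p k * (h + k)
        = 2 / T * p k * (\<tau> * (h + z) / t + (z - k) + (h + k))"
        by (simp only: distrib_left)
      ultimately show ?thesis using pos by simp
    qed
    have "(W has_real_derivative 2 * (h + z) / t * p b - 2 * (h + z) / t * p (- b)) (at z)"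
      unfolding W sum[symmetric] by (intro DERIV_diff DERIV_add d1 d2)
    also have "2 * (h + z) / t * p b - 2 * (h + z) / t * p (- b) = f z"
      unfolding f_def g p_def by (simp add: right_diff_distrib)
    finally show ?thesis .
  qed
  have lim: "(W \<longlongrightarrow> (h + b) / T * phi T (h + b) - (h - b) / T * phi T (h - b)) at_top"
  proof -
    have e: "((\<lambda>z. erf ((z - c) / sqrt (2 * \<sigma>))) \<longlongrightarrow> 1) at_top" for c
    proof (rule filterlim_compose[OF erf_at_top])
      show "LIM z at_top. (z - c) / sqrt (2 * \<sigma>) :> at_top"
        using pos by real_asymp
    qed
    have p: "((\<lambda>z. phi \<sigma> (z + c)) \<longlongrightarrow> 0) at_top" if "0 < \<sigma>" for \<sigma> c
      using that unfolding phi_def by real_asymp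
    have "(W \<longlongrightarrow> - (2 * \<tau> / T) * 0 * (0 - 0)
       + (h + b) / T * phi T (h + b) * 1 - (h - b) / T * phi T (h - b) * 1) at_top"
      unfolding W_def[abs_def] g_def
      using p[OF \<open>0 < t\<close>, of h] p[OF \<open>0 < \<tau>\<close>, of b] p[OF \<open>0 < \<tau>\<close>, of "- b"]
      by (intro tendsto_intros e) (simp_all add: add.commute)
    then show ?thesis by simp
  qed
  have W0: "(h + b) / T * phi T (h + b) - (h - b) / T * phi T (h - b) - W 0 = arg_cdf T x t h"
  proof -
    have "T * sqrt (2 * \<sigma>) = sqrt (2 * T * t * (T - t))"
    proof -
      have "T * sqrt (2 * \<sigma>) = sqrt (T\<^sup>2 * (2 * \<sigma>))"
        using pos by (simp add: real_sqrt_mult)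
      also have "T\<^sup>2 * (2 * \<sigma>) = 2 * T * t * (T - t)"
        using pos by (simp add: \<sigma>_def \<tau>_def power2_eq_square)
      finally show ?thesis .
    qed
    then have e: "erf ((0 - u / T) / sqrt (2 * \<sigma>)) = - erf (u / sqrt (2 * T * t * (T - t)))" for u
      by (simp add: erf_minus[symmetric])
    have e': "erf ((- t * b - \<tau> * h) / v) = - erf ((t * b + \<tau> * h) / v)" for v
      by (subst erf_minus[symmetric]) (simp add: diff_divide_distrib add_divide_distrib)
    \<comment> \<open>At depth 0 the killed kernel vanishes, so the lower limit contributes error
      functions only.\<close>
    have "g \<tau> 0 b = 0"
      by (simp add: g_def phi_minus)
    then show ?thesis
      unfolding W_def e unfolding e' unfolding arg_cdf_def b_def \<tau>_def by (simp add: algebra_simps)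
  qed
  have "(\<integral>\<^sup>+y. ennreal (max_density t y h) * ennreal (g (T - t) (h - y) (h - x)) \<partial>lborel)
    = (\<integral>\<^sup>+z. ennreal (max_density t (h - z) h) * ennreal (g (T - t) (h - (h - z)) (h - x)) \<partial>lborel)"
    by (rule nn_integral_lborel_reflect[symmetric]) measurable
  also have "\<dots> = (\<integral>\<^sup>+z. ennreal (f z) * indicator {0..} z \<partial>lborel)"
  proof (rule nn_integral_cong)
    fix z
    show "ennreal (max_density t (h - z) h) * ennreal (g (T - t) (h - (h - z)) (h - x))
      = ennreal (f z) * indicator {0..} z"
    proof (cases "0 < z")
      case True
      then show ?thesis
        using assms pos g_nonneg[of \<tau> z b]
        by (simp add: max_density_def f_def b_def \<tau>_def phi_nonneg ennreal_mult'[symmetric] ac_simps)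
    next
      case False
      then show ?thesis
        by (cases "z = 0") (simp_all add: max_density_def f_def g_def phi_minus)
    qed
  qed
  also have "\<dots> = ennreal ((h + b) / T * phi T (h + b) - (h - b) / T * phi T (h - b) - W 0)"
    by (rule nn_integral_FTC_atLeast[OF _ deriv _ lim])
      (use assms pos g_nonneg[OF \<open>0 < \<tau>\<close>] in \<open>auto simp: f_def[abs_def] phi_nonneg\<close>)
  finally show ?thesis unfolding W0 .
qed

text \<open>In \<open>m\<close>, \<open>max_density\<close> is the derivative of
  \<open>- phi T (2 * m - x)\<close>, so its integral up to \<open>c\<close> is a difference of two
  Gaussians, which is \<open>g\<close>.\<close>

lemma nn_integral_max_density_max:
  assumes "0 < T"
  shows "(\<integral>\<^sup>+m. ennreal (max_density T x m) * indicator {..c} m \<partial>lborel)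
    = ennreal (if 0 < c \<and> x < c then g T c (c - x) else 0)"
proof (cases "0 < c \<and> x < c")
  case True
  \<comment> \<open>The support of the density in \<open>m\<close> starts at \<open>a\<close>. The
    boundary term is \<open>phi T x\<close> in either case: directly if \<open>a = x\<close>, by
    evenness of \<open>phi\<close> if \<open>a = 0\<close>.\<close>
  define a where "a = max 0 x"
  have a: "a < c" "0 \<le> a" "x \<le> a" and ax: "phi T (2 * a - x) = phi T x"
    using True by (auto simp: a_def max_def phi_minus)
  have "(\<integral>\<^sup>+m. ennreal (max_density T x m) * indicator {..c} m \<partial>lborel)
    = (\<integral>\<^sup>+m. ennreal (2 * (2 * m - x) / T * phi T (2 * m - x)) * indicator {a<..c} m \<partial>lborel)"
    by (intro nn_integral_cong) (auto simp: max_density_def a_def split: split_indicator)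
  also have "\<dots> = ennreal (- phi T (2 * c - x) - (- phi T (2 * a - x)))"
  proof (rule nn_integral_FTC_Ioc)
    fix m assume "a < m"
    show "DERIV (\<lambda>m. - phi T (2 * m - x)) m :> 2 * (2 * m - x) / T * phi T (2 * m - x)"
      by (auto intro!: derivative_eq_intros simp: divide_inverse algebra_simps)
    show "0 \<le> 2 * (2 * m - x) / T * phi T (2 * m - x)"
      using \<open>a < m\<close> a assms by (simp add: phi_nonneg)
  next
    have "continuous_on UNIV (\<lambda>m. - phi T (2 * m - x))"
      by (intro continuous_intros)
    then have "((\<lambda>m. - phi T (2 * m - x)) \<longlongrightarrow> - phi T (2 * a - x)) (at a)"
      unfolding continuous_on_def by blast
    then show "((\<lambda>m. - phi T (2 * m - x)) \<longlongrightarrow> - phi T (2 * a - x)) (at_right a)"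
      unfolding filterlim_at_split by blast
  qed (use a in auto)
  also have "- phi T (2 * c - x) - (- phi T (2 * a - x)) = g T c (c - x)"
    by (simp add: g_def ax)
  finally show ?thesis using True by simp
next
  case False
  then have "(\<integral>\<^sup>+m. ennreal (max_density T x m) * indicator {..c} m \<partial>lborel) = (\<integral>\<^sup>+m. 0 \<partial>(lborel :: real measure))"
    by (intro nn_integral_cong) (auto simp: max_density_def split: split_indicator)
  then show ?thesis by (simp only: if_not_P[OF False]) simp
qed

text \<open>The mass that survives killing at height \<open>c\<close>, that is, the probability that
  the path stays below \<open>c\<close> for time \<open>T\<close>. It supplies the error function in
  \<open>density_after\<close>.\<close>

lemma nn_integral_g:
  assumes "0 < T" "0 < c"
  shows "(\<integral>\<^sup>+x. ennreal (if x < c then g T c (c - x) else 0) \<partial>lborel) = ennreal (erf (c / sqrt (2 * T)))"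
proof -
  define W where "W y = - (1/2) * (erf ((c - y) / sqrt (2 * T)) + erf ((c + y) / sqrt (2 * T)))" for y
  have "(\<integral>\<^sup>+x. ennreal (if x < c then g T c (c - x) else 0) \<partial>lborel)
    = (\<integral>\<^sup>+y. ennreal (if c - y < c then g T c (c - (c - y)) else 0) \<partial>lborel)"
    by (rule nn_integral_lborel_reflect[symmetric]) measurable
  also have "\<dots> = (\<integral>\<^sup>+y. ennreal (g T c y) * indicator {0..} y \<partial>lborel)"
    by (intro nn_integral_cong) (auto simp: g_def split: split_indicator)
  also have "\<dots> = ennreal (0 - W 0)"
  proof (rule nn_integral_FTC_atLeast)
    show "DERIV W y :> g T c y" for y
    proof -
      have "(W has_real_derivative - (1/2) * (2 * phi T (c - y) * (0 - 1) + 2 * phi T (c + y) * (0 + 1))) (at y)"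
        unfolding W_def
        by (intro DERIV_cmult DERIV_add DERIV_diff DERIV_erf_phi DERIV_ident DERIV_const assms)
      then show ?thesis by (simp add: g_def algebra_simps)
    qed
    have "((\<lambda>y. erf ((c - y) / sqrt (2 * T))) \<longlongrightarrow> -1) at_top"
      by (rule filterlim_compose[OF erf_at_bot]) (use assms in real_asymp)
    moreover have "((\<lambda>y. erf ((c + y) / sqrt (2 * T))) \<longlongrightarrow> 1) at_top"
      by (rule filterlim_compose[OF erf_at_top]) (use assms in real_asymp)
    ultimately have "(W \<longlongrightarrow> - (1/2) * (-1 + 1)) at_top"
      unfolding W_def[abs_def] by (intro tendsto_intros)
    then show "(W \<longlongrightarrow> 0) at_top" by simp
  qed (use assms g_nonneg in auto)
  finally show ?thesis by (simp add: W_def)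
qed

text \<open>The law of (location, height) of the maximum over duration \<open>T\<close>: the arcsine
  density \<open>1 / (pi * sqrt (t * (T - t)))\<close> of the location times the Rayleigh density
  \<open>h / t * exp (- h\<^sup>2 / (2 * t))\<close> of the height.\<close>

definition pair_density :: "real \<Rightarrow> real \<Rightarrow> real \<Rightarrow> real" where
  "pair_density T t h =
    (if 0 < t \<and> t < T \<and> 0 < h then
       h / (pi * t powr (3/2) * (T - t) powr (1/2)) * exp (- h\<^sup>2 / (2 * t)) else 0)"

text \<open>In the variable \<open>y = h - x\<close> the integrand is \<open>y\<close> times a
  Gaussian, with an elementary antiderivative; the factor \<open>T - t\<close> that appears lowers
  the exponent from \<open>3/2\<close> to \<open>1/2\<close>.\<close>

lemma nn_integral_triple_density:
  "(\<integral>\<^sup>+x. ennreal (triple_density T x t h) \<partial>lborel) = ennreal (pair_density T t h)"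
proof (cases "0 < t \<and> t < T \<and> 0 < h")
  case True
  define \<tau> where "\<tau> = T - t"
  define K where "K = h / (pi * t powr (3/2) * \<tau> powr (3/2)) * exp (- h\<^sup>2 / (2 * t))"
  have \<tau>: "0 < \<tau>" and K: "0 < K" using True by (auto simp: \<tau>_def K_def)
  have "(\<integral>\<^sup>+x. ennreal (triple_density T x t h) \<partial>lborel)
     = (\<integral>\<^sup>+y. ennreal (triple_density T (h - y) t h) \<partial>lborel)"
    by (rule nn_integral_lborel_reflect[symmetric]) measurable
  also have "\<dots> = (\<integral>\<^sup>+y. ennreal (K * y * exp (- y\<^sup>2 / (2 * \<tau>))) * indicator {0..} y \<partial>lborel)"
  proof (intro nn_integral_cong)
    fix y
    have "exp (- y\<^sup>2 / (2 * \<tau>) - h\<^sup>2 / (2 * t)) = exp (- y\<^sup>2 / (2 * \<tau>)) * exp (- h\<^sup>2 / (2 * t))"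
      by (simp flip: exp_add)
    then show "ennreal (triple_density T (h - y) t h) = ennreal (K * y * exp (- y\<^sup>2 / (2 * \<tau>))) * indicator {0..} y"
      using True unfolding triple_density_def K_def \<tau>_def by (simp split: split_indicator)
  qed
  also have "\<dots> = ennreal (0 - (- K * \<tau> * exp (- 0\<^sup>2 / (2 * \<tau>))))"
  proof (rule nn_integral_FTC_atLeast)
    show "DERIV (\<lambda>y. - K * \<tau> * exp (- y\<^sup>2 / (2 * \<tau>))) y :> K * y * exp (- y\<^sup>2 / (2 * \<tau>))" for y
      using \<tau> by (auto intro!: derivative_eq_intros)
    show "((\<lambda>y. - K * \<tau> * exp (- y\<^sup>2 / (2 * \<tau>))) \<longlongrightarrow> 0) at_top"
      using \<tau> by real_asymp
  qed (use K in auto)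
  also have "0 - (- K * \<tau> * exp (- 0\<^sup>2 / (2 * \<tau>))) = pair_density T t h"
  proof -
    have "\<tau> powr (3/2) = \<tau> * \<tau> powr (1/2)"
      using powr_add[of \<tau> 1 "1/2"] \<tau> by simp
    then show ?thesis
      using True \<tau> by (simp add: pair_density_def K_def \<tau>_def)
  qed
  finally show ?thesis .
next
  case False
  then have "triple_density T x t h = 0" for x by (auto simp: triple_density_def)
  with False show ?thesis by (auto simp: pair_density_def)
qed

section \<open>Independence of path segments\<close>

locale bm01 = prob_space M for M :: "'a measure" +
  fixes B :: "real \<Rightarrow> 'a \<Rightarrow> real"
  assumes brownian: "brownian_motion_01 M B"
begin

lemma measurable_B: "t \<in> {0..1} \<Longrightarrow> B t \<in> borel_measurable M"
  using brownian by (simp add: brownian_motion_01_def)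

lemma continuous_B: "\<omega> \<in> space M \<Longrightarrow> continuous_on {0..1} (\<lambda>t. B t \<omega>)"
  using brownian by (simp add: brownian_motion_01_def)

lemma distributed_incr:
  "0 \<le> u \<Longrightarrow> u < v \<Longrightarrow> v \<le> 1 \<Longrightarrow>
    distributed M lborel (\<lambda>\<omega>. B v \<omega> - B u \<omega>) (normal_density 0 (sqrt (v - u)))"
  using brownian by (simp add: brownian_motion_01_def)

lemma indep_incr_grid:
  "0 \<le> t 0 \<Longrightarrow> (\<And>i. i < n \<Longrightarrow> t i \<le> t (Suc i)) \<Longrightarrow> t n \<le> 1 \<Longrightarrow>
    indep_vars (\<lambda>_. borel) (\<lambda>i \<omega>. B (t (Suc i)) \<omega> - B (t i) \<omega>) {..<n}"
  using brownian by (simp add: brownian_motion_01_def)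

definition incr_events :: "real \<Rightarrow> real set \<Rightarrow> 'a set set" where
  "incr_events u S = {(\<lambda>\<omega>. B r \<omega> - B u \<omega>) -` A \<inter> space M | r A. r \<in> S \<and> A \<in> sets borel}"

text \<open>The information in the path on \<open>{u..v}\<close> as seen from its starting value.
  Only increments enter, which is what makes consecutive segments independent.\<close>

definition seg :: "real \<Rightarrow> real \<Rightarrow> 'a measure" where
  "seg u v = sigma (space M) (incr_events u {u..v})"

lemma incr_events_Pow: "incr_events u S \<subseteq> Pow (space M)"
  by (auto simp: incr_events_def)

lemma incr_events_mono: "S \<subseteq> S' \<Longrightarrow> incr_events u S \<subseteq> incr_events u S'"
  unfolding incr_events_def by blast

lemma space_seg [simp]: "space (seg u v) = space M"
  by (auto simp: seg_def incr_events_def intro!: space_measure_of)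

lemma sets_seg: "sets (seg u v) = sigma_sets (space M) (incr_events u {u..v})"
  by (auto simp: seg_def incr_events_def intro!: sets_measure_of)

lemma incr_events_subset:
  "S \<subseteq> {0..1} \<Longrightarrow> u \<in> {0..1} \<Longrightarrow> incr_events u S \<subseteq> events"
  unfolding incr_events_def
  by (auto intro!: measurable_sets[OF borel_measurable_diff] measurable_B)

lemma seg_subset: "0 \<le> u \<Longrightarrow> u \<le> v \<Longrightarrow> v \<le> 1 \<Longrightarrow> sets (seg u v) \<subseteq> events"
  unfolding sets_seg by (intro sets.sigma_sets_subset incr_events_subset) auto

lemma measurable_seg_M:
  assumes "X \<in> measurable (seg u v) N" "0 \<le> u" "u \<le> v" "v \<le> 1"
  shows "X \<in> measurable M N"
proof (rule measurableI)
  show "X \<omega> \<in> space N" if "\<omega> \<in> space M" for \<omega>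
    using measurable_space[OF assms(1)] that by simp
  show "X -` A \<inter> space M \<in> events" if "A \<in> sets N" for A
    using measurable_sets[OF assms(1) that] seg_subset[OF assms(2-4)] by auto
qed

lemma measurable_seg_incr:
  assumes "u \<le> q" "q \<le> v" "u \<le> r" "r \<le> v"
  shows "(\<lambda>\<omega>. B r \<omega> - B q \<omega>) \<in> borel_measurable (seg u v)"
proof -
  have *: "(\<lambda>\<omega>. B r \<omega> - B u \<omega>) \<in> borel_measurable (seg u v)" if "u \<le> r" "r \<le> v" for r
  proof (rule measurableI)
    fix A :: "real set" assume "A \<in> sets borel"
    with that show "(\<lambda>\<omega>. B r \<omega> - B u \<omega>) -` A \<inter> space (seg u v) \<in> sets (seg u v)"
      unfolding sets_seg by (intro sigma_sets.Basic) (auto simp: incr_events_def)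
  qed simp
  have "(\<lambda>\<omega>. (B r \<omega> - B u \<omega>) - (B q \<omega> - B u \<omega>)) \<in> borel_measurable (seg u v)"
    by (intro borel_measurable_diff * assms)
  then show ?thesis by simp
qed

lemma measurable_seg_mono:
  assumes "X \<in> measurable (seg q r) N" "u \<le> q" "q \<le> r" "r \<le> v"
  shows "X \<in> measurable (seg u v) N"
proof (rule measurableI)
  show "X \<omega> \<in> space N" if "\<omega> \<in> space (seg u v)" for \<omega>
    using measurable_space[OF assms(1)] that by simp
  have "sets (seg q r) \<subseteq> sets (seg u v)"
    unfolding sets_seg[of q r] space_seg[symmetric, of u v]
  proof (rule sets.sigma_sets_subset, rule subsetI)
    fix X assume "X \<in> incr_events q {q..r}"
    then obtain p A where p: "p \<in> {q..r}" "A \<in> sets borel"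
      and X: "X = (\<lambda>\<omega>. B p \<omega> - B q \<omega>) -` A \<inter> space (seg u v)"
      by (auto simp: incr_events_def)
    show "X \<in> sets (seg u v)"
      unfolding X using assms p by (intro measurable_sets[OF measurable_seg_incr]) auto
  qed
  then show "X -` A \<inter> space (seg u v) \<in> sets (seg u v)" if "A \<in> sets N" for A
    using measurable_sets[OF assms(1) that] by auto
qed

text \<open>All finitely many times are merged with \<open>u\<close> and \<open>v\<close> into one
  increasing grid that contains \<open>v\<close>. Every increment from \<open>u\<close> is a sum of
  grid increments before \<open>v\<close>, every increment from \<open>v\<close> a sum of those
  after it, and the grid increments are independent.\<close>

lemma indep_incr_events_finite:
  assumes "0 \<le> u" "u \<le> v" "v \<le> w" "w \<le> 1"
    and S: "finite S" "S \<subseteq> {u..v}" and S': "finite S'" "S' \<subseteq> {v..w}"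
  shows "indep_set (sigma_sets (space M) (incr_events u S)) (sigma_sets (space M) (incr_events v S'))"
proof -
  define P where "P = {u, v} \<union> S \<union> S'"
  define ts where "ts = sorted_list_of_set P"
  define t where "t i = ts ! i" for i
  \<comment> \<open>The number of grid increments, one less than the number of grid points.\<close>
  define n where "n = length ts - 1"
  define \<Delta> where "\<Delta> i \<omega> = B (t (Suc i)) \<omega> - B (t i) \<omega>" for i \<omega>
  have P: "finite P" "P \<subseteq> {u..w}" "u \<in> P" "v \<in> P"
    using assms by (auto simp: P_def)
  have ts: "set ts = P" "sorted ts" "distinct ts"
    using P by (auto simp: ts_def)
  then have "ts \<noteq> []" using P by auto
  then have len: "length ts = Suc n"
    by (cases ts) (auto simp: n_def)
  have t_mono: "t i < t j" if "i < j" "j \<le> n" for i j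
    unfolding t_def using that len strict_sorted_iff[of ts] ts(2,3)
    by (intro sorted_wrt_nth_less[of "(<)"]) auto
  have t_less: "t i < t j \<longleftrightarrow> i < j" if "i \<le> n" "j \<le> n" for i j
    using t_mono[of i j] t_mono[of j i] that by (cases i j rule: linorder_cases) auto
  have ex: "\<exists>k\<le>n. t k = r" if "r \<in> P" for r
    using that ts(1) len by (auto simp: t_def in_set_conv_nth less_Suc_eq_le)
  have tP: "t i \<in> P" if "i \<le> n" for i
    using that ts(1) len by (auto simp: t_def)
  obtain N where N: "N \<le> n" "t N = v" using ex P by blast
  have t0: "t 0 = u"
  proof -
    obtain k where "k \<le> n" "t k = u" using ex P by blast
    then show ?thesis
      using t_less[of 0 k] tP[of 0] P(2) by force
  qed
  have "indep_vars (\<lambda>_. borel) \<Delta> {..<n}"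
    unfolding \<Delta>_def
  proof (rule indep_incr_grid)
    show "t i \<le> t (Suc i)" if "i < n" for i
      using t_less[of i "Suc i"] that by auto
    show "t n \<le> 1" using tP[of n] P(2) assms by force
  qed (use t0 assms in auto)
  then have ind: "indep_var (PiM {..<N} (\<lambda>_. borel)) (\<lambda>\<omega>. \<lambda>i\<in>{..<N}. \<Delta> i \<omega>)
      (PiM {N..<n} (\<lambda>_. borel)) (\<lambda>\<omega>. \<lambda>i\<in>{N..<n}. \<Delta> i \<omega>)"
    by (rule indep_var_restrict) (use N in auto)
  \<comment> \<open>Telescoping: an increment between two grid points is a measurable function of
    the vector of grid increments with indices in \<open>I\<close>.\<close>
  have sub: "sigma_sets (space M) (incr_events q R) \<subseteq>
      sigma_sets (space M) {(\<lambda>\<omega>. \<lambda>i\<in>I. \<Delta> i \<omega>) -` A \<inter> space M | A. A \<in> sets (PiM I (\<lambda>_. borel))}"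
    if I: "\<And>r. r \<in> R \<Longrightarrow> \<exists>k l. {l..<k} \<subseteq> I \<and> l \<le> k \<and> t l = q \<and> t k = r" for q R I
  proof (rule sigma_sets_mono, rule subsetI)
    fix X assume "X \<in> incr_events q R"
    then obtain r A where r: "r \<in> R" "A \<in> sets borel"
      and X: "X = (\<lambda>\<omega>. B r \<omega> - B q \<omega>) -` A \<inter> space M"
      by (auto simp: incr_events_def)
    obtain k l where k: "{l..<k} \<subseteq> I" "l \<le> k" "t l = q" "t k = r" using I r by blast
    have m: "(\<lambda>f. \<Sum>i\<in>{l..<k}. f i) \<in> borel_measurable (PiM I (\<lambda>_. borel :: real measure))"
      using k(1) by (intro borel_measurable_sum measurable_component_singleton) auto
    have "B r \<omega> - B q \<omega> = (\<Sum>i\<in>{l..<k}. (\<lambda>i\<in>I. \<Delta> i \<omega>) i)" for \<omega>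
    proof -
      have "(\<Sum>i\<in>{l..<k}. (\<lambda>i\<in>I. \<Delta> i \<omega>) i) = (\<Sum>i\<in>{l..<k}. \<Delta> i \<omega>)"
        using k(1) by (intro sum.cong) auto
      also have "\<dots> = B (t k) \<omega> - B (t l) \<omega>"
        unfolding \<Delta>_def using sum_Suc_diff'[OF k(2), of "\<lambda>i. B (t i) \<omega>"] by simp
      finally show ?thesis by (simp add: k)
    qed
    then have "X = (\<lambda>\<omega>. \<lambda>i\<in>I. \<Delta> i \<omega>) -`
        ((\<lambda>f. \<Sum>i\<in>{l..<k}. f i) -` A \<inter> space (PiM I (\<lambda>_. borel))) \<inter> space M"
      unfolding X by (auto simp: space_PiM)
    then show "X \<in> sigma_sets (space M) {(\<lambda>\<omega>. \<lambda>i\<in>I. \<Delta> i \<omega>) -` A \<inter> space M | A. A \<in> sets (PiM I (\<lambda>_. borel))}"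
      using measurable_sets[OF m r(2)] by (intro sigma_sets.Basic) blast
  qed
  have "\<exists>k l. {l..<k} \<subseteq> {..<N} \<and> l \<le> k \<and> t l = u \<and> t k = r" if r: "r \<in> S" for r
  proof -
    obtain k where k: "k \<le> n" "t k = r" using ex[of r] r by (auto simp: P_def)
    have "r \<le> v" using r S by auto
    then have "k \<le> N" using t_less[of N k] N k by force
    with k t0 show ?thesis by (intro exI[of _ k] exI[of _ 0]) auto
  qed
  note 1 = sub[OF this]
  have "\<exists>k l. {l..<k} \<subseteq> {N..<n} \<and> l \<le> k \<and> t l = v \<and> t k = r" if r: "r \<in> S'" for r
  proof -
    obtain k where k: "k \<le> n" "t k = r" using ex[of r] r by (auto simp: P_def)
    have "v \<le> r" using r S' by auto
    then have "N \<le> k" using t_less[of k N] N k by force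
    with k N show ?thesis by (intro exI[of _ k] exI[of _ N]) auto
  qed
  note 2 = sub[OF this]
  have ind': "indep_set
      (sigma_sets (space M) {(\<lambda>\<omega>. \<lambda>i\<in>{..<N}. \<Delta> i \<omega>) -` A \<inter> space M | A. A \<in> sets (PiM {..<N} (\<lambda>_. borel))})
      (sigma_sets (space M) {(\<lambda>\<omega>. \<lambda>i\<in>{N..<n}. \<Delta> i \<omega>) -` A \<inter> space M | A. A \<in> sets (PiM {N..<n} (\<lambda>_. borel))})"
    using ind unfolding indep_var_eq by blast
  show ?thesis
  proof (rule indep_setI)
    show "sigma_sets (space M) (incr_events u S) \<subseteq> events"
      using 1 indep_setD_ev1[OF ind'] by (rule order_trans)
    show "sigma_sets (space M) (incr_events v S') \<subseteq> events"
      using 2 indep_setD_ev2[OF ind'] by (rule order_trans)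
    show "prob (a \<inter> b) = prob a * prob b"
      if "a \<in> sigma_sets (space M) (incr_events u S)" "b \<in> sigma_sets (space M) (incr_events v S')" for a b
      by (rule indep_setD[OF ind' subsetD[OF 1 that(1)] subsetD[OF 2 that(2)]])
  qed
qed

text \<open>The union is directed, since two finite sets of times lie in a third. It is therefore an
  intersection-stable generator of \<open>seg\<close>, to which independence proved on finite grids
  can be lifted.\<close>

lemma Int_stable_incr_events:
  "Int_stable (\<Union>S\<in>{S. finite S \<and> S \<subseteq> T}. sigma_sets (space M) (incr_events u S))"
proof (rule Int_stableI)
  fix a b
  assume "a \<in> (\<Union>S\<in>{S. finite S \<and> S \<subseteq> T}. sigma_sets (space M) (incr_events u S))"
    and "b \<in> (\<Union>S\<in>{S. finite S \<and> S \<subseteq> T}. sigma_sets (space M) (incr_events u S))"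
  then obtain S S' where S: "finite S" "S \<subseteq> T" "finite S'" "S' \<subseteq> T"
    and ab: "a \<in> sigma_sets (space M) (incr_events u S)" "b \<in> sigma_sets (space M) (incr_events u S')"
    by blast
  interpret N: sigma_algebra "space M" "sigma_sets (space M) (incr_events u (S \<union> S'))"
    by (rule sigma_algebra_sigma_sets[OF incr_events_Pow])
  have sub: "sigma_sets (space M) (incr_events u S) \<subseteq> sigma_sets (space M) (incr_events u (S \<union> S'))"
    "sigma_sets (space M) (incr_events u S') \<subseteq> sigma_sets (space M) (incr_events u (S \<union> S'))"
    by (rule sigma_sets_subseteq, rule incr_events_mono, simp)+
  have "a \<inter> b \<in> sigma_sets (space M) (incr_events u (S \<union> S'))"
    by (rule N.Int[OF subsetD[OF sub(1) ab(1)] subsetD[OF sub(2) ab(2)]])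
  then show "a \<inter> b \<in> (\<Union>S\<in>{S. finite S \<and> S \<subseteq> T}. sigma_sets (space M) (incr_events u S))"
    by (rule UN_I[rotated]) (simp add: S)
qed

lemma sets_seg_subset_incr_events:
  "sets (seg u v) \<subseteq> sigma_sets (space M)
    (\<Union>S\<in>{S. finite S \<and> S \<subseteq> {u..v}}. sigma_sets (space M) (incr_events u S))"
  unfolding sets_seg
proof (rule sigma_sets_mono, rule subsetI)
  fix X assume "X \<in> incr_events u {u..v}"
  then obtain r where "r \<in> {u..v}" "X \<in> incr_events u {r}"
    by (auto simp: incr_events_def)
  then show "X \<in> sigma_sets (space M)
    (\<Union>S\<in>{S. finite S \<and> S \<subseteq> {u..v}}. sigma_sets (space M) (incr_events u S))"
    by (intro sigma_sets.Basic UN_I[of "{r}"]) auto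
qed

lemma indep_set_seg:
  assumes "0 \<le> u" "u \<le> v" "v \<le> w" "w \<le> 1"
  shows "indep_set (sets (seg u v)) (sets (seg v w))"
proof -
  let ?F = "\<lambda>u v. \<Union>S\<in>{S. finite S \<and> S \<subseteq> {u..v}}. sigma_sets (space M) (incr_events u S)"
  have sub: "?F u v \<subseteq> events" if "0 \<le> u" "u \<le> v" "v \<le> 1" for u v
    using that by (intro UN_least sets.sigma_sets_subset incr_events_subset) auto
  have "indep_set (?F u v) (?F v w)"
  proof (rule indep_setI)
    show "?F u v \<subseteq> events" "?F v w \<subseteq> events"
      using assms by (intro sub; simp)+
    fix a b assume "a \<in> ?F u v" "b \<in> ?F v w"
    then show "prob (a \<inter> b) = prob a * prob b"
      using indep_setD[OF indep_incr_events_finite[OF assms]] by blast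
  qed
  then have *: "indep_set (sigma_sets (space M) (?F u v)) (sigma_sets (space M) (?F v w))"
    by (intro indep_set_sigma_sets Int_stable_incr_events)
  show ?thesis
  proof (rule indep_setI)
    show "sets (seg u v) \<subseteq> events" "sets (seg v w) \<subseteq> events"
      using assms by (intro seg_subset; simp)+
    show "prob (a \<inter> b) = prob a * prob b" if "a \<in> sets (seg u v)" "b \<in> sets (seg v w)" for a b
      by (rule indep_setD[OF * that[THEN subsetD[OF sets_seg_subset_incr_events]]])
  qed
qed

text \<open>The form in which independence is used later: functionals of two adjacent segments are
  independent as soon as each is measurable for its own segment.\<close>

lemma indep_var_seg:
  assumes "0 \<le> u" "u \<le> v" "v \<le> w" "w \<le> 1"
    and X: "X \<in> measurable (seg u v) S" and Y: "Y \<in> measurable (seg v w) T"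
  shows "indep_var S X T Y"
  unfolding indep_var_eq
proof (intro conjI)
  show "random_variable S X" "random_variable T Y"
    using measurable_seg_M[OF X] measurable_seg_M[OF Y] assms by auto
  have 1: "sigma_sets (space M) {X -` A \<inter> space M | A. A \<in> sets S} \<subseteq> sets (seg u v)"
    unfolding space_seg[symmetric, of u v]
    by (rule sets.sigma_sets_subset) (use measurable_sets[OF X] in auto)
  have 2: "sigma_sets (space M) {Y -` A \<inter> space M | A. A \<in> sets T} \<subseteq> sets (seg v w)"
    unfolding space_seg[symmetric, of v w]
    by (rule sets.sigma_sets_subset) (use measurable_sets[OF Y] in auto)
  note ind = indep_set_seg[OF assms(1-4)]
  show "indep_set (sigma_sets (space M) {X -` A \<inter> space M | A. A \<in> sets S})
      (sigma_sets (space M) {Y -` A \<inter> space M | A. A \<in> sets T})"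
  proof (rule indep_setI)
    show "sigma_sets (space M) {X -` A \<inter> space M | A. A \<in> sets S} \<subseteq> events"
      by (rule order_trans[OF 1 indep_setD_ev1[OF ind]])
    show "sigma_sets (space M) {Y -` A \<inter> space M | A. A \<in> sets T} \<subseteq> events"
      by (rule order_trans[OF 2 indep_setD_ev2[OF ind]])
    show "prob (a \<inter> b) = prob a * prob b"
      if "a \<in> sigma_sets (space M) {X -` A \<inter> space M | A. A \<in> sets S}"
        "b \<in> sigma_sets (space M) {Y -` A \<inter> space M | A. A \<in> sets T}" for a b
      by (rule indep_setD[OF ind subsetD[OF 1 that(1)] subsetD[OF 2 that(2)]])
  qed
qed

end

section \<open>Maximum of a path segment and its first location\<close>

context bm01
begin

text \<open>Heights are measured from \<open>B u\<close>, so that the maximum is a functional of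
  increments and measurable for \<open>seg u v\<close>. The location \<open>seg_argmax\<close>
  remains an absolute time.\<close>

definition seg_max :: "real \<Rightarrow> real \<Rightarrow> 'a \<Rightarrow> real" where
  "seg_max u v \<omega> = (SUP r\<in>{u..v}. B r \<omega> - B u \<omega>)"

definition seg_argmax :: "real \<Rightarrow> real \<Rightarrow> 'a \<Rightarrow> real" where
  "seg_argmax u v \<omega> = (LEAST r. r \<in> {u..v} \<and> B r \<omega> - B u \<omega> = seg_max u v \<omega>)"

lemma continuous_incr:
  assumes "\<omega> \<in> space M" "0 \<le> u" "v \<le> 1"
  shows "continuous_on {u..v} (\<lambda>r. B r \<omega> - B q \<omega>)"
  using assms by (intro continuous_on_diff continuous_on_const continuous_on_subset[OF continuous_B]) auto

lemma seg_max_attained: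
  assumes "\<omega> \<in> space M" "0 \<le> u" "u \<le> v" "v \<le> 1"
  obtains r where "r \<in> {u..v}" "B r \<omega> - B u \<omega> = seg_max u v \<omega>"
    "\<And>q. q \<in> {u..v} \<Longrightarrow> B q \<omega> - B u \<omega> \<le> seg_max u v \<omega>"
proof -
  obtain r where r: "r \<in> {u..v}" "\<And>q. q \<in> {u..v} \<Longrightarrow> B q \<omega> - B u \<omega> \<le> B r \<omega> - B u \<omega>"
    using continuous_attains_sup[OF _ _ continuous_incr[of \<omega> u v u]] assms by force
  then have "seg_max u v \<omega> = B r \<omega> - B u \<omega>"
    unfolding seg_max_def by (intro cSup_eq_maximum) auto
  with r that show thesis by simp
qed

lemma seg_max_le_iff:
  assumes "\<omega> \<in> space M" "0 \<le> u" "u \<le> v" "v \<le> 1"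
  shows "seg_max u v \<omega> \<le> a \<longleftrightarrow> (\<forall>r\<in>{u..v}. B r \<omega> - B u \<omega> \<le> a)"
  by (rule seg_max_attained[OF assms]) (metis order_trans)

lemma incr_le_seg_max:
  assumes "\<omega> \<in> space M" "0 \<le> u" "u \<le> r" "r \<le> v" "v \<le> 1"
  shows "B r \<omega> - B u \<omega> \<le> seg_max u v \<omega>"
  by (rule seg_max_attained[of \<omega> u v]) (use assms in auto)

lemma seg_max_nonneg:
  assumes "\<omega> \<in> space M" "0 \<le> u" "u \<le> v" "v \<le> 1"
  shows "0 \<le> seg_max u v \<omega>"
  using incr_le_seg_max[of \<omega> u u v] assms by simp

lemma seg_max_same [simp]: "seg_max u u \<omega> = 0"
  by (simp add: seg_max_def)

lemma seg_max_split:
  assumes "\<omega> \<in> space M" "0 \<le> u" "u \<le> v" "v \<le> w" "w \<le> 1"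
  shows "seg_max u w \<omega> = max (seg_max u v \<omega>) (B v \<omega> - B u \<omega> + seg_max v w \<omega>)"
proof -
  \<comment> \<open>Two reals with the same upper bounds are equal.\<close>
  have "seg_max u w \<omega> \<le> a \<longleftrightarrow> max (seg_max u v \<omega>) (B v \<omega> - B u \<omega> + seg_max v w \<omega>) \<le> a" for a
  proof -
    have "B v \<omega> - B u \<omega> + seg_max v w \<omega> \<le> a \<longleftrightarrow> seg_max v w \<omega> \<le> a - (B v \<omega> - B u \<omega>)"
      by auto
    also have "\<dots> \<longleftrightarrow> (\<forall>r\<in>{v..w}. B r \<omega> - B u \<omega> \<le> a)"
      using assms by (subst seg_max_le_iff) (auto simp: algebra_simps)
    finally have 1: "B v \<omega> - B u \<omega> + seg_max v w \<omega> \<le> a \<longleftrightarrow> (\<forall>r\<in>{v..w}. B r \<omega> - B u \<omega> \<le> a)" .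
    have 2: "seg_max u v \<omega> \<le> a \<longleftrightarrow> (\<forall>r\<in>{u..v}. B r \<omega> - B u \<omega> \<le> a)"
      using assms by (intro seg_max_le_iff) auto
    have 3: "seg_max u w \<omega> \<le> a \<longleftrightarrow> (\<forall>r\<in>{u..w}. B r \<omega> - B u \<omega> \<le> a)"
      using assms by (intro seg_max_le_iff) auto
    have "{u..w} = {u..v} \<union> {v..w}"
      using assms by auto
    then show ?thesis
      unfolding max.bounded_iff 1 2 3 by blast
  qed
  then show ?thesis
    by (metis order_antisym order_refl)
qed

lemma seg_max_mono:
  assumes "\<omega> \<in> space M" "0 \<le> u" "u \<le> v" "v \<le> w" "w \<le> 1"
  shows "seg_max u v \<omega> \<le> seg_max u w \<omega>"
  using seg_max_split[OF assms] by simp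

lemma seg_argmax_eqI:
  assumes "p \<in> {u..v}" "B p \<omega> - B u \<omega> = seg_max u v \<omega>"
    and "\<And>r. u \<le> r \<Longrightarrow> r < p \<Longrightarrow> B r \<omega> - B u \<omega> \<noteq> seg_max u v \<omega>"
  shows "seg_argmax u v \<omega> = p"
  unfolding seg_argmax_def
  by (rule Least_equality) (use assms in \<open>auto simp: not_less[symmetric]\<close>)

text \<open>\<open>LEAST\<close> on the reals is meaningful here because the maximisers of a
  continuous path on a compact interval form a nonempty compact set, which contains its
  infimum.\<close>

lemma seg_argmax:
  assumes "\<omega> \<in> space M" "0 \<le> u" "u \<le> v" "v \<le> 1"
  shows "seg_argmax u v \<omega> \<in> {u..v}" (is ?a)
    and "B (seg_argmax u v \<omega>) \<omega> - B u \<omega> = seg_max u v \<omega>" (is ?b)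
    and "\<And>r. u \<le> r \<Longrightarrow> r < seg_argmax u v \<omega> \<Longrightarrow> B r \<omega> - B u \<omega> \<noteq> seg_max u v \<omega>" (is "\<And>r. _ \<Longrightarrow> _ \<Longrightarrow> ?c r")
proof -
  define P where "P = {r \<in> {u..v}. B r \<omega> - B u \<omega> = seg_max u v \<omega>}"
  have "closed P"
    unfolding P_def using assms
    by (intro continuous_closed_preimage_constant continuous_incr) auto
  moreover have "bounded P"
    by (rule bounded_subset[OF bounded_closed_interval]) (auto simp: P_def)
  ultimately have "compact P"
    by (simp add: compact_eq_bounded_closed)
  moreover have "P \<noteq> {}"
    by (rule seg_max_attained[OF assms]) (auto simp: P_def)
  ultimately obtain p where p: "p \<in> P" "\<And>r. r \<in> P \<Longrightarrow> p \<le> r"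
    using compact_attains_inf by metis
  have 3: "B r \<omega> - B u \<omega> \<noteq> seg_max u v \<omega>" if "u \<le> r" "r < p" for r
    using that p(2)[of r] p(1) by (auto simp: P_def)
  have "seg_argmax u v \<omega> = p"
    using p(1) 3 by (intro seg_argmax_eqI) (auto simp: P_def)
  with p(1) 3 show ?a ?b "\<And>r. u \<le> r \<Longrightarrow> r < seg_argmax u v \<omega> \<Longrightarrow> ?c r"
    by (simp_all add: P_def)
qed

text \<open>A tie between the two pieces goes to the earlier one, since the first location is taken;
  hence the non-strict comparison.\<close>

lemma seg_argmax_split:
  assumes "\<omega> \<in> space M" "0 \<le> u" "u \<le> v" "v \<le> w" "w \<le> 1"
  shows "seg_argmax u w \<omega> =
    (if B v \<omega> - B u \<omega> + seg_max v w \<omega> \<le> seg_max u v \<omega> then seg_argmax u v \<omega> else seg_argmax v w \<omega>)"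
proof -
  note split = seg_max_split[OF assms]
  have uv: "\<omega> \<in> space M" "0 \<le> u" "u \<le> v" "v \<le> 1" and vw: "\<omega> \<in> space M" "0 \<le> v" "v \<le> w" "w \<le> 1"
    using assms by auto
  show ?thesis
  proof (cases "B v \<omega> - B u \<omega> + seg_max v w \<omega> \<le> seg_max u v \<omega>")
    case True
    then have max: "seg_max u w \<omega> = seg_max u v \<omega>" using split by simp
    have "seg_argmax u w \<omega> = seg_argmax u v \<omega>"
    proof (rule seg_argmax_eqI)
      show "seg_argmax u v \<omega> \<in> {u..w}" "B (seg_argmax u v \<omega>) \<omega> - B u \<omega> = seg_max u w \<omega>"
        using seg_argmax(1,2)[OF uv] assms max by auto
      show "B r \<omega> - B u \<omega> \<noteq> seg_max u w \<omega>" if "u \<le> r" "r < seg_argmax u v \<omega>" for r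
        using seg_argmax(3)[OF uv that] max by simp
    qed
    with True show ?thesis by simp
  next
    case False
    then have eq: "seg_max u w \<omega> = B v \<omega> - B u \<omega> + seg_max v w \<omega>" using split by simp
    have "seg_argmax u w \<omega> = seg_argmax v w \<omega>"
    proof (rule seg_argmax_eqI)
      show "seg_argmax v w \<omega> \<in> {u..w}" "B (seg_argmax v w \<omega>) \<omega> - B u \<omega> = seg_max u w \<omega>"
        using seg_argmax[OF vw] assms eq by auto
      fix r assume r: "u \<le> r" "r < seg_argmax v w \<omega>"
      show "B r \<omega> - B u \<omega> \<noteq> seg_max u w \<omega>"
      proof (cases "r \<le> v")
        case True
        then show ?thesis using incr_le_seg_max[of \<omega> u r v] r uv False eq by auto
      next
        case False
        then show ?thesis using seg_argmax(3)[OF vw, of r] r eq by auto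
      qed
    qed
    with False show ?thesis by simp
  qed
qed

text \<open>Turns the event that the maximum is attained by time \<open>t\<close> into a comparison
  between the two sides of \<open>t\<close>. Both the measurability of \<open>seg_argmax\<close> and
  the computation of its law rest on this.\<close>

lemma seg_argmax_le_iff:
  assumes "\<omega> \<in> space M" "0 \<le> u" "u \<le> t" "t \<le> v" "v \<le> 1"
  shows "seg_argmax u v \<omega> \<le> t \<longleftrightarrow> B t \<omega> - B u \<omega> + seg_max t v \<omega> \<le> seg_max u t \<omega>"
proof (cases "B t \<omega> - B u \<omega> + seg_max t v \<omega> \<le> seg_max u t \<omega>")
  case True
  then show ?thesis
    using seg_argmax_split[OF assms] seg_argmax(1)[of \<omega> u t] assms by auto
next
  case False
  have tv: "\<omega> \<in> space M" "0 \<le> t" "t \<le> v" "v \<le> 1" using assms by auto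
  have "t \<le> seg_argmax t v \<omega>" using seg_argmax(1)[OF tv] by auto
  \<comment> \<open>The boundary case: were the second piece maximal at its start, its relative
    maximum would be 0 and \<open>B t\<close> would exceed the maximum of the first piece, which
    includes time \<open>t\<close>.\<close>
  moreover have "seg_argmax t v \<omega> \<noteq> t"
  proof
    assume "seg_argmax t v \<omega> = t"
    then have "seg_max t v \<omega> = 0" using seg_argmax(2)[OF tv] by simp
    with False incr_le_seg_max[of \<omega> u t t] assms show False by auto
  qed
  ultimately show ?thesis
    using False seg_argmax_split[OF assms] by auto
qed

text \<open>By continuity the bound need only be tested on the rational times of the open interval,
  a countable dense set. The degenerate interval is separate, because there that set is
  empty.\<close>

lemma measurable_seg_max:
  assumes "0 \<le> u" "u \<le> v" "v \<le> 1"
  shows "seg_max u v \<in> borel_measurable (seg u v)"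
proof (cases "u = v")
  case False
  define D where "D = {u<..<v} \<inter> \<rat>"
  have "closure D = {u..v}"
  proof (rule antisym)
    have "{u<..<v} \<subseteq> closure D"
      using open_Int_closure_subset[of "{u<..<v}" \<rat>] by (simp add: D_def Rats_closure_real)
    then have "closure {u<..<v} \<subseteq> closure D"
      by (simp add: closure_minimal)
    then show "{u..v} \<subseteq> closure D"
      using False assms by simp
    show "closure D \<subseteq> {u..v}"
      by (rule closure_minimal) (auto simp: D_def)
  qed
  have D: "countable D" "D \<subseteq> {u..v}"
    by (auto simp: D_def countable_rat)
  have iff: "seg_max u v \<omega> \<le> a \<longleftrightarrow> (\<forall>r\<in>D. B r \<omega> - B u \<omega> \<le> a)" if "\<omega> \<in> space M" for \<omega> a
  proof -
    have "B r \<omega> - B u \<omega> \<le> a" if "r \<in> {u..v}" "\<forall>r\<in>D. B r \<omega> - B u \<omega> \<le> a" for r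
    proof (rule continuous_le_on_closure[where S = D and f = "\<lambda>r. B r \<omega> - B u \<omega>"])
      show "continuous_on (closure D) (\<lambda>r. B r \<omega> - B u \<omega>)"
        using \<open>closure D = _\<close> \<open>\<omega> \<in> space M\<close> assms by (auto intro!: continuous_incr)
    qed (use that \<open>closure D = _\<close> in auto)
    then show ?thesis
      using D(2) seg_max_le_iff[OF that assms] by blast
  qed
  show ?thesis
    unfolding borel_measurable_iff_le
  proof
    fix a
    have "{\<omega> \<in> space (seg u v). seg_max u v \<omega> \<le> a} =
        {\<omega> \<in> space (seg u v). \<forall>r\<in>D. B r \<omega> - B u \<omega> \<le> a}"
      by (auto simp: iff)
    also have "\<dots> \<in> sets (seg u v)"
    proof (rule sets.sets_Collect_countable_All')
      fix r assume "r \<in> D"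
      then have "(\<lambda>\<omega>. B r \<omega> - B u \<omega>) \<in> borel_measurable (seg u v)"
        using D(2) assms by (intro measurable_seg_incr) auto
      then show "{\<omega> \<in> space (seg u v). B r \<omega> - B u \<omega> \<le> a} \<in> sets (seg u v)"
        unfolding borel_measurable_iff_le by blast
    qed (rule D(1))
    finally show "{\<omega> \<in> space (seg u v). seg_max u v \<omega> \<le> a} \<in> sets (seg u v)" .
  qed
next
  case True
  then have "seg_max u v = (\<lambda>_. 0)"
    by (simp add: fun_eq_iff)
  then show ?thesis by simp
qed

lemma measurable_seg_argmax:
  assumes "0 \<le> u" "u \<le> v" "v \<le> 1"
  shows "seg_argmax u v \<in> borel_measurable (seg u v)"
  unfolding borel_measurable_iff_le
proof
  fix t
  consider "t < u" | "v \<le> t" | "u \<le> t" "t \<le> v" by linarith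
  then show "{\<omega> \<in> space (seg u v). seg_argmax u v \<omega> \<le> t} \<in> sets (seg u v)"
  proof cases
    case 1
    have "\<not> seg_argmax u v \<omega> \<le> t" if "\<omega> \<in> space M" for \<omega>
      using seg_argmax(1)[OF that assms] 1 by auto
    then have "{\<omega> \<in> space (seg u v). seg_argmax u v \<omega> \<le> t} = {}"
      by auto
    show ?thesis by (subst \<open>_ = {}\<close>) simp
  next
    case 2
    have "seg_argmax u v \<omega> \<le> t" if "\<omega> \<in> space M" for \<omega>
      using seg_argmax(1)[OF that assms] 2 by auto
    then have "{\<omega> \<in> space (seg u v). seg_argmax u v \<omega> \<le> t} = space (seg u v)"
      by auto
    show ?thesis by (subst \<open>_ = space (seg u v)\<close>) (rule sets.top)
  next
    case 3
    have [measurable]: "(\<lambda>\<omega>. B t \<omega> - B u \<omega>) \<in> borel_measurable (seg u v)"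
      "seg_max t v \<in> borel_measurable (seg u v)" "seg_max u t \<in> borel_measurable (seg u v)"
      using assms 3
      by (auto intro!: measurable_seg_incr measurable_seg_mono[OF measurable_seg_max])
    have "{\<omega> \<in> space (seg u v). seg_argmax u v \<omega> \<le> t} =
        {\<omega> \<in> space (seg u v). (B t \<omega> - B u \<omega>) + seg_max t v \<omega> \<le> seg_max u t \<omega>}"
      using seg_argmax_le_iff[of _ u t v] assms 3 by auto
    also have "\<dots> \<in> sets (seg u v)"
      by measurable
    finally show ?thesis .
  qed
qed

end

section \<open>The reflection principle\<close>

text \<open>Uniqueness of measures on a product, with exhausting sequences \<open>a\<close> and
  \<open>b\<close> inside the generators; half-lines exhaust the real line without containing
  it.\<close>

lemma measure_eqI_pair:
  assumes sets: "sets \<mu> = sets (A \<Otimes>\<^sub>M B)" "sets \<nu> = sets (A \<Otimes>\<^sub>M B)"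
    and fin: "finite_measure \<mu>"
    and A: "sets A = sigma_sets (space A) Ea" "Ea \<subseteq> Pow (space A)" "Int_stable Ea"
    and B: "sets B = sigma_sets (space B) Eb" "Eb \<subseteq> Pow (space B)" "Int_stable Eb"
    and a: "\<And>n::nat. a n \<in> Ea" "incseq a" "(\<Union>n. a n) = space A"
    and b: "\<And>n::nat. b n \<in> Eb" "incseq b" "(\<Union>n. b n) = space B"
    and eq: "\<And>X Y. X \<in> Ea \<Longrightarrow> Y \<in> Eb \<Longrightarrow> emeasure \<mu> (X \<times> Y) = emeasure \<nu> (X \<times> Y)"
  shows "\<mu> = \<nu>"
proof (rule measure_eqI_generator_eq)
  let ?E = "{X \<times> Y | X Y. X \<in> Ea \<and> Y \<in> Eb}"
  have "sets (A \<Otimes>\<^sub>M B) = sets (sigma (space A \<times> space B) ?E)"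
    using A B a b
    by (intro sets_pair_eq[of Ea A "range a" Eb B "range b"]) (auto simp: image_subset_iff)
  also have "\<dots> = sigma_sets (space A \<times> space B) ?E"
    using A(2) B(2) by (intro sets_measure_of) auto
  finally show "sets \<mu> = sigma_sets (space A \<times> space B) ?E" "sets \<nu> = sigma_sets (space A \<times> space B) ?E"
    using sets by simp_all
  show "Int_stable ?E"
  proof (rule Int_stableI)
    fix P Q assume "P \<in> ?E" "Q \<in> ?E"
    then obtain X Y X' Y' where "P = X \<times> Y" "Q = X' \<times> Y'" "X \<in> Ea" "X' \<in> Ea" "Y \<in> Eb" "Y' \<in> Eb" by blast
    moreover have "(X \<times> Y) \<inter> (X' \<times> Y') = (X \<inter> X') \<times> (Y \<inter> Y')" by auto
    ultimately show "P \<inter> Q \<in> ?E"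
      using Int_stableD[OF A(3), of X X'] Int_stableD[OF B(3), of Y Y'] by auto
  qed
  show "?E \<subseteq> Pow (space A \<times> space B)"
    using A(2) B(2) by auto
  show "emeasure \<mu> X = emeasure \<nu> X" if "X \<in> ?E" for X
    using that eq by auto
  show "range (\<lambda>n. a n \<times> b n) \<subseteq> ?E"
    using a(1) b(1) by auto
  show "(\<Union>n. a n \<times> b n) = space A \<times> space B"
  proof (rule antisym)
    show "space A \<times> space B \<subseteq> (\<Union>n. a n \<times> b n)"
    proof
      fix p assume "p \<in> space A \<times> space B"
      then obtain i j where ij: "fst p \<in> a i" "snd p \<in> b j"
        unfolding a(3)[symmetric] b(3)[symmetric] by auto
      have "a i \<subseteq> a (max i j)" "b j \<subseteq> b (max i j)"
        using a(2) b(2) by (simp_all add: incseqD)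
      with ij show "p \<in> (\<Union>n. a n \<times> b n)"
        by (auto simp: mem_Times_iff)
    qed
    show "(\<Union>n. a n \<times> b n) \<subseteq> space A \<times> space B"
      unfolding a(3)[symmetric] b(3)[symmetric] by auto
  qed
  show "emeasure \<mu> (a n \<times> b n) \<noteq> \<infinity>" for n
    using finite_measure.emeasure_finite[OF fin] by simp
qed

lemma Int_stable_atMost: "Int_stable (range (atMost :: real \<Rightarrow> _))"
proof (rule Int_stableI)
  fix a b assume "a \<in> range (atMost :: real \<Rightarrow> _)" "b \<in> range (atMost :: real \<Rightarrow> _)"
  then obtain x y where "a = {..x}" "b = {..y}" by blast
  then have "a \<inter> b = {..min x y}" by auto
  then show "a \<inter> b \<in> range atMost" by blast
qed

lemma Int_stable_lessThan: "Int_stable (range (lessThan :: real \<Rightarrow> _))"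
proof (rule Int_stableI)
  fix a b assume "a \<in> range (lessThan :: real \<Rightarrow> _)" "b \<in> range (lessThan :: real \<Rightarrow> _)"
  then obtain x y where "a = {..<x}" "b = {..<y}" by blast
  then have "a \<inter> b = {..<min x y}" by auto
  then show "a \<inter> b \<in> range lessThan" by blast
qed

lemma sets_borel_eq_atMost: "sets (borel :: real measure) = sigma_sets UNIV (range atMost)"
  by (subst borel_eq_atMost) (simp add: sets_measure_of)

lemma sets_borel_eq_lessThan: "sets (borel :: real measure) = sigma_sets UNIV (range lessThan)"
  by (subst borel_Iio) (simp add: sets_measure_of)

lemma Union_atMost_real: "(\<Union>n. {..real n}) = UNIV"
  using real_arch_simple by auto

lemma Union_lessThan_real: "(\<Union>n. {..<real n}) = UNIV"
  using reals_Archimedean2 by auto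

context bm01
begin

section \<open>Symmetry of increments and reflection at a level\<close>

lemma expectation_incr_minus:
  assumes "0 \<le> u" "u \<le> v" "v \<le> 1" and f [measurable]: "f \<in> borel_measurable borel"
  shows "expectation (\<lambda>\<omega>. f (B v \<omega> - B u \<omega>)) = (expectation (\<lambda>\<omega>. f (- (B v \<omega> - B u \<omega>))) :: real)"
\<comment> \<open>\<open>distributed_incr\<close> requires \<open>u < v\<close>. The degenerate
  case, with increment 0, occurs at the last grid cell in
  \<open>reflection_continuous\<close>.\<close>
proof (cases "u = v")
  case False
  define \<sigma> where "\<sigma> = sqrt (v - u)"
  have D: "distributed M lborel (\<lambda>\<omega>. B v \<omega> - B u \<omega>) (normal_density 0 \<sigma>)"
    unfolding \<sigma>_def using assms False by (intro distributed_incr) auto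
  have "expectation (\<lambda>\<omega>. f (B v \<omega> - B u \<omega>)) = (\<integral>x. normal_density 0 \<sigma> x * f x \<partial>lborel)"
    using distributed_integral[OF D, of f] by simp
  also have "\<dots> = (\<integral>x. normal_density 0 \<sigma> (- x) * f (- x) \<partial>lborel)"
    using lborel_integral_real_affine[of "-1" "\<lambda>x. normal_density 0 \<sigma> x * f x" 0] by simp
  also have "\<dots> = (\<integral>x. normal_density 0 \<sigma> x * f (- x) \<partial>lborel)"
    by (simp add: normal_density_def)
  also have "\<dots> = expectation (\<lambda>\<omega>. f (- (B v \<omega> - B u \<omega>)))"
    using distributed_integral[OF D, of "\<lambda>x. f (- x)"] by simp
  finally show ?thesis .
qed simp

lemma expectation_past_incr_minus:
  assumes uvw: "0 \<le> u" "u \<le> v" "v \<le> w" "w \<le> 1" and E: "E \<in> sets (seg u v)"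
    and f [measurable]: "f \<in> borel_measurable borel" and bound: "\<And>x. \<bar>f x\<bar> \<le> K"
  shows "expectation (\<lambda>\<omega>. indicator E \<omega> * f (B w \<omega> - B v \<omega>))
    = (expectation (\<lambda>\<omega>. indicator E \<omega> * f (- (B w \<omega> - B v \<omega>))) :: real)"
proof -
  have prod: "expectation (\<lambda>\<omega>. indicator E \<omega> * h (B w \<omega> - B v \<omega>)) =
      (expectation (indicator E) * expectation (\<lambda>\<omega>. h (B w \<omega> - B v \<omega>)) :: real)"
    if h [measurable]: "h \<in> borel_measurable borel" and hb: "\<And>x. \<bar>h x\<bar> \<le> K" for h :: "real \<Rightarrow> real"
  proof (rule indep_var_lebesgue_integral)
    have m: "(\<lambda>\<omega>. h (B w \<omega> - B v \<omega>)) \<in> borel_measurable (seg v w)"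
      using uvw by (intro measurable_compose[OF measurable_seg_incr h]) auto
    show ind: "indep_var borel (indicator E) borel (\<lambda>\<omega>. h (B w \<omega> - B v \<omega>))"
      using E by (intro indep_var_seg[OF uvw _ m]) auto
    show "integrable M (indicator E :: 'a \<Rightarrow> real)"
      using indep_var_rv1[OF ind] by (intro integrable_const_bound[of _ 1]) auto
    show "integrable M (\<lambda>\<omega>. h (B w \<omega> - B v \<omega>))"
      using indep_var_rv2[OF ind] hb by (intro integrable_const_bound[of _ K]) auto
  qed
  have "expectation (\<lambda>\<omega>. f (B w \<omega> - B v \<omega>)) = expectation (\<lambda>\<omega>. f (- (B w \<omega> - B v \<omega>)))"
    using uvw by (intro expectation_incr_minus f) auto
  moreover have "(\<lambda>x. f (- x)) \<in> borel_measurable borel"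
    by measurable
  ultimately show ?thesis
    using prod[OF f bound] prod[of "\<lambda>x. f (- x)"] bound by simp
qed

text \<open>Formulated for bounded continuous \<open>f\<close> instead of events: on a grid the path
  is restarted only near level \<open>a\<close>, and the passage to the limit combines continuity of
  \<open>f\<close> with dominated convergence.\<close>

lemma reflection_continuous:
  assumes uv: "0 \<le> u" "u < v" "v \<le> 1" and "0 < a"
    and f: "continuous_on UNIV f" and bound: "\<And>x. \<bar>f x\<bar> \<le> K"
  shows "expectation (\<lambda>\<omega>. if a \<le> seg_max u v \<omega> then f (B v \<omega> - B u \<omega> - a) else 0)
    = (expectation (\<lambda>\<omega>. if a \<le> seg_max u v \<omega> then f (- (B v \<omega> - B u \<omega> - a)) else 0) :: real)"
proof -
  define r where "r n k = u + (v - u) * (real k / real (Suc n))" for n k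
  have r0: "r n 0 = u" and rN: "r n (Suc n) = v" for n
    by (simp_all add: r_def del: of_nat_Suc)
  have r_mono: "r n j \<le> r n k" if "j \<le> k" for n j k
    using that uv by (auto simp: r_def intro!: mult_left_mono divide_right_mono)
  have r_range: "u \<le> r n k" "r n k \<le> v" if "k \<le> Suc n" for n k
    using r_mono[of 0 k n] r_mono[OF that, of n] by (simp_all add: r0 rN)
  have r_step: "r n (Suc k) - r n k = (v - u) / real (Suc n)" for n k
    unfolding r_def of_nat_Suc[of k] by (simp only: add_divide_distrib distrib_left) (simp del: of_nat_Suc)
  \<comment> \<open>On \<open>E n k\<close> the hitting time of \<open>a\<close> lies in the \<open>k\<close>-th grid cell. The increment after that cell is
    symmetric and independent of \<open>E n k\<close>, and refining the grid makes it start at level \<open>a\<close>.\<close>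
  define E where "E n k = {\<omega> \<in> space M. seg_max u (r n k) \<omega> < a \<and> a \<le> seg_max u (r n (Suc k)) \<omega>}" for n k
  define S where "S h n \<omega> = (\<Sum>k<Suc n. indicator (E n k) \<omega> * h (B v \<omega> - B (r n (Suc k)) \<omega>))"
    for h :: "real \<Rightarrow> real" and n \<omega>
  have [measurable]: "f \<in> borel_measurable borel"
    using f by (rule borel_measurable_continuous_onI)
  have E_seg: "E n k \<in> sets (seg u (r n (Suc k)))" if "k < Suc n" for n k
  proof -
    have [measurable]: "seg_max u (r n k) \<in> borel_measurable (seg u (r n (Suc k)))"
      "seg_max u (r n (Suc k)) \<in> borel_measurable (seg u (r n (Suc k)))"
      using that r_range[of k n] r_range[of "Suc k" n] r_mono[of k "Suc k" n] uv
      by (auto intro!: measurable_seg_max measurable_seg_mono[OF measurable_seg_max])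
    have "{\<omega> \<in> space (seg u (r n (Suc k))). seg_max u (r n k) \<omega> < a \<and> a \<le> seg_max u (r n (Suc k)) \<omega>}
        \<in> sets (seg u (r n (Suc k)))"
      by measurable
    then show ?thesis by (simp add: E_def)
  qed
  have E_M: "E n k \<in> events" if "k < Suc n" for n k
    using E_seg[OF that] seg_subset[of u "r n (Suc k)"] r_range[of "Suc k" n] that uv by auto
  have B_r: "B (r n k) \<in> borel_measurable M" if "k \<le> Suc n" for n k
    using r_range[OF that] uv by (intro measurable_B) auto
  have B_uv [measurable]: "B u \<in> borel_measurable M" "B v \<in> borel_measurable M"
    by (rule measurable_B, use uv in force)+
  have max_M [measurable]: "seg_max u v \<in> borel_measurable M"
    using uv by (intro measurable_seg_M[OF measurable_seg_max]) simp_all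
  have S_term: "(\<lambda>\<omega>. indicator (E n k) \<omega> * h (B v \<omega> - B (r n (Suc k)) \<omega>)) \<in> borel_measurable M"
    if "k < Suc n" and [measurable]: "h \<in> borel_measurable borel" for h :: "real \<Rightarrow> real" and n k
  proof -
    have [measurable]: "E n k \<in> events" "B (r n (Suc k)) \<in> borel_measurable M"
      using that(1) by (simp_all add: E_M B_r)
    show ?thesis by measurable
  qed
  have S_meas: "S h n \<in> borel_measurable M" if "h \<in> borel_measurable borel" for h n
    unfolding S_def by (intro borel_measurable_sum S_term that) simp
  \<comment> \<open>The running maximum is monotone, so a path that reaches \<open>a\<close> belongs
    to exactly one \<open>E n k\<close> and the sum has a single surviving term.\<close>
  have S_hit: "\<exists>k<Suc n. \<omega> \<in> E n k \<and> (\<forall>h. S h n \<omega> = h (B v \<omega> - B (r n (Suc k)) \<omega>))"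
    if \<omega>: "\<omega> \<in> space M" and hit: "a \<le> seg_max u v \<omega>" for n \<omega>
  proof -
    define j where "j = (LEAST j. a \<le> seg_max u (r n j) \<omega>)"
    have j: "a \<le> seg_max u (r n j) \<omega>" "j \<le> Suc n"
      unfolding j_def using hit rN
      by (metis (mono_tags, lifting) LeastI, metis (mono_tags, lifting) Least_le)
    have less: "seg_max u (r n i) \<omega> < a" if "i < j" for i
      using not_less_Least[OF that[unfolded j_def]] by simp
    \<comment> \<open>At the first grid point the running maximum is 0, which is below
      \<open>a\<close>.\<close>
    have "j \<noteq> 0"
      using j(1) \<open>0 < a\<close> r0[of n] by (intro notI) simp
    then obtain k where k: "j = Suc k" by (cases j) auto
    have kE: "\<omega> \<in> E n k" using j(1) less[of k] k \<omega> by (simp add: E_def)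
    have uniq: "i = k" if "\<omega> \<in> E n i" "i < Suc n" for i
    proof -
      have i: "seg_max u (r n i) \<omega> < a" "a \<le> seg_max u (r n (Suc i)) \<omega>"
        using that(1) unfolding E_def by blast+
      have "\<not> Suc i \<le> k"
        using less[of "Suc i"] i(2) k by (meson Suc_le_lessD less_Suc_eq_le not_less)
      moreover have "\<not> Suc k \<le> i"
      proof
        assume le: "Suc k \<le> i"
        have "i \<le> Suc n" "Suc k \<le> Suc n" using that(2) le by linarith+
        then have "u \<le> r n (Suc k)" "r n i \<le> 1"
          using r_range[of "Suc k" n] r_range[of i n] uv by linarith+
        then have "seg_max u (r n (Suc k)) \<omega> \<le> seg_max u (r n i) \<omega>"
          using seg_max_mono[OF \<omega> uv(1) _ r_mono[OF le]] by blast
        then show False using i(1) j(1) k by simp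
      qed
      ultimately show ?thesis by linarith
    qed
    have "S h n \<omega> = h (B v \<omega> - B (r n (Suc k)) \<omega>)" for h
    proof -
      have "S h n \<omega> = (\<Sum>i<Suc n. if i = k then h (B v \<omega> - B (r n (Suc k)) \<omega>) else 0)"
        unfolding S_def
      proof (rule sum.cong[OF refl])
        fix i assume "i \<in> {..<Suc n}"
        then have "\<omega> \<notin> E n i" if "i \<noteq> k"
          using uniq[of i] that by blast
        with kE show "indicator (E n i) \<omega> * h (B v \<omega> - B (r n (Suc i)) \<omega>)
            = (if i = k then h (B v \<omega> - B (r n (Suc k)) \<omega>) else 0)"
          by (cases "i = k") simp_all
      qed
      also have "\<dots> = h (B v \<omega> - B (r n (Suc k)) \<omega>)"
        using j(2) k by (subst sum.delta) simp_all
      finally show ?thesis .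
    qed
    then show ?thesis
      using kE j(2) k by (intro exI[of _ k] conjI allI) simp_all
  qed
  have S_miss: "S h n \<omega> = 0" if "\<omega> \<in> space M" "\<not> a \<le> seg_max u v \<omega>" for h n \<omega>
  proof -
    have "\<omega> \<notin> E n k" if "k < Suc n" for k
    proof -
      have "seg_max u (r n (Suc k)) \<omega> \<le> seg_max u v \<omega>"
        using that r_range[of "Suc k" n] uv \<open>\<omega> \<in> space M\<close> by (intro seg_max_mono; linarith)
      then show ?thesis using \<open>\<not> a \<le> _\<close> by (auto simp: E_def)
    qed
    then show ?thesis unfolding S_def by (intro sum.neutral ballI) (simp del: sum.lessThan_Suc)
  qed
  have S_bound: "\<bar>S h n \<omega>\<bar> \<le> K" if "\<omega> \<in> space M" "\<And>x. \<bar>h x\<bar> \<le> K" for h n \<omega>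
  proof (cases "a \<le> seg_max u v \<omega>")
    case True
    then show ?thesis using S_hit[OF that(1) True, of n] that(2) by auto
  next
    case False
    then show ?thesis using S_miss[OF that(1) False] that(2)[of 0] by auto
  qed
  have S_lim: "(\<lambda>n. S h n \<omega>) \<longlonglongrightarrow> (if a \<le> seg_max u v \<omega> then h (B v \<omega> - B u \<omega> - a) else 0)"
    if \<omega>: "\<omega> \<in> space M" and h: "continuous_on UNIV h" for h \<omega>
  proof (cases "a \<le> seg_max u v \<omega>")
    case True
    obtain \<kappa> where \<kappa>: "\<And>n. \<kappa> n < Suc n" "\<And>n. \<omega> \<in> E n (\<kappa> n)"
        "\<And>n h. S h n \<omega> = h (B v \<omega> - B (r n (Suc (\<kappa> n))) \<omega>)"
      using S_hit[OF \<omega> True] by metis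
    have unif: "uniformly_continuous_on {0..1} (\<lambda>t. B t \<omega>)"
      by (rule compact_uniformly_continuous[OF continuous_B[OF \<omega>]]) simp
    have "(\<lambda>n. B (r n (Suc (\<kappa> n))) \<omega>) \<longlonglongrightarrow> B u \<omega> + a"
    proof (rule LIMSEQ_I)
      fix e :: real assume "0 < e"
      then obtain d where d: "0 < d" "\<And>s t. s \<in> {0..1} \<Longrightarrow> t \<in> {0..1} \<Longrightarrow> dist s t < d \<Longrightarrow> dist (B s \<omega>) (B t \<omega>) < e"
        using unif unfolding uniformly_continuous_on_def by metis
      have "(\<lambda>n. (v - u) / real (Suc n)) \<longlonglongrightarrow> 0"
        by real_asymp
      then have "\<forall>\<^sub>F n in sequentially. (v - u) / real (Suc n) < d"
        using d(1) by (rule order_tendstoD)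
      then obtain n0 where n0: "\<And>n. n0 \<le> n \<Longrightarrow> (v - u) / real (Suc n) < d"
        by (auto simp: eventually_sequentially)
      have "norm (B (r n (Suc (\<kappa> n))) \<omega> - (B u \<omega> + a)) < e" if "n0 \<le> n" for n
      proof -
        define p q where "p = r n (\<kappa> n)" and "q = r n (Suc (\<kappa> n))"
        have \<kappa>n: "\<kappa> n \<le> Suc n" "Suc (\<kappa> n) \<le> Suc n" "\<kappa> n \<le> Suc (\<kappa> n)"
          using \<kappa>(1)[of n] by simp_all
        have pq: "u \<le> p" "p \<le> q" "q \<le> v"
          unfolding p_def q_def using r_range(1)[OF \<kappa>n(1)] r_range(2)[OF \<kappa>n(2)] r_mono[OF \<kappa>n(3)] by blast+
        have "q - p < d"
          unfolding p_def q_def r_step by (rule n0[OF that])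
        have mp: "seg_max u p \<omega> < a" and mq: "a \<le> seg_max u q \<omega>"
          using \<kappa>(2)[of n] unfolding E_def p_def q_def by blast+
        have uq: "\<omega> \<in> space M" "0 \<le> u" "u \<le> q" "q \<le> 1" using pq uv \<omega> by linarith+
        \<comment> \<open>The maximum over \<open>{u..q}\<close> is at least \<open>a\<close> and is
          attained after \<open>p\<close>, since up to \<open>p\<close> the path stays below
          \<open>a\<close>. The intermediate value theorem then gives a time \<open>s\<close> in the
          cell with value exactly \<open>a\<close>, and uniform continuity compares
          \<open>B q\<close> with \<open>B s\<close>.\<close>
        obtain t where t: "t \<in> {u..q}" "B t \<omega> - B u \<omega> = seg_max u q \<omega>"
          by (rule seg_max_attained[OF uq]) auto
        have "p < t"
        proof (rule ccontr)
          assume "\<not> p < t"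
          then have "t \<le> p" by simp
          then have "B t \<omega> - B u \<omega> \<le> seg_max u p \<omega>"
            using t(1) pq uq by (intro incr_le_seg_max) simp_all
          then show False using t(2) mp mq by linarith
        qed
        have "B p \<omega> - B u \<omega> \<le> a"
          using incr_le_seg_max[of \<omega> u p p] pq uq mp by linarith
        moreover have "a \<le> B t \<omega> - B u \<omega>"
          using t(2) mq by simp
        moreover have "continuous_on {p..t} (\<lambda>t. B t \<omega> - B u \<omega>)"
          using pq uq t(1) by (intro continuous_incr) simp_all
        ultimately obtain s where s: "p \<le> s" "s \<le> t" "B s \<omega> - B u \<omega> = a"
          using IVT'[of "\<lambda>t. B t \<omega> - B u \<omega>" p a t] \<open>p < t\<close> by force
        have "s \<in> {0..1}" "q \<in> {0..1}" "dist q s < d"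
          using s(1,2) t(1) pq \<open>q - p < d\<close> uv by (simp_all add: dist_real_def)
        then have "dist (B q \<omega>) (B s \<omega>) < e"
          by (intro d(2))
        moreover have "B u \<omega> + a = B s \<omega>"
          using s(3) by linarith
        ultimately show ?thesis
          unfolding q_def dist_real_def real_norm_def by simp
      qed
      then show "\<exists>n0. \<forall>n\<ge>n0. norm (B (r n (Suc (\<kappa> n))) \<omega> - (B u \<omega> + a)) < e"
        by blast
    qed
    then have "(\<lambda>n. B v \<omega> - B (r n (Suc (\<kappa> n))) \<omega>) \<longlonglongrightarrow> B v \<omega> - (B u \<omega> + a)"
      by (intro tendsto_diff tendsto_const)
    then have "(\<lambda>n. h (B v \<omega> - B (r n (Suc (\<kappa> n))) \<omega>)) \<longlonglongrightarrow> h (B v \<omega> - (B u \<omega> + a))"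
      by (rule continuous_on_tendsto_compose[OF h]) simp_all
    then show ?thesis using True \<kappa>(3) by (simp add: diff_diff_eq)
  next
    case False
    then show ?thesis using S_miss[OF \<omega> False] by simp
  qed
  \<comment> \<open>The limit statement is needed for \<open>f\<close> and for its mirror image; for
    each \<open>n\<close> the two discretised expectations agree term by term.\<close>
  have f': "continuous_on UNIV (\<lambda>x. f (- x))"
    using f by (intro continuous_on_compose2[OF f]) (auto intro!: continuous_intros)
  have lim: "(\<lambda>n. expectation (S h n)) \<longlonglongrightarrow>
      expectation (\<lambda>\<omega>. if a \<le> seg_max u v \<omega> then h (B v \<omega> - B u \<omega> - a) else 0)"
    if h: "continuous_on UNIV h" and hb: "\<And>x. \<bar>h x\<bar> \<le> K" for h
  proof (rule integral_dominated_convergence[where w = "\<lambda>_. K"])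
    have [measurable]: "h \<in> borel_measurable borel"
      using h by (rule borel_measurable_continuous_onI)
    show "(\<lambda>\<omega>. if a \<le> seg_max u v \<omega> then h (B v \<omega> - B u \<omega> - a) else 0) \<in> borel_measurable M"
      by measurable
    show "S h n \<in> borel_measurable M" for n
      by (rule S_meas) measurable
    show "AE \<omega> in M. (\<lambda>n. S h n \<omega>) \<longlonglongrightarrow> (if a \<le> seg_max u v \<omega> then h (B v \<omega> - B u \<omega> - a) else 0)"
      using S_lim[OF _ h] by (intro AE_I2)
    show "AE \<omega> in M. norm (S h n \<omega>) \<le> K" for n
      using S_bound[OF _ hb] by (intro AE_I2) simp
  qed simp
  have "expectation (S f n) = expectation (S (\<lambda>x. f (- x)) n)" for n
  proof -
    have int: "integrable M (\<lambda>\<omega>. indicator (E n k) \<omega> * h (B v \<omega> - B (r n (Suc k)) \<omega>))"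
      if "k < Suc n" and [measurable]: "h \<in> borel_measurable borel" and "\<And>x. \<bar>h x\<bar> \<le> K" for h :: "real \<Rightarrow> real" and k
    proof (rule integrable_const_bound[of _ K])
      show "AE \<omega> in M. norm (indicator (E n k) \<omega> * h (B v \<omega> - B (r n (Suc k)) \<omega>)) \<le> K"
        using that(3) order_trans[OF abs_ge_zero that(3)] by (intro AE_I2) (auto simp: indicator_def)
      show "(\<lambda>\<omega>. indicator (E n k) \<omega> * h (B v \<omega> - B (r n (Suc k)) \<omega>)) \<in> borel_measurable M"
        using S_term[OF that(1,2)] .
    qed
    have "expectation (S f n) = (\<Sum>k<Suc n. expectation (\<lambda>\<omega>. indicator (E n k) \<omega> * f (B v \<omega> - B (r n (Suc k)) \<omega>)))"
      unfolding S_def using bound by (intro Bochner_Integration.integral_sum int) auto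
    also have "\<dots> = (\<Sum>k<Suc n. expectation (\<lambda>\<omega>. indicator (E n k) \<omega> * f (- (B v \<omega> - B (r n (Suc k)) \<omega>))))"
      using uv r_range bound E_seg
      by (intro sum.cong refl expectation_past_incr_minus[where K = K and u = u]) auto
    also have "\<dots> = expectation (S (\<lambda>x. f (- x)) n)"
      unfolding S_def using bound by (intro Bochner_Integration.integral_sum[symmetric] int) auto
    finally show ?thesis .
  qed
  with lim[OF f bound] have "(\<lambda>n. expectation (S (\<lambda>x. f (- x)) n)) \<longlonglongrightarrow>
      expectation (\<lambda>\<omega>. if a \<le> seg_max u v \<omega> then f (B v \<omega> - B u \<omega> - a) else 0)"
    by simp
  from LIMSEQ_unique[OF this lim[OF f']] bound show ?thesis
    by simp
qed

lemma measurable_incr: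
  "0 \<le> u \<Longrightarrow> u \<le> v \<Longrightarrow> v \<le> 1 \<Longrightarrow> (\<lambda>\<omega>. B v \<omega> - B u \<omega>) \<in> borel_measurable M"
  by (intro borel_measurable_diff measurable_B) simp_all

lemma measurable_seg_max_M:
  "0 \<le> u \<Longrightarrow> u \<le> v \<Longrightarrow> v \<le> 1 \<Longrightarrow> seg_max u v \<in> borel_measurable M"
  by (rule measurable_seg_M[OF measurable_seg_max])

lemma measurable_seg_argmax_M:
  "0 \<le> u \<Longrightarrow> u \<le> v \<Longrightarrow> v \<le> 1 \<Longrightarrow> seg_argmax u v \<in> borel_measurable M"
  by (rule measurable_seg_M[OF measurable_seg_argmax])

lemma reflection:
  assumes uv: "0 \<le> u" "u < v" "v \<le> 1" and "0 < a" "x \<le> a"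
  shows "prob {\<omega> \<in> space M. B v \<omega> - B u \<omega> \<le> x \<and> a \<le> seg_max u v \<omega>}
    = prob {\<omega> \<in> space M. 2 * a - x \<le> B v \<omega> - B u \<omega>}"
proof -
  define X where "X \<omega> = B v \<omega> - B u \<omega>" for \<omega>
  \<comment> \<open>A continuous ramp of slope \<open>- m\<close>: it equals 1 up to
    \<open>x - a\<close>, descends to 0, and converges pointwise to the indicator of
    \<open>{..x - a}\<close>, end point included.\<close>
  define f where "f m z = max 0 (min 1 (1 - real m * (z - (x - a))))" for m z
  have cont: "continuous_on UNIV (f m)" for m
    unfolding f_def by (intro continuous_intros)
  have bound: "\<bar>f m z\<bar> \<le> 1" for m z
    by (simp add: f_def)
  have f_lim: "(\<lambda>m. f m z) \<longlonglongrightarrow> (if z \<le> x - a then 1 else 0)" for z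
  proof (cases "z \<le> x - a")
    case True
    then have "real m * (z - (x - a)) \<le> 0" for m
      by (simp add: mult_nonneg_nonpos)
    then have "f m z = 1" for m
      unfolding f_def by (simp add: min_absorb1)
    with True show ?thesis by simp
  next
    case False
    then obtain n where n: "1 < real n * (z - (x - a))"
      using reals_Archimedean3[of "z - (x - a)"] by auto
    have "f m z = 0" if "n \<le> m" for m
    proof -
      have "real n * (z - (x - a)) \<le> real m * (z - (x - a))"
        using that False by (intro mult_right_mono) simp_all
      with n show ?thesis by (simp add: f_def max_def min_def)
    qed
    then have "\<forall>\<^sub>F m in sequentially. f m z = 0"
      by (auto simp: eventually_sequentially)
    with False show ?thesis by (simp add: tendsto_eventually)
  qed
  have [measurable]: "X \<in> borel_measurable M" "seg_max u v \<in> borel_measurable M"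
    unfolding X_def[abs_def] using uv by (simp_all add: measurable_incr measurable_seg_max_M)
  have lim: "(\<lambda>m. expectation (\<lambda>\<omega>. if a \<le> seg_max u v \<omega> then f m (Z \<omega>) else 0))
      \<longlonglongrightarrow> prob {\<omega> \<in> space M. a \<le> seg_max u v \<omega> \<and> Z \<omega> \<le> x - a}"
    if [measurable]: "Z \<in> borel_measurable M" for Z
  proof -
    have "(\<lambda>m. expectation (\<lambda>\<omega>. if a \<le> seg_max u v \<omega> then f m (Z \<omega>) else 0))
      \<longlonglongrightarrow> expectation (indicator {\<omega> \<in> space M. a \<le> seg_max u v \<omega> \<and> Z \<omega> \<le> x - a})"
    proof (rule integral_dominated_convergence[where w = "\<lambda>_. 1"])
      show "AE \<omega> in M. (\<lambda>m. if a \<le> seg_max u v \<omega> then f m (Z \<omega>) else 0)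
        \<longlonglongrightarrow> indicator {\<omega> \<in> space M. a \<le> seg_max u v \<omega> \<and> Z \<omega> \<le> x - a} \<omega>"
      proof (rule AE_I2)
        fix \<omega> assume "\<omega> \<in> space M"
        then show "(\<lambda>m. if a \<le> seg_max u v \<omega> then f m (Z \<omega>) else 0)
          \<longlonglongrightarrow> indicator {\<omega> \<in> space M. a \<le> seg_max u v \<omega> \<and> Z \<omega> \<le> x - a} \<omega>"
          using f_lim[of "Z \<omega>"]
          by (cases "a \<le> seg_max u v \<omega>"; cases "Z \<omega> \<le> x - a") (simp_all add: indicator_def)
      qed
      show "AE \<omega> in M. norm (if a \<le> seg_max u v \<omega> then f m (Z \<omega>) else 0) \<le> 1" for m
        by (rule AE_I2) (simp add: bound)
      have [measurable]: "f m \<in> borel_measurable borel" for m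
        by (rule borel_measurable_continuous_onI[OF cont])
      show "(\<lambda>\<omega>. if a \<le> seg_max u v \<omega> then f m (Z \<omega>) else 0) \<in> borel_measurable M" for m
        by measurable
    qed simp_all
    then show ?thesis by simp
  qed
  have "(\<lambda>m. expectation (\<lambda>\<omega>. if a \<le> seg_max u v \<omega> then f m (X \<omega> - a) else 0))
      = (\<lambda>m. expectation (\<lambda>\<omega>. if a \<le> seg_max u v \<omega> then f m (- (X \<omega> - a)) else 0))"
    unfolding X_def by (rule ext) (rule reflection_continuous[OF uv \<open>0 < a\<close> cont bound])
  with lim[of "\<lambda>\<omega>. X \<omega> - a"] lim[of "\<lambda>\<omega>. - (X \<omega> - a)"]
  have "prob {\<omega> \<in> space M. a \<le> seg_max u v \<omega> \<and> X \<omega> - a \<le> x - a}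
      = prob {\<omega> \<in> space M. a \<le> seg_max u v \<omega> \<and> - (X \<omega> - a) \<le> x - a}"
    by (intro LIMSEQ_unique[of _ "prob {\<omega> \<in> space M. a \<le> seg_max u v \<omega> \<and> X \<omega> - a \<le> x - a}"]) simp_all
  \<comment> \<open>Since \<open>x \<le> a\<close>, a path that ends at or above
    \<open>2 * a - x\<close> ends at or above \<open>a\<close>, so it has certainly reached the
    level.\<close>
  moreover have "{\<omega> \<in> space M. a \<le> seg_max u v \<omega> \<and> - (X \<omega> - a) \<le> x - a} = {\<omega> \<in> space M. 2 * a - x \<le> X \<omega>}"
  proof -
    have "a \<le> seg_max u v \<omega>" if "\<omega> \<in> space M" "2 * a - x \<le> X \<omega>" for \<omega>
      using incr_le_seg_max[of \<omega> u v v] that uv \<open>x \<le> a\<close> unfolding X_def by simp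
    then show ?thesis by auto
  qed
  moreover have "{\<omega> \<in> space M. a \<le> seg_max u v \<omega> \<and> X \<omega> - a \<le> x - a}
      = {\<omega> \<in> space M. X \<omega> \<le> x \<and> a \<le> seg_max u v \<omega>}"
    by auto
  ultimately show ?thesis unfolding X_def by simp
qed

section \<open>The joint law of increment and maximum\<close>

lemma emeasure_incr:
  assumes "0 \<le> u" "u < v" "v \<le> 1" "A \<in> sets borel"
  shows "emeasure M {\<omega> \<in> space M. B v \<omega> - B u \<omega> \<in> A} = (\<integral>\<^sup>+x. ennreal (phi (v - u) x) * indicator A x \<partial>lborel)"
proof -
  have "emeasure M {\<omega> \<in> space M. B v \<omega> - B u \<omega> \<in> A} = emeasure M ((\<lambda>\<omega>. B v \<omega> - B u \<omega>) -` A \<inter> space M)"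
    by (rule arg_cong[where f = "emeasure M"]) auto
  then show ?thesis
    using distributed_emeasure[OF distributed_incr[OF assms(1-3)], of A] assms
    by (simp add: phi_eq_normal_density)
qed

text \<open>Among the paths that end at or below \<open>p\<close>, those reaching \<open>m\<close>
  have by reflection the mass \<open>J\<close> of increments at least \<open>2 * m - p\<close>. The
  Gaussian density splits accordingly as \<open>g T m (m - y) + phi T (2 * m - y)\<close>, and
  cancelling the finite \<open>J\<close> leaves the killed kernel.\<close>

lemma emeasure_incr_max:
  assumes uv: "0 \<le> u" "u < v" "v \<le> 1" and "0 < m"
  shows "emeasure M {\<omega> \<in> space M. B v \<omega> - B u \<omega> \<le> x \<and> seg_max u v \<omega> < m}
    = (\<integral>\<^sup>+y. ennreal (if y < m then g (v - u) m (m - y) else 0) * indicator {..x} y \<partial>lborel)"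
proof -
  define T where "T = v - u"
  define X where "X \<omega> = B v \<omega> - B u \<omega>" for \<omega>
  \<comment> \<open>Reflection at \<open>m\<close> requires an end point of at most
    \<open>m\<close>. Truncation loses nothing, as a path whose maximum is below \<open>m\<close>
    also ends below \<open>m\<close>.\<close>
  define p where "p = min x m"
  have T: "0 < T" using uv by (simp add: T_def)
  have [measurable]: "X \<in> borel_measurable M" "seg_max u v \<in> borel_measurable M"
    unfolding X_def[abs_def] using uv by (simp_all add: measurable_incr measurable_seg_max_M)
  define I where "I = (\<integral>\<^sup>+y. ennreal (g T m (m - y)) * indicator {..p} y \<partial>lborel)"
  define J where "J = emeasure M {\<omega> \<in> space M. 2 * m - p \<le> X \<omega>}"
  define K where "K = emeasure M {\<omega> \<in> space M. X \<omega> \<le> p \<and> seg_max u v \<omega> < m}"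
  have "emeasure M {\<omega> \<in> space M. X \<omega> \<le> p}
    = K + emeasure M {\<omega> \<in> space M. X \<omega> \<le> p \<and> m \<le> seg_max u v \<omega>}"
    unfolding K_def by (subst plus_emeasure) (auto intro!: arg_cong[where f = "emeasure M"])
  also have "emeasure M {\<omega> \<in> space M. X \<omega> \<le> p \<and> m \<le> seg_max u v \<omega>} = J"
    using reflection[OF uv \<open>0 < m\<close>, of p] unfolding J_def X_def by (simp add: emeasure_eq_measure p_def)
  finally have 1: "emeasure M {\<omega> \<in> space M. X \<omega> \<le> p} = K + J" .
  have J: "J = (\<integral>\<^sup>+y. ennreal (phi T (2 * m - y)) * indicator {..p} y \<partial>lborel)"
  proof -
    have "J = (\<integral>\<^sup>+z. ennreal (phi T z) * indicator {2 * m - p..} z \<partial>lborel)"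
      unfolding J_def X_def T_def using emeasure_incr[OF uv, of "{2 * m - p..}"] by simp
    also have "\<dots> = (\<integral>\<^sup>+y. ennreal (phi T (2 * m - y)) * indicator {2 * m - p..} (2 * m - y) \<partial>lborel)"
      by (rule nn_integral_lborel_reflect[symmetric]) measurable
    also have "\<dots> = (\<integral>\<^sup>+y. ennreal (phi T (2 * m - y)) * indicator {..p} y \<partial>lborel)"
      by (intro nn_integral_cong) (simp split: split_indicator)
    finally show ?thesis .
  qed
  have "emeasure M {\<omega> \<in> space M. X \<omega> \<le> p} = (\<integral>\<^sup>+y. ennreal (phi T y) * indicator {..p} y \<partial>lborel)"
    unfolding X_def T_def using emeasure_incr[OF uv, of "{..p}"] by simp
  also have "\<dots> = (\<integral>\<^sup>+y. ennreal (g T m (m - y)) * indicator {..p} y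
      + ennreal (phi T (2 * m - y)) * indicator {..p} y \<partial>lborel)"
  proof (rule nn_integral_cong)
    fix y
    have "0 \<le> g T m (m - y)" if "y \<le> p"
      using that T \<open>0 < m\<close> by (intro g_nonneg) (simp_all add: p_def)
    moreover have "phi T y = g T m (m - y) + phi T (2 * m - y)"
      by (simp add: g_def)
    ultimately show "ennreal (phi T y) * indicator {..p} y =
        ennreal (g T m (m - y)) * indicator {..p} y + ennreal (phi T (2 * m - y)) * indicator {..p} y"
      by (simp add: phi_nonneg ennreal_plus split: split_indicator)
  qed
  also have "\<dots> = I + J"
    unfolding I_def J by (rule nn_integral_add) measurable
  finally have "J + K = J + I"
    using 1 by (simp add: add.commute)
  moreover have "J \<noteq> \<infinity>" by (simp add: J_def)
  ultimately have "K = I"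
    by (simp add: ennreal_add_left_cancel)
  have "{\<omega> \<in> space M. X \<omega> \<le> x \<and> seg_max u v \<omega> < m} = {\<omega> \<in> space M. X \<omega> \<le> p \<and> seg_max u v \<omega> < m}"
  proof -
    have "X \<omega> \<le> m" if "\<omega> \<in> space M" "seg_max u v \<omega> < m" for \<omega>
      using incr_le_seg_max[of \<omega> u v v] that uv unfolding X_def by simp
    then show ?thesis by (auto simp: p_def)
  qed
  then have "emeasure M {\<omega> \<in> space M. X \<omega> \<le> x \<and> seg_max u v \<omega> < m} = I"
    using \<open>K = I\<close> by (simp add: K_def)
  also have "I = (\<integral>\<^sup>+y. ennreal (if y < m then g T m (m - y) else 0) * indicator {..x} y \<partial>lborel)"
    unfolding I_def
  proof (rule nn_integral_cong)
    fix y
    have "g T m (m - y) = 0" if "y = m" using that by (simp add: g_def)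
    then show "ennreal (g T m (m - y)) * indicator {..p} y
        = ennreal (if y < m then g T m (m - y) else 0) * indicator {..x} y"
      by (cases y m rule: linorder_cases) (simp_all add: p_def split: split_indicator)
  qed
  finally show ?thesis unfolding X_def T_def .
qed

lemma distributed_incr_max:
  assumes uv: "0 \<le> u" "u < v" "v \<le> 1"
  shows "distributed M (lborel \<Otimes>\<^sub>M lborel) (\<lambda>\<omega>. (B v \<omega> - B u \<omega>, seg_max u v \<omega>))
    (\<lambda>(x, m). ennreal (max_density (v - u) x m))"
proof -
  define T where "T = v - u"
  define X where "X \<omega> = B v \<omega> - B u \<omega>" for \<omega>
  have T: "0 < T" using uv by (simp add: T_def)
  have X [measurable]: "X \<in> borel_measurable M" and mx [measurable]: "seg_max u v \<in> borel_measurable M"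
    unfolding X_def[abs_def] using uv by (simp_all add: measurable_incr measurable_seg_max_M)
  have rv [measurable]: "(\<lambda>\<omega>. (X \<omega>, seg_max u v \<omega>)) \<in> measurable M (lborel \<Otimes>\<^sub>M lborel)"
    by measurable
  have dens [measurable]: "(\<lambda>(x, m). ennreal (max_density T x m)) \<in> borel_measurable (lborel \<Otimes>\<^sub>M lborel)"
    by measurable
  have "distr M (lborel \<Otimes>\<^sub>M lborel) (\<lambda>\<omega>. (X \<omega>, seg_max u v \<omega>))
    = density (lborel \<Otimes>\<^sub>M lborel) (\<lambda>(x, m). ennreal (max_density T x m))" (is "?\<mu> = ?\<nu>")
  \<comment> \<open>Open half-lines for the maximum, because \<open>emeasure_incr_max\<close>
    concerns the strict complement of the event of reaching \<open>m\<close>.\<close>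
  proof (rule measure_eqI_pair[where A = lborel and B = lborel and Ea = "range atMost" and Eb = "range lessThan"
        and a = "\<lambda>n. {..real n}" and b = "\<lambda>n. {..<real n}"])
    show "finite_measure ?\<mu>"
      by (intro prob_space.finite_measure prob_space_distr rv)
    fix P Q assume "P \<in> range (atMost :: real \<Rightarrow> _)" "Q \<in> range (lessThan :: real \<Rightarrow> _)"
    then obtain x m where PQ: "P = {..x}" "Q = {..<m}" by blast
    have "emeasure ?\<mu> (P \<times> Q) = emeasure M {\<omega> \<in> space M. X \<omega> \<le> x \<and> seg_max u v \<omega> < m}"
      unfolding PQ by (subst emeasure_distr) (auto intro!: arg_cong[where f = "emeasure M"])
    also have "\<dots> = (\<integral>\<^sup>+y. ennreal (if 0 < m \<and> y < m then g T m (m - y) else 0) * indicator {..x} y \<partial>lborel)"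
    proof (cases "0 < m")
      case True
      then show ?thesis
        using emeasure_incr_max[OF uv True, of x] unfolding X_def T_def by simp
    next
      case False
      have empty: "{\<omega> \<in> space M. X \<omega> \<le> x \<and> seg_max u v \<omega> < m} = {}"
      proof -
        have "0 \<le> seg_max u v \<omega>" if "\<omega> \<in> space M" for \<omega>
          using seg_max_nonneg[OF that, of u v] uv by simp
        with False show ?thesis by force
      qed
      show ?thesis unfolding empty using False by simp
    qed
    also have "\<dots> = (\<integral>\<^sup>+y. (\<integral>\<^sup>+z. ennreal (max_density T y z) * indicator (P \<times> Q) (y, z) \<partial>lborel) \<partial>lborel)"
    proof (rule nn_integral_cong)
      fix y
      have "(\<integral>\<^sup>+z. ennreal (max_density T y z) * indicator (P \<times> Q) (y, z) \<partial>lborel)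
        = (\<integral>\<^sup>+z. indicator {..x} y * (ennreal (max_density T y z) * indicator {..m} z) \<partial>lborel)"
        unfolding PQ using AE_lborel_singleton[of m]
        by (intro nn_integral_cong_AE) (auto elim!: eventually_mono split: split_indicator)
      also have "\<dots> = indicator {..x} y * (\<integral>\<^sup>+z. ennreal (max_density T y z) * indicator {..m} z \<partial>lborel)"
        by (rule nn_integral_cmult) measurable
      finally show "ennreal (if 0 < m \<and> y < m then g T m (m - y) else 0) * indicator {..x} y
          = (\<integral>\<^sup>+z. ennreal (max_density T y z) * indicator (P \<times> Q) (y, z) \<partial>lborel)"
        unfolding nn_integral_max_density_max[OF T] by (subst mult.commute) (rule sym)
    qed
    also have "\<dots> = emeasure ?\<nu> (P \<times> Q)"
      unfolding PQ by (subst emeasure_density, measurable) (subst lborel.nn_integral_fst[symmetric], measurable)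
    finally show "emeasure ?\<mu> (P \<times> Q) = emeasure ?\<nu> (P \<times> Q)" .
  next
    show "{..real n} \<in> range atMost" "{..<real n} \<in> range lessThan" for n by blast+
  qed (simp_all add: sets_borel_eq_atMost[symmetric] sets_borel_eq_lessThan[symmetric]
      Int_stable_atMost Int_stable_lessThan Union_atMost_real Union_lessThan_real incseq_def)
  then show ?thesis
    using rv dens unfolding distributed_def X_def T_def by blast
qed

lemma nn_integral_incr_max:
  assumes "0 \<le> u" "u < v" "v \<le> 1" and F [measurable]: "F \<in> borel_measurable (borel \<Otimes>\<^sub>M borel)"
  shows "(\<integral>\<^sup>+\<omega>. F (B v \<omega> - B u \<omega>, seg_max u v \<omega>) \<partial>M)
    = (\<integral>\<^sup>+x. (\<integral>\<^sup>+m. ennreal (max_density (v - u) x m) * F (x, m) \<partial>lborel) \<partial>lborel)"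
proof -
  have "(\<integral>\<^sup>+\<omega>. F (B v \<omega> - B u \<omega>, seg_max u v \<omega>) \<partial>M)
    = (\<integral>\<^sup>+p. (\<lambda>(x, m). ennreal (max_density (v - u) x m)) p * F p \<partial>(lborel \<Otimes>\<^sub>M lborel))"
    by (rule distributed_nn_integral[symmetric, OF distributed_incr_max[OF assms(1-3)]]) measurable
  then show ?thesis
    by (subst (asm) lborel.nn_integral_fst[symmetric]) simp_all
qed

lemma emeasure_seg_max_le:
  assumes "0 \<le> u" "u < v" "v \<le> 1"
  shows "emeasure M {\<omega> \<in> space M. seg_max u v \<omega> \<le> c}
    = ennreal (if 0 < c then erf (c / sqrt (2 * (v - u))) else 0)"
proof -
  have [measurable]: "seg_max u v \<in> borel_measurable M"
    using assms by (simp add: measurable_seg_max_M)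
  have "emeasure M {\<omega> \<in> space M. seg_max u v \<omega> \<le> c} = (\<integral>\<^sup>+\<omega>. indicator {..c} (seg_max u v \<omega>) \<partial>M)"
  proof -
    have "(\<integral>\<^sup>+\<omega>. indicator {..c} (seg_max u v \<omega>) \<partial>M)
      = (\<integral>\<^sup>+\<omega>. indicator {\<omega> \<in> space M. seg_max u v \<omega> \<le> c} \<omega> \<partial>M)"
      by (rule nn_integral_cong) (simp split: split_indicator)
    then show ?thesis by simp
  qed
  also have "\<dots> = (\<integral>\<^sup>+x. (\<integral>\<^sup>+m. ennreal (max_density (v - u) x m) * indicator {..c} m \<partial>lborel) \<partial>lborel)"
    using nn_integral_incr_max[OF assms, of "\<lambda>(x, m). indicator {..c} m"] by simp
  also have "\<dots> = (\<integral>\<^sup>+x. ennreal (if 0 < c \<and> x < c then g (v - u) c (c - x) else 0) \<partial>lborel)"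
    using assms by (simp only: nn_integral_max_density_max diff_gt_0_iff_gt)
  also have "\<dots> = ennreal (if 0 < c then erf (c / sqrt (2 * (v - u))) else 0)"
    using nn_integral_g[of "v - u" c] assms by (cases "0 < c") simp_all
  finally show ?thesis .
qed

end

section \<open>Joint law of increment, location and maximum\<close>

lemma nn_integral_lborel_triple:
  fixes F :: "real \<times> real \<times> real \<Rightarrow> ennreal"
  assumes [measurable]: "F \<in> borel_measurable (borel \<Otimes>\<^sub>M borel \<Otimes>\<^sub>M borel)"
  shows "(\<integral>\<^sup>+p. F p \<partial>(lborel \<Otimes>\<^sub>M lborel \<Otimes>\<^sub>M lborel))
    = (\<integral>\<^sup>+x. (\<integral>\<^sup>+y. (\<integral>\<^sup>+z. F (x, y, z) \<partial>lborel) \<partial>lborel) \<partial>lborel)"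
proof -
  have "sigma_finite_measure (lborel \<Otimes>\<^sub>M lborel :: (real \<times> real) measure)"
    unfolding lborel_prod by (rule sigma_finite_lborel)
  then have "(\<integral>\<^sup>+p. F p \<partial>(lborel \<Otimes>\<^sub>M lborel \<Otimes>\<^sub>M lborel))
    = (\<integral>\<^sup>+x. (\<integral>\<^sup>+q. F (x, q) \<partial>(lborel \<Otimes>\<^sub>M lborel)) \<partial>lborel)"
    by (rule sigma_finite_measure.nn_integral_fst[symmetric]) measurable
  also have "\<dots> = (\<integral>\<^sup>+x. (\<integral>\<^sup>+y. (\<integral>\<^sup>+z. F (x, y, z) \<partial>lborel) \<partial>lborel) \<partial>lborel)"
    by (intro nn_integral_cong lborel.nn_integral_fst[symmetric]) measurable
  finally show ?thesis .
qed

lemma nn_integral_lborel_swap: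
  fixes f :: "real \<Rightarrow> real \<Rightarrow> ennreal"
  assumes "(\<lambda>(x, y). f x y) \<in> borel_measurable (borel \<Otimes>\<^sub>M borel)"
  shows "(\<integral>\<^sup>+x. (\<integral>\<^sup>+y. f x y \<partial>lborel) \<partial>lborel) = (\<integral>\<^sup>+y. (\<integral>\<^sup>+x. f x y \<partial>lborel) \<partial>lborel)"
proof (rule lborel_pair.Fubini'[symmetric])
  have "sets (lborel \<Otimes>\<^sub>M lborel) = sets (borel \<Otimes>\<^sub>M borel :: (real \<times> real) measure)"
    by (rule sets_pair_measure_cong) simp_all
  then show "(\<lambda>(x, y). f x y) \<in> borel_measurable (lborel \<Otimes>\<^sub>M lborel)"
    using assms by (simp cong: measurable_cong_sets)
qed

text \<open>A half-line is imposed on the location only, which is accessible just through its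
  distribution function; the height may be tested on any Borel set.\<close>

lemma sets_borel_pair_atMost:
  "sets (borel \<Otimes>\<^sub>M borel :: (real \<times> real) measure)
    = sigma_sets UNIV {{..t} \<times> C | t C. C \<in> sets borel}"
proof -
  let ?E = "{X \<times> C | X C. X \<in> range atMost \<and> C \<in> sets borel} :: (real \<times> real) set set"
  have "sets (borel \<Otimes>\<^sub>M borel :: (real \<times> real) measure) = sets (sigma (space borel \<times> space borel) ?E)"
  proof (rule sets_pair_eq[where Ca = "range (\<lambda>n. {..real n})" and Cb = "{UNIV}"])
    show "sets borel = sigma_sets (space borel) (range (atMost :: real \<Rightarrow> _))"
      using sets_borel_eq_atMost by simp
    show "sets borel = sigma_sets (space borel) (sets (borel :: real measure))"
      by (rule sets.sigma_sets_eq[symmetric])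
    show "\<Union> (range (\<lambda>n. {..real n})) = space borel"
      using Union_atMost_real by simp
  qed auto
  also have "\<dots> = sigma_sets UNIV ?E"
    by (subst sets_measure_of) auto
  also have "?E = {{..t} \<times> C | t C. C \<in> sets borel}"
    by auto
  finally show ?thesis .
qed

lemma Int_stable_atMost_times: "Int_stable {{..t::real} \<times> C | t C. C \<in> sets (borel :: real measure)}"
proof (rule Int_stableI)
  fix a b assume "a \<in> {{..t::real} \<times> C | t C. C \<in> sets (borel :: real measure)}"
    "b \<in> {{..t::real} \<times> C | t C. C \<in> sets (borel :: real measure)}"
  then obtain t C t' C' where "a = {..t} \<times> C" "b = {..t'} \<times> C'" "C \<in> sets borel" "C' \<in> sets borel"
    by blast
  moreover have "({..t} \<times> C) \<inter> ({..t'} \<times> C') = {..min t t'} \<times> (C \<inter> C')"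
    by auto
  moreover have "C \<inter> C' \<in> sets borel"
    using calculation(3,4) by (rule sets.Int)
  ultimately show "a \<inter> b \<in> {{..t::real} \<times> C | t C. C \<in> sets (borel :: real measure)}"
    by blast
qed

lemma (in prob_space) nn_integral_indep_var:
  assumes ind: "indep_var S X T Y" and F: "F \<in> borel_measurable (S \<Otimes>\<^sub>M T)"
  shows "(\<integral>\<^sup>+\<omega>. F (X \<omega>, Y \<omega>) \<partial>M) = (\<integral>\<^sup>+\<omega>. (\<integral>\<^sup>+\<omega>'. F (X \<omega>, Y \<omega>') \<partial>M) \<partial>M)"
proof -
  have X [measurable]: "X \<in> measurable M S" and Y [measurable]: "Y \<in> measurable M T"
    using indep_var_rv1[OF ind] indep_var_rv2[OF ind] .
  note [measurable] = F
  interpret Y: prob_space "distr M T Y" by (rule prob_space_distr[OF Y])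
  have F': "F \<in> borel_measurable (distr M S X \<Otimes>\<^sub>M distr M T Y)"
    using F by (simp cong: measurable_cong_sets sets_pair_measure_cong)
  have "(\<integral>\<^sup>+\<omega>. F (X \<omega>, Y \<omega>) \<partial>M) = (\<integral>\<^sup>+p. F p \<partial>distr M (S \<Otimes>\<^sub>M T) (\<lambda>\<omega>. (X \<omega>, Y \<omega>)))"
    by (rule nn_integral_distr[symmetric]) measurable
  also have "\<dots> = (\<integral>\<^sup>+p. F p \<partial>(distr M S X \<Otimes>\<^sub>M distr M T Y))"
    using ind unfolding indep_var_distribution_eq by simp
  also have "\<dots> = (\<integral>\<^sup>+x. (\<integral>\<^sup>+y. F (x, y) \<partial>distr M T Y) \<partial>distr M S X)"
    by (rule Y.nn_integral_fst[symmetric, OF F'])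
  also have "\<dots> = (\<integral>\<^sup>+\<omega>. (\<integral>\<^sup>+y. F (X \<omega>, y) \<partial>distr M T Y) \<partial>M)"
    by (rule nn_integral_distr) measurable
  also have "\<dots> = (\<integral>\<^sup>+\<omega>. (\<integral>\<^sup>+\<omega>'. F (X \<omega>, Y \<omega>') \<partial>M) \<partial>M)"
  proof (rule nn_integral_cong)
    fix \<omega> assume "\<omega> \<in> space M"
    then have "X \<omega> \<in> space S" using measurable_space[OF X] by blast
    then show "(\<integral>\<^sup>+y. F (X \<omega>, y) \<partial>distr M T Y) = (\<integral>\<^sup>+\<omega>'. F (X \<omega>, Y \<omega>') \<partial>M)"
      by (intro nn_integral_distr) measurable
  qed
  finally show ?thesis .
qed

context bm01
begin

text \<open>The path is cut at \<open>w = u + t\<close>. Integrating out the maximum of the second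
  piece gives the killed kernel \<open>g\<close>, shifting its increment introduces the total
  increment \<open>x\<close>, and the remaining integral over the position at \<open>w\<close> is
  \<open>nn_integral_max_density_g\<close>.\<close>

lemma emeasure_incr_argmax_max:
  assumes uv: "0 \<le> u" "u < v" "v \<le> 1" and t: "0 < t" "t < v - u"
    and [measurable]: "A \<in> sets borel" "C \<in> sets borel"
  shows "emeasure M {\<omega> \<in> space M. B v \<omega> - B u \<omega> \<in> A \<and> seg_argmax u v \<omega> - u \<le> t \<and> seg_max u v \<omega> \<in> C}
    = (\<integral>\<^sup>+x. (\<integral>\<^sup>+h. indicator A x * indicator C h *
        ennreal (if 0 < h \<and> x < h then arg_cdf (v - u) x t h else 0) \<partial>lborel) \<partial>lborel)"
proof -
  define T where "T = v - u"
  define w where "w = u + t"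
  have w: "0 \<le> u" "u < w" "w < v" "v \<le> 1" "w - u = t" "v - w = T - t"
    using uv t by (auto simp: w_def T_def)
  define P where "P \<omega> = (B w \<omega> - B u \<omega>, seg_max u w \<omega>)" for \<omega>
  define Q where "Q \<omega> = (B v \<omega> - B w \<omega>, seg_max w v \<omega>)" for \<omega>
  \<comment> \<open>The last factor says that the second piece does not rise above the maximum of
    the first. On that event the overall maximum is the one of the first piece, so \<open>C\<close>
    tests that component alone.\<close>
  define F :: "(real \<times> real) \<times> (real \<times> real) \<Rightarrow> ennreal" where
    "F p = indicator A (fst (fst p) + fst (snd p)) * indicator C (snd (fst p)) *
      (if snd (snd p) \<le> snd (fst p) - fst (fst p) then 1 else 0)" for p
  have F [measurable]: "F \<in> borel_measurable ((borel \<Otimes>\<^sub>M borel) \<Otimes>\<^sub>M (borel \<Otimes>\<^sub>M borel))"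
    unfolding F_def[abs_def] by measurable
  have sec: "(\<lambda>q. F (p, q)) \<in> borel_measurable (borel \<Otimes>\<^sub>M borel)" for p
    by (rule measurable_compose[OF measurable_Pair1' F]) (simp add: space_pair_measure)
  have outer: "(\<lambda>p. \<integral>\<^sup>+y'. (\<integral>\<^sup>+h'. ennreal (max_density (T - t) y' h') * F (p, y', h') \<partial>lborel) \<partial>lborel)
      \<in> borel_measurable (borel \<Otimes>\<^sub>M borel)"
    by measurable
  have P: "P \<in> measurable (seg u w) (borel \<Otimes>\<^sub>M borel)" and Q: "Q \<in> measurable (seg w v) (borel \<Otimes>\<^sub>M borel)"
    unfolding P_def Q_def using w
    by (intro measurable_Pair measurable_seg_incr measurable_seg_max; simp)+
  have ind: "indep_var (borel \<Otimes>\<^sub>M borel) P (borel \<Otimes>\<^sub>M borel) Q"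
    using w by (intro indep_var_seg[OF _ _ _ _ P Q]) simp_all
  define K where "K x h y = indicator A x * indicator C h *
      (ennreal (max_density t y h) * ennreal (if 0 < h - y \<and> x < h then g (T - t) (h - y) (h - x) else 0))" for x h y
  have K [measurable]: "(\<lambda>p. K (f p) (f' p) (f'' p)) \<in> borel_measurable N"
    if [measurable]: "f \<in> borel_measurable N" "f' \<in> borel_measurable N" "f'' \<in> borel_measurable N"
    for f f' f'' and N :: "'b measure"
    unfolding K_def by measurable
  have [measurable]: "seg_max u v \<in> borel_measurable M" "seg_argmax u v \<in> borel_measurable M"
    "(\<lambda>\<omega>. B v \<omega> - B u \<omega>) \<in> borel_measurable M"
    using uv by (simp_all add: measurable_seg_max_M measurable_seg_argmax_M measurable_incr)
  have "emeasure M {\<omega> \<in> space M. B v \<omega> - B u \<omega> \<in> A \<and> seg_argmax u v \<omega> - u \<le> t \<and> seg_max u v \<omega> \<in> C}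
    = (\<integral>\<^sup>+\<omega>. indicator {\<omega> \<in> space M. B v \<omega> - B u \<omega> \<in> A \<and> seg_argmax u v \<omega> - u \<le> t \<and> seg_max u v \<omega> \<in> C} \<omega> \<partial>M)"
    by (rule nn_integral_indicator[symmetric]) measurable
  also have "\<dots> = (\<integral>\<^sup>+\<omega>. F (P \<omega>, Q \<omega>) \<partial>M)"
  proof (rule nn_integral_cong)
    fix \<omega> assume \<omega>: "\<omega> \<in> space M"
    have "seg_argmax u v \<omega> - u \<le> t \<longleftrightarrow> seg_argmax u v \<omega> \<le> w"
      by (auto simp: w_def)
    also have "\<dots> \<longleftrightarrow> B w \<omega> - B u \<omega> + seg_max w v \<omega> \<le> seg_max u w \<omega>"
      using w \<omega> by (intro seg_argmax_le_iff) simp_all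
    finally have 1: "seg_argmax u v \<omega> - u \<le> t \<longleftrightarrow> B w \<omega> - B u \<omega> + seg_max w v \<omega> \<le> seg_max u w \<omega>" .
    have 2: "seg_max u v \<omega> = max (seg_max u w \<omega>) (B w \<omega> - B u \<omega> + seg_max w v \<omega>)"
      using w \<omega> by (intro seg_max_split) simp_all
    show "indicator {\<omega> \<in> space M. B v \<omega> - B u \<omega> \<in> A \<and> seg_argmax u v \<omega> - u \<le> t \<and> seg_max u v \<omega> \<in> C} \<omega>
        = F (P \<omega>, Q \<omega>)"
    proof (cases "B w \<omega> - B u \<omega> + seg_max w v \<omega> \<le> seg_max u w \<omega>")
      case True
      then have "seg_max u v \<omega> = seg_max u w \<omega>" using 2 by simp
      then show ?thesis
        using True 1 \<omega> by (auto simp add: F_def P_def Q_def indicator_def algebra_simps)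
    next
      case False
      then show ?thesis
        using 1 by (simp add: F_def P_def Q_def indicator_def algebra_simps)
    qed
  qed
  also have "\<dots> = (\<integral>\<^sup>+\<omega>. (\<integral>\<^sup>+\<omega>'. F (P \<omega>, Q \<omega>') \<partial>M) \<partial>M)"
    by (rule nn_integral_indep_var[OF ind F])
  also have "\<dots> = (\<integral>\<^sup>+\<omega>. (\<lambda>p. \<integral>\<^sup>+y'. (\<integral>\<^sup>+h'. ennreal (max_density (T - t) y' h') * F (p, y', h') \<partial>lborel) \<partial>lborel) (P \<omega>) \<partial>M)"
    unfolding Q_def w(6)[symmetric] using w
    by (intro nn_integral_cong nn_integral_incr_max sec) simp_all
  also have "\<dots> = (\<integral>\<^sup>+y. (\<integral>\<^sup>+h. ennreal (max_density t y h) *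
      (\<integral>\<^sup>+y'. (\<integral>\<^sup>+h'. ennreal (max_density (T - t) y' h') * F ((y, h), y', h') \<partial>lborel) \<partial>lborel) \<partial>lborel) \<partial>lborel)"
    unfolding P_def w(5)[symmetric] using w
    by (intro nn_integral_incr_max outer[unfolded w(5)[symmetric]]) simp_all
  also have "\<dots> = (\<integral>\<^sup>+y. (\<integral>\<^sup>+h. (\<integral>\<^sup>+x. K x h y \<partial>lborel) \<partial>lborel) \<partial>lborel)"
  proof (intro nn_integral_cong)
    fix y h :: real
    have "(\<integral>\<^sup>+h'. ennreal (max_density (T - t) y' h') * F ((y, h), y', h') \<partial>lborel)
      = indicator A (y + y') * indicator C h *
        ennreal (if 0 < h - y \<and> y' < h - y then g (T - t) (h - y) (h - y - y') else 0)" for y'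
    proof -
      have "(\<integral>\<^sup>+h'. ennreal (max_density (T - t) y' h') * F ((y, h), y', h') \<partial>lborel)
        = (\<integral>\<^sup>+h'. indicator A (y + y') * indicator C h *
            (ennreal (max_density (T - t) y' h') * indicator {..h - y} h') \<partial>lborel)"
        by (intro nn_integral_cong) (simp add: F_def split: split_indicator)
      also have "\<dots> = indicator A (y + y') * indicator C h *
            (\<integral>\<^sup>+h'. ennreal (max_density (T - t) y' h') * indicator {..h - y} h' \<partial>lborel)"
        by (rule nn_integral_cmult) measurable
      finally show ?thesis
        using t by (simp only: nn_integral_max_density_max T_def diff_gt_0_iff_gt)
    qed
    then have "ennreal (max_density t y h) *
        (\<integral>\<^sup>+y'. (\<integral>\<^sup>+h'. ennreal (max_density (T - t) y' h') * F ((y, h), y', h') \<partial>lborel) \<partial>lborel)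
      = (\<integral>\<^sup>+y'. ennreal (max_density t y h) * (indicator A (y + y') * indicator C h *
        ennreal (if 0 < h - y \<and> y' < h - y then g (T - t) (h - y) (h - y - y') else 0)) \<partial>lborel)"
      by (simp only:) (rule nn_integral_cmult[symmetric], measurable)
    also have "\<dots> = (\<integral>\<^sup>+y'. K (y + y') h y \<partial>lborel)"
    proof (rule nn_integral_cong)
      fix y'
      have "h - y - y' = h - (y + y')" "y' < h - y \<longleftrightarrow> y + y' < h" by linarith+
      then show "ennreal (max_density t y h) * (indicator A (y + y') * indicator C h *
        ennreal (if 0 < h - y \<and> y' < h - y then g (T - t) (h - y) (h - y - y') else 0)) = K (y + y') h y"
        unfolding K_def by (simp only: ac_simps)
    qed
    also have "\<dots> = (\<integral>\<^sup>+x. K x h y \<partial>lborel)"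
      by (rule nn_integral_lborel_shift) measurable
    finally show "ennreal (max_density t y h) *
        (\<integral>\<^sup>+y'. (\<integral>\<^sup>+h'. ennreal (max_density (T - t) y' h') * F ((y, h), y', h') \<partial>lborel) \<partial>lborel)
      = (\<integral>\<^sup>+x. K x h y \<partial>lborel)" .
  qed
  also have "\<dots> = (\<integral>\<^sup>+y. (\<integral>\<^sup>+x. (\<integral>\<^sup>+h. K x h y \<partial>lborel) \<partial>lborel) \<partial>lborel)"
    by (intro nn_integral_cong nn_integral_lborel_swap) measurable
  also have "\<dots> = (\<integral>\<^sup>+x. (\<integral>\<^sup>+y. (\<integral>\<^sup>+h. K x h y \<partial>lborel) \<partial>lborel) \<partial>lborel)"
    by (intro nn_integral_lborel_swap) measurable
  also have "\<dots> = (\<integral>\<^sup>+x. (\<integral>\<^sup>+h. (\<integral>\<^sup>+y. K x h y \<partial>lborel) \<partial>lborel) \<partial>lborel)"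
    by (intro nn_integral_cong nn_integral_lborel_swap) measurable
  also have "\<dots> = (\<integral>\<^sup>+x. (\<integral>\<^sup>+h. indicator A x * indicator C h *
        ennreal (if 0 < h \<and> x < h then arg_cdf T x t h else 0) \<partial>lborel) \<partial>lborel)"
  proof (intro nn_integral_cong)
    fix x h :: real
    have "(\<integral>\<^sup>+y. K x h y \<partial>lborel) = indicator A x * indicator C h *
      (\<integral>\<^sup>+y. ennreal (max_density t y h) * ennreal (if 0 < h - y \<and> x < h then g (T - t) (h - y) (h - x) else 0) \<partial>lborel)"
      unfolding K_def by (rule nn_integral_cmult) measurable
    also have "(\<integral>\<^sup>+y. ennreal (max_density t y h) * ennreal (if 0 < h - y \<and> x < h then g (T - t) (h - y) (h - x) else 0) \<partial>lborel)
      = ennreal (if 0 < h \<and> x < h then arg_cdf T x t h else 0)"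
    proof (cases "0 < h \<and> x < h")
      case True
      have "(\<integral>\<^sup>+y. ennreal (max_density t y h) * ennreal (if 0 < h - y \<and> x < h then g (T - t) (h - y) (h - x) else 0) \<partial>lborel)
        = (\<integral>\<^sup>+y. ennreal (max_density t y h) * ennreal (g (T - t) (h - y) (h - x)) \<partial>lborel)"
        using True by (intro nn_integral_cong) (simp add: max_density_def)
      then show ?thesis
        using True nn_integral_max_density_g[of t T h x] t by (simp add: T_def)
    next
      case False
      have "ennreal (max_density t y h) * ennreal (if 0 < h - y \<and> x < h then g (T - t) (h - y) (h - x) else 0) = 0" for y
        using False by (cases "x < h") (simp_all add: max_density_def)
      then show ?thesis using False by (simp only: if_False) simp
    qed
    finally show "(\<integral>\<^sup>+y. K x h y \<partial>lborel) = indicator A x * indicator C h *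
        ennreal (if 0 < h \<and> x < h then arg_cdf T x t h else 0)" .
  qed
  finally show ?thesis unfolding T_def .
qed

text \<open>A maximum at the right end would equal the increment, and \<open>max_density\<close>
  vanishes where the maximum does not exceed the increment.\<close>

lemma AE_seg_argmax_less:
  assumes "0 \<le> u" "u < v" "v \<le> 1"
  shows "AE \<omega> in M. seg_argmax u v \<omega> < v"
proof -
  define F :: "real \<times> real \<Rightarrow> ennreal" where "F p = (if snd p \<le> fst p then 1 else 0)" for p
  have [measurable]: "F \<in> borel_measurable (borel \<Otimes>\<^sub>M borel)"
    unfolding F_def[abs_def] by measurable
  have [measurable]: "seg_max u v \<in> borel_measurable M" "(\<lambda>\<omega>. B v \<omega> - B u \<omega>) \<in> borel_measurable M"
    using assms by (simp_all add: measurable_seg_max_M measurable_incr)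
  have "(\<integral>\<^sup>+\<omega>. F (B v \<omega> - B u \<omega>, seg_max u v \<omega>) \<partial>M)
    = (\<integral>\<^sup>+x. (\<integral>\<^sup>+m. ennreal (max_density (v - u) x m) * F (x, m) \<partial>lborel) \<partial>lborel)"
    by (rule nn_integral_incr_max[OF assms]) measurable
  also have "\<dots> = (\<integral>\<^sup>+x. (\<integral>\<^sup>+m. 0 \<partial>(lborel :: real measure)) \<partial>(lborel :: real measure))"
  proof (intro nn_integral_cong)
    fix x m show "ennreal (max_density (v - u) x m) * F (x, m) = 0"
      by (simp add: F_def max_density_def)
  qed
  finally have "AE \<omega> in M. F (B v \<omega> - B u \<omega>, seg_max u v \<omega>) = 0"
    by (subst nn_integral_0_iff_AE[symmetric]) simp_all
  with AE_space show ?thesis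
  proof eventually_elim
    fix \<omega> assume "\<omega> \<in> space M" and F: "F (B v \<omega> - B u \<omega>, seg_max u v \<omega>) = 0"
    then have \<omega>: "\<omega> \<in> space M" "0 \<le> u" "u \<le> v" "v \<le> 1" using assms by simp_all
    have "seg_argmax u v \<omega> \<noteq> v"
      using F seg_argmax(2)[OF \<omega>] by (auto simp: F_def split: if_splits)
    then show "seg_argmax u v \<omega> < v"
      using seg_argmax(1)[OF \<omega>] by simp
  qed
qed

text \<open>For \<open>t\<close> strictly between 0 and \<open>T\<close> both measures give the
  integral of \<open>arg_cdf\<close>, once by the law of the path and once because
  \<open>arg_cdf\<close> is the time integral of \<open>triple_density\<close>. The other
  \<open>t\<close> are boundary cases: a location at the start is null, and values
  \<open>t \<ge> T\<close> are reached by a limit from below.\<close>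

lemma distributed_incr_argmax_max:
  assumes uv: "0 \<le> u" "u < v" "v \<le> 1"
  shows "distributed M (lborel \<Otimes>\<^sub>M lborel \<Otimes>\<^sub>M lborel)
    (\<lambda>\<omega>. (B v \<omega> - B u \<omega>, seg_argmax u v \<omega> - u, seg_max u v \<omega>))
    (\<lambda>(x, t, h). ennreal (triple_density (v - u) x t h))"
proof -
  define T where "T = v - u"
  define Z where "Z \<omega> = (B v \<omega> - B u \<omega>, seg_argmax u v \<omega> - u, seg_max u v \<omega>)" for \<omega>
  have T: "0 < T" using uv by (simp add: T_def)
  have [measurable]: "seg_max u v \<in> borel_measurable M" "seg_argmax u v \<in> borel_measurable M"
    "(\<lambda>\<omega>. B v \<omega> - B u \<omega>) \<in> borel_measurable M"
    using uv by (simp_all add: measurable_seg_max_M measurable_seg_argmax_M measurable_incr)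
  have Z [measurable]: "Z \<in> measurable M (lborel \<Otimes>\<^sub>M lborel \<Otimes>\<^sub>M lborel)"
    unfolding Z_def by measurable
  define f where "f = (\<lambda>(x, t, h). ennreal (triple_density T x t h))"
  have f [measurable]: "f \<in> borel_measurable (lborel \<Otimes>\<^sub>M lborel \<Otimes>\<^sub>M lborel)"
    unfolding f_def by measurable
  define \<mu> where "\<mu> = distr M (lborel \<Otimes>\<^sub>M lborel \<Otimes>\<^sub>M lborel) Z"
  define \<nu> where "\<nu> = density (lborel \<Otimes>\<^sub>M lborel \<Otimes>\<^sub>M lborel) f"
  have sets_\<mu>: "sets \<mu> = sets (lborel \<Otimes>\<^sub>M lborel \<Otimes>\<^sub>M lborel)" and sets_\<nu>: "sets \<nu> = sets (lborel \<Otimes>\<^sub>M lborel \<Otimes>\<^sub>M lborel)"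
    by (simp_all add: \<mu>_def \<nu>_def)
  have \<mu>: "emeasure \<mu> (A \<times> I \<times> C)
      = emeasure M {\<omega> \<in> space M. B v \<omega> - B u \<omega> \<in> A \<and> seg_argmax u v \<omega> - u \<in> I \<and> seg_max u v \<omega> \<in> C}"
    if [measurable]: "A \<in> sets borel" "I \<in> sets borel" "C \<in> sets borel" for A I C
    unfolding \<mu>_def by (subst emeasure_distr) (auto simp: Z_def intro!: arg_cong[where f = "emeasure M"])
  have \<nu>: "emeasure \<nu> (A \<times> I \<times> C)
      = (\<integral>\<^sup>+x. (\<integral>\<^sup>+h. indicator A x * indicator C h *
          (\<integral>\<^sup>+t. ennreal (triple_density T x t h) * indicator I t \<partial>lborel) \<partial>lborel) \<partial>lborel)"
    if [measurable]: "A \<in> sets borel" "I \<in> sets borel" "C \<in> sets borel" for A I C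
  proof -
    have "emeasure \<nu> (A \<times> I \<times> C) = (\<integral>\<^sup>+p. f p * indicator (A \<times> I \<times> C) p \<partial>(lborel \<Otimes>\<^sub>M lborel \<Otimes>\<^sub>M lborel))"
      unfolding \<nu>_def by (rule emeasure_density) measurable
    also have "\<dots> = (\<integral>\<^sup>+x. (\<integral>\<^sup>+t. (\<integral>\<^sup>+h. f (x, t, h) * indicator (A \<times> I \<times> C) (x, t, h) \<partial>lborel) \<partial>lborel) \<partial>lborel)"
      by (rule nn_integral_lborel_triple) (unfold f_def, measurable)
    also have "\<dots> = (\<integral>\<^sup>+x. (\<integral>\<^sup>+t. (\<integral>\<^sup>+h. indicator A x * indicator C h *
          (ennreal (triple_density T x t h) * indicator I t) \<partial>lborel) \<partial>lborel) \<partial>lborel)"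
      by (intro nn_integral_cong) (simp add: f_def split: split_indicator)
    also have "\<dots> = (\<integral>\<^sup>+x. (\<integral>\<^sup>+h. (\<integral>\<^sup>+t. indicator A x * indicator C h *
          (ennreal (triple_density T x t h) * indicator I t) \<partial>lborel) \<partial>lborel) \<partial>lborel)"
      by (intro nn_integral_cong nn_integral_lborel_swap) measurable
    also have "\<dots> = (\<integral>\<^sup>+x. (\<integral>\<^sup>+h. indicator A x * indicator C h *
          (\<integral>\<^sup>+t. ennreal (triple_density T x t h) * indicator I t \<partial>lborel) \<partial>lborel) \<partial>lborel)"
      by (intro nn_integral_cong nn_integral_cmult) measurable
    finally show ?thesis .
  qed
  have inner: "emeasure \<mu> (A \<times> {..t} \<times> C) = emeasure \<nu> (A \<times> {..t} \<times> C)"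
    if t: "0 < t" "t < T" and [measurable]: "A \<in> sets borel" "C \<in> sets borel" for t A C
  proof -
    have "emeasure \<mu> (A \<times> {..t} \<times> C) = (\<integral>\<^sup>+x. (\<integral>\<^sup>+h. indicator A x * indicator C h *
        ennreal (if 0 < h \<and> x < h then arg_cdf T x t h else 0) \<partial>lborel) \<partial>lborel)"
      using emeasure_incr_argmax_max[OF uv, of t A C, folded T_def] t by (simp add: \<mu>)
    also have "\<dots> = emeasure \<nu> (A \<times> {..t} \<times> C)"
      unfolding \<nu>[OF that(3) atMost_borel that(4)]
    proof (intro nn_integral_cong arg_cong2[where f = "(*)"] refl)
      fix x h :: real
      show "ennreal (if 0 < h \<and> x < h then arg_cdf T x t h else 0)
        = (\<integral>\<^sup>+t'. ennreal (triple_density T x t' h) * indicator {..t} t' \<partial>lborel)"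
      proof (cases "0 < h \<and> x < h")
        case True
        then show ?thesis using nn_integral_triple_density_time[OF t] by simp
      next
        case False
        then have "triple_density T x t' h = 0" for t' by (auto simp: triple_density_def)
        then show ?thesis by (simp only: if_not_P[OF False]) simp
      qed
    qed
    finally show ?thesis .
  qed
  have "\<mu> = \<nu>"
  proof (rule measure_eqI_pair[where A = lborel and B = "lborel \<Otimes>\<^sub>M lborel" and Ea = "sets borel"
        and Eb = "{{..t} \<times> C | t C. C \<in> sets borel}" and a = "\<lambda>_. UNIV" and b = "\<lambda>n. {..real n} \<times> UNIV"])
    show "finite_measure \<mu>"
      unfolding \<mu>_def by (intro prob_space.finite_measure prob_space_distr Z)
    have "sets (lborel \<Otimes>\<^sub>M lborel :: (real \<times> real) measure) = sets (borel \<Otimes>\<^sub>M borel)"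
      by (rule sets_pair_measure_cong) simp_all
    then show "sets (lborel \<Otimes>\<^sub>M lborel :: (real \<times> real) measure)
        = sigma_sets (space (lborel \<Otimes>\<^sub>M lborel)) {{..t} \<times> C | t C. C \<in> sets borel}"
      unfolding sets_borel_pair_atMost by (simp add: space_pair_measure)
    show "sets lborel = sigma_sets (space lborel) (sets (borel :: real measure))"
      using sets.sigma_sets_eq[of "borel :: real measure"] by simp
    show "Int_stable (sets (borel :: real measure))"
      by (rule sets.Int_stable)
    show "{..real n} \<times> UNIV \<in> {{..t} \<times> C | t C. C \<in> sets borel}" for n
      by (auto intro!: exI[of _ "real n"] exI[of _ UNIV])
    show "(\<Union>n. {..real n} \<times> UNIV) = space (lborel \<Otimes>\<^sub>M lborel :: (real \<times> real) measure)"
    proof -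
      have "(\<Union>n. {..real n} \<times> (UNIV :: real set)) = (\<Union>n. {..real n}) \<times> UNIV"
        by blast
      then show ?thesis by (simp add: space_pair_measure Union_atMost_real)
    qed
    fix A P assume A [measurable]: "A \<in> sets (borel :: real measure)" and "P \<in> {{..t::real} \<times> C | t C. C \<in> sets (borel :: real measure)}"
    then obtain t C where P: "P = {..t} \<times> C" and C [measurable]: "C \<in> sets borel" by blast
    consider "t \<le> 0" | "0 < t" "t < T" | "T \<le> t" by linarith
    then have "emeasure \<mu> (A \<times> {..t} \<times> C) = emeasure \<nu> (A \<times> {..t} \<times> C)"
    proof cases
      case 1
      \<comment> \<open>A maximum located at \<open>u\<close> has relative height 0, an event of
        probability 0 by \<open>emeasure_seg_max_le\<close>.\<close>
      have "emeasure \<mu> (A \<times> {..t} \<times> C) \<le> emeasure M {\<omega> \<in> space M. seg_max u v \<omega> \<le> 0}"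
        unfolding \<mu>[OF A atMost_borel C]
      proof (rule emeasure_mono)
        show "{\<omega> \<in> space M. B v \<omega> - B u \<omega> \<in> A \<and> seg_argmax u v \<omega> - u \<in> {..t} \<and> seg_max u v \<omega> \<in> C}
            \<subseteq> {\<omega> \<in> space M. seg_max u v \<omega> \<le> 0}"
        proof (rule subsetI)
          fix \<omega> assume "\<omega> \<in> {\<omega> \<in> space M. B v \<omega> - B u \<omega> \<in> A \<and> seg_argmax u v \<omega> - u \<in> {..t} \<and> seg_max u v \<omega> \<in> C}"
          then have \<omega>: "\<omega> \<in> space M" "0 \<le> u" "u \<le> v" "v \<le> 1" and le: "seg_argmax u v \<omega> - u \<in> {..t}"
            using uv by simp_all
          have "seg_argmax u v \<omega> = u"
            using seg_argmax(1)[OF \<omega>] le 1 by simp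
          then show "\<omega> \<in> {\<omega> \<in> space M. seg_max u v \<omega> \<le> 0}" using seg_argmax(2)[OF \<omega>] \<omega>(1) by simp
        qed
      qed measurable
      also have "\<dots> = 0"
        by (simp add: emeasure_seg_max_le[OF uv])
      finally have "emeasure \<mu> (A \<times> {..t} \<times> C) = 0" by simp
      moreover have "emeasure \<nu> (A \<times> {..t} \<times> C) = 0"
      proof -
        have z: "ennreal (triple_density T x t' h) * indicator {..t} t' = 0" for x t' h
          using 1 by (simp add: triple_density_def split: split_indicator)
        show ?thesis unfolding \<nu>[OF A atMost_borel C] z by simp
      qed
      ultimately show ?thesis by simp
    next
      case 2
      then show ?thesis using inner A C by simp
    next
      case 3
      \<comment> \<open>The summand 2 keeps \<open>s 0\<close> positive, as \<open>inner\<close>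
        demands; with 1 it would be 0.\<close>
      define s where "s n = T - T / (real n + 2)" for n
      have s: "0 < s n" "s n < T" for n
        using T by (auto simp: s_def field_simps intro: add_pos_nonneg)
      have s_mono: "s m \<le> s n" if "m \<le> n" for m n
        using that T by (auto simp: s_def intro!: divide_left_mono)
      have s_lim: "s \<longlonglongrightarrow> T"
        unfolding s_def by real_asymp
      have Un: "(\<Union>n. A \<times> {..s n} \<times> C) = A \<times> {..<T} \<times> C"
      proof -
        have "(\<Union>n. {..s n}) = {..<T}"
        proof (rule antisym)
          show "(\<Union>n. {..s n}) \<subseteq> {..<T}" using s(2) le_less_trans by fastforce
          show "{..<T} \<subseteq> (\<Union>n. {..s n})"
          proof
            fix r assume "r \<in> {..<T}"
            then have "\<forall>\<^sub>F n in sequentially. r < s n"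
              using s_lim by (intro order_tendstoD) simp_all
            then obtain n where "r < s n"
              by (auto simp: eventually_sequentially)
            then show "r \<in> (\<Union>n. {..s n})" by (auto intro!: exI[of _ n])
          qed
        qed
        then show ?thesis by blast
      qed
      have inc: "incseq (\<lambda>n. A \<times> {..s n} \<times> C)"
        using s_mono by (fastforce simp: incseq_def)
      have m: "range (\<lambda>n. A \<times> {..s n} \<times> C) \<subseteq> sets (lborel \<Otimes>\<^sub>M lborel \<Otimes>\<^sub>M lborel)"
        by (intro image_subsetI pair_measureI) simp_all
      have "(\<lambda>n. emeasure \<mu> (A \<times> {..s n} \<times> C)) \<longlonglongrightarrow> emeasure \<mu> (A \<times> {..<T} \<times> C)"
        using Lim_emeasure_incseq[OF m[folded sets_\<mu>] inc] unfolding Un .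
      moreover have "(\<lambda>n. emeasure \<nu> (A \<times> {..s n} \<times> C)) \<longlonglongrightarrow> emeasure \<nu> (A \<times> {..<T} \<times> C)"
        using Lim_emeasure_incseq[OF m[folded sets_\<nu>] inc] unfolding Un .
      moreover have "emeasure \<mu> (A \<times> {..s n} \<times> C) = emeasure \<nu> (A \<times> {..s n} \<times> C)" for n
        by (rule inner[OF s A C])
      ultimately have eq: "emeasure \<mu> (A \<times> {..<T} \<times> C) = emeasure \<nu> (A \<times> {..<T} \<times> C)"
        by (simp add: LIMSEQ_unique)
      have "emeasure \<mu> (A \<times> {..t} \<times> C) = emeasure \<mu> (A \<times> {..<T} \<times> C)"
        unfolding \<mu>[OF A atMost_borel C] \<mu>[OF A lessThan_borel C]
      proof (rule emeasure_eq_AE)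
        show "AE \<omega> in M. \<omega> \<in> {\<omega> \<in> space M. B v \<omega> - B u \<omega> \<in> A \<and> seg_argmax u v \<omega> - u \<in> {..t} \<and> seg_max u v \<omega> \<in> C} \<longleftrightarrow>
            \<omega> \<in> {\<omega> \<in> space M. B v \<omega> - B u \<omega> \<in> A \<and> seg_argmax u v \<omega> - u \<in> {..<T} \<and> seg_max u v \<omega> \<in> C}"
          using AE_seg_argmax_less[OF uv]
        proof eventually_elim
          fix \<omega> assume "seg_argmax u v \<omega> < v"
          then have "seg_argmax u v \<omega> - u < T" "seg_argmax u v \<omega> - u \<le> t"
            using 3 by (simp_all add: T_def)
          then show "\<omega> \<in> {\<omega> \<in> space M. B v \<omega> - B u \<omega> \<in> A \<and> seg_argmax u v \<omega> - u \<in> {..t} \<and> seg_max u v \<omega> \<in> C} \<longleftrightarrow>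
            \<omega> \<in> {\<omega> \<in> space M. B v \<omega> - B u \<omega> \<in> A \<and> seg_argmax u v \<omega> - u \<in> {..<T} \<and> seg_max u v \<omega> \<in> C}"
            by simp
        qed
      qed measurable
      moreover have "emeasure \<nu> (A \<times> {..t} \<times> C) = emeasure \<nu> (A \<times> {..<T} \<times> C)"
      proof -
        have z: "ennreal (triple_density T x t' h) * indicator {..t} t' = ennreal (triple_density T x t' h) * indicator {..<T} t'" for x t' h
          using 3 by (simp add: triple_density_def split: split_indicator)
        show ?thesis unfolding \<nu>[OF A atMost_borel C] \<nu>[OF A lessThan_borel C] z ..
      qed
      ultimately show ?thesis using eq by simp
    qed
    then show "emeasure \<mu> (A \<times> P) = emeasure \<nu> (A \<times> P)" unfolding P .
  qed (auto simp: sets_\<mu> sets_\<nu> Int_stable_atMost_times incseq_def space_pair_measure)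
  then show ?thesis
    using Z f unfolding distributed_def \<mu>_def \<nu>_def Z_def f_def T_def by blast
qed

lemma nn_integral_incr_argmax_max:
  assumes uv: "0 \<le> u" "u < v" "v \<le> 1" and F [measurable]: "F \<in> borel_measurable (borel \<Otimes>\<^sub>M borel \<Otimes>\<^sub>M borel)"
  shows "(\<integral>\<^sup>+\<omega>. F (B v \<omega> - B u \<omega>, seg_argmax u v \<omega> - u, seg_max u v \<omega>) \<partial>M)
    = (\<integral>\<^sup>+x. (\<integral>\<^sup>+t. (\<integral>\<^sup>+h. ennreal (triple_density (v - u) x t h) * F (x, t, h) \<partial>lborel) \<partial>lborel) \<partial>lborel)"
proof -
  have "(\<integral>\<^sup>+\<omega>. F (B v \<omega> - B u \<omega>, seg_argmax u v \<omega> - u, seg_max u v \<omega>) \<partial>M)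
    = (\<integral>\<^sup>+p. (\<lambda>(x, t, h). ennreal (triple_density (v - u) x t h)) p * F p \<partial>(lborel \<Otimes>\<^sub>M lborel \<Otimes>\<^sub>M lborel))"
    by (rule distributed_nn_integral[symmetric, OF distributed_incr_argmax_max[OF uv]]) measurable
  also have "\<dots> = (\<integral>\<^sup>+x. (\<integral>\<^sup>+t. (\<integral>\<^sup>+h. (\<lambda>(x, t, h). ennreal (triple_density (v - u) x t h)) (x, t, h) * F (x, t, h) \<partial>lborel) \<partial>lborel) \<partial>lborel)"
    by (rule nn_integral_lborel_triple) measurable
  finally show ?thesis by simp
qed

lemma nn_integral_argmax_max:
  assumes uv: "0 \<le> u" "u < v" "v \<le> 1" and F [measurable]: "F \<in> borel_measurable (borel \<Otimes>\<^sub>M borel)"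
  shows "(\<integral>\<^sup>+\<omega>. F (seg_argmax u v \<omega> - u, seg_max u v \<omega>) \<partial>M)
    = (\<integral>\<^sup>+t. (\<integral>\<^sup>+h. ennreal (pair_density (v - u) t h) * F (t, h) \<partial>lborel) \<partial>lborel)"
proof -
  have "(\<integral>\<^sup>+\<omega>. F (seg_argmax u v \<omega> - u, seg_max u v \<omega>) \<partial>M)
    = (\<integral>\<^sup>+x. (\<integral>\<^sup>+t. (\<integral>\<^sup>+h. ennreal (triple_density (v - u) x t h) * F (t, h) \<partial>lborel) \<partial>lborel) \<partial>lborel)"
    using nn_integral_incr_argmax_max[OF uv, of "\<lambda>(x, p). F p"] by simp
  also have "\<dots> = (\<integral>\<^sup>+t. (\<integral>\<^sup>+x. (\<integral>\<^sup>+h. ennreal (triple_density (v - u) x t h) * F (t, h) \<partial>lborel) \<partial>lborel) \<partial>lborel)"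
    by (rule nn_integral_lborel_swap) measurable
  also have "\<dots> = (\<integral>\<^sup>+t. (\<integral>\<^sup>+h. (\<integral>\<^sup>+x. ennreal (triple_density (v - u) x t h) * F (t, h) \<partial>lborel) \<partial>lborel) \<partial>lborel)"
    by (intro nn_integral_cong nn_integral_lborel_swap) measurable
  also have "\<dots> = (\<integral>\<^sup>+t. (\<integral>\<^sup>+h. (\<integral>\<^sup>+x. ennreal (triple_density (v - u) x t h) \<partial>lborel) * F (t, h) \<partial>lborel) \<partial>lborel)"
    by (intro nn_integral_cong nn_integral_multc) measurable
  finally show ?thesis by (simp only: nn_integral_triple_density)
qed

end

section \<open>The joint density\<close>

lemma measurable_pair_density [measurable (raw)]:
  assumes [measurable]: "f \<in> borel_measurable M" "f' \<in> borel_measurable M"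
  shows "(\<lambda>w. pair_density T (f w) (f' w)) \<in> borel_measurable M"
  unfolding pair_density_def by measurable

lemma measurable_bm_density [measurable (raw)]:
  assumes [measurable]: "f \<in> borel_measurable M" "f' \<in> borel_measurable M" "f'' \<in> borel_measurable M"
  shows "(\<lambda>w. bm_density s (f w) (f' w) (f'' w)) \<in> borel_measurable M"
  unfolding bm_density_def density_before_def density_after_def by measurable

lemma bm_density_nonneg:
  assumes "0 < s" "s < 1"
  shows "0 \<le> bm_density s x \<theta> h"
proof -
  have "0 \<le> g s (h - x) h" if "0 < h" "x < h"
    using that assms by (intro g_nonneg) simp_all
  moreover have "0 \<le> erf ((h - x) / sqrt (2 * (1 - s)))" if "x < h"
    using that assms by (intro erf_nonneg) simp
  ultimately show ?thesis
    by (simp add: bm_density_def density_before_def density_after_def)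
qed

text \<open>The two summands live on disjoint ranges of \<open>\<theta>\<close>. For
  \<open>\<theta> < s\<close> the first piece carries the maximum and the second rises by at most
  \<open>h - x\<close>, with probability \<open>erf\<close>. For \<open>s < \<theta>\<close> the
  second piece attains its maximum after a delay \<open>\<theta> - s\<close>, at height
  \<open>h - x\<close> above \<open>x\<close>, while the first stays below \<open>h\<close>, with
  density \<open>g\<close>. At \<open>\<theta> = s\<close> both vanish, matching the default value
  of \<open>bm_density\<close>.\<close>

lemma ennreal_bm_density:
  assumes "0 < s" "s < 1"
  shows "ennreal (bm_density s x \<theta> h)
    = ennreal (triple_density s x \<theta> h) * ennreal (if 0 < h - x then erf ((h - x) / sqrt (2 * (1 - s))) else 0)
    + ennreal (pair_density (1 - s) (\<theta> - s) (h - x)) * ennreal (if 0 < h \<and> x < h then g s h (h - x) else 0)"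
proof -
  consider "\<not> (0 < \<theta> \<and> \<theta> < 1 \<and> 0 < h \<and> x < h)" | "0 < h" "x < h" "0 < \<theta>" "\<theta> < s"
    | "\<theta> = s" | "0 < h" "x < h" "s < \<theta>" "\<theta> < 1"
    by linarith
  then show ?thesis
  proof cases
    case 1
    then have "bm_density s x \<theta> h = 0" by (simp only: bm_density_def if_False)
    moreover have "triple_density s x \<theta> h = 0"
      using 1 assms by (auto simp: triple_density_def)
    moreover have "pair_density (1 - s) (\<theta> - s) (h - x) = 0 \<or> \<not> (0 < h \<and> x < h)"
      using 1 assms by (auto simp: pair_density_def)
    ultimately show ?thesis by auto
  next
    case 2
    have "bm_density s x \<theta> h = triple_density s x \<theta> h * erf ((h - x) / sqrt (2 * (1 - s)))"
      using 2 assms by (simp add: bm_density_def density_after_def triple_density_def)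
    then show ?thesis
      using 2 by (simp add: pair_density_def ennreal_mult' triple_density_nonneg)
  next
    case 3
    then show ?thesis by (simp add: bm_density_def triple_density_def pair_density_def)
  next
    case 4
    have "bm_density s x \<theta> h = pair_density (1 - s) (\<theta> - s) (h - x) * g s h (h - x)"
      using 4 assms g_commute[of s h "h - x"]
      by (simp add: bm_density_def density_before_def pair_density_def ac_simps)
    moreover have "0 \<le> pair_density (1 - s) (\<theta> - s) (h - x)"
      by (simp add: pair_density_def)
    ultimately show ?thesis
      using 4 by (simp add: triple_density_def ennreal_mult')
  qed
qed

context bm01
begin

text \<open>The path is cut at \<open>s\<close>. If the first piece carries the maximum, its triple
  law is combined with the maximum of the second piece alone; otherwise the pair law of the second
  piece is combined with increment and maximum of the first.\<close>

lemma distributed_triple: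
  assumes s: "0 < s" "s < 1"
  shows "distributed M (lborel \<Otimes>\<^sub>M lborel \<Otimes>\<^sub>M lborel)
    (\<lambda>\<omega>. (B s \<omega>, path_argmax B \<omega>, path_max B \<omega>)) (\<lambda>(x, \<theta>, h). ennreal (bm_density s x \<theta> h))"
proof -
  define Z where "Z \<omega> = (B s \<omega> - B 0 \<omega>, seg_argmax 0 1 \<omega> - 0, seg_max 0 1 \<omega>)" for \<omega>
  define Z1 where "Z1 \<omega> = (B s \<omega> - B 0 \<omega>, seg_argmax 0 s \<omega> - 0, seg_max 0 s \<omega>)" for \<omega>
  define Z2 where "Z2 \<omega> = (B s \<omega> - B 0 \<omega>, seg_max 0 s \<omega>)" for \<omega>
  define W where "W \<omega> = (seg_argmax s 1 \<omega> - s, seg_max s 1 \<omega>)" for \<omega>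
  define W1 :: "'a \<Rightarrow> real \<times> real \<times> real" where "W1 \<omega> = (0, 0, seg_max s 1 \<omega>)" for \<omega>
    \<comment> \<open>padded because \<open>indep_var\<close> wants both variables of the same type\<close>
  define f where "f = (\<lambda>(x, \<theta>, h). ennreal (bm_density s x \<theta> h))"
  have f [measurable]: "f \<in> borel_measurable (lborel \<Otimes>\<^sub>M lborel \<Otimes>\<^sub>M lborel)"
    unfolding f_def by measurable
  have B0: "B 0 \<omega> = 0" if "\<omega> \<in> space M" for \<omega>
    using brownian that by (simp add: brownian_motion_01_def)
  have Z_eq: "Z \<omega> = (B s \<omega>, path_argmax B \<omega>, path_max B \<omega>)" if "\<omega> \<in> space M" for \<omega>
    unfolding Z_def path_argmax_def path_max_def seg_argmax_def seg_max_def B0[OF that] by simp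
  have [measurable]: "(\<lambda>\<omega>. B s \<omega> - B 0 \<omega>) \<in> borel_measurable M" "seg_argmax 0 1 \<in> borel_measurable M"
    "seg_max 0 1 \<in> borel_measurable M" "seg_argmax 0 s \<in> borel_measurable M" "seg_max 0 s \<in> borel_measurable M"
    "seg_argmax s 1 \<in> borel_measurable M" "seg_max s 1 \<in> borel_measurable M"
    using s by (simp_all add: measurable_seg_max_M measurable_seg_argmax_M measurable_incr)
  have Z [measurable]: "Z \<in> measurable M (lborel \<Otimes>\<^sub>M lborel \<Otimes>\<^sub>M lborel)"
    unfolding Z_def by measurable
  have Z1: "Z1 \<in> measurable (seg 0 s) (borel \<Otimes>\<^sub>M borel \<Otimes>\<^sub>M borel)"
    unfolding Z1_def using s
    by (intro measurable_Pair measurable_seg_incr measurable_seg_max borel_measurable_diff measurable_seg_argmax) simp_all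
  have Z2: "Z2 \<in> measurable (seg 0 s) (borel \<Otimes>\<^sub>M borel)"
    unfolding Z2_def using s
    by (intro measurable_Pair measurable_seg_incr measurable_seg_max) simp_all
  have W: "W \<in> measurable (seg s 1) (borel \<Otimes>\<^sub>M borel)"
    unfolding W_def using s
    by (intro measurable_Pair borel_measurable_diff measurable_seg_max measurable_seg_argmax) simp_all
  have W1: "W1 \<in> measurable (seg s 1) (borel \<Otimes>\<^sub>M borel \<Otimes>\<^sub>M borel)"
    unfolding W1_def using s by (intro measurable_Pair measurable_const measurable_seg_max) simp_all
  have ind1: "indep_var (borel \<Otimes>\<^sub>M borel \<Otimes>\<^sub>M borel) Z1 (borel \<Otimes>\<^sub>M borel \<Otimes>\<^sub>M borel) W1"
    using s by (intro indep_var_seg[OF _ _ _ _ Z1 W1]) simp_all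
  have ind2: "indep_var (borel \<Otimes>\<^sub>M borel) Z2 (borel \<Otimes>\<^sub>M borel) W"
    using s by (intro indep_var_seg[OF _ _ _ _ Z2 W]) simp_all
  have "distr M (lborel \<Otimes>\<^sub>M lborel \<Otimes>\<^sub>M lborel) Z = density (lborel \<Otimes>\<^sub>M lborel \<Otimes>\<^sub>M lborel) f"
  proof (rule measure_eqI)
    fix S assume "S \<in> sets (distr M (lborel \<Otimes>\<^sub>M lborel \<Otimes>\<^sub>M lborel) Z)"
    then have S [measurable]: "S \<in> sets (lborel \<Otimes>\<^sub>M lborel \<Otimes>\<^sub>M lborel)"
      by simp
    have "sets (lborel \<Otimes>\<^sub>M lborel \<Otimes>\<^sub>M lborel) = sets (borel \<Otimes>\<^sub>M borel \<Otimes>\<^sub>M borel :: (real \<times> real \<times> real) measure)"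
      by (intro sets_pair_measure_cong) simp_all
    with S have [measurable]: "S \<in> sets (borel \<Otimes>\<^sub>M borel \<Otimes>\<^sub>M borel)" by simp
    \<comment> \<open>\<open>F1\<close> and \<open>F2\<close> restrict the indicator of
      \<open>S\<close> to the two cases. A tie belongs to \<open>F1\<close>, since the first
      location counts; the comparison in \<open>F2\<close> is strict, so the two add up to the
      indicator. In \<open>F2\<close> the relative location and height of the second piece are
      shifted by \<open>s\<close> and by the position at time \<open>s\<close>.\<close>
    define F1 :: "(real \<times> real \<times> real) \<times> (real \<times> real \<times> real) \<Rightarrow> ennreal" where
      "F1 p = indicator S (fst p) * (if snd (snd (snd p)) \<le> snd (snd (fst p)) - fst (fst p) then 1 else 0)" for p
    define F2 :: "(real \<times> real) \<times> (real \<times> real) \<Rightarrow> ennreal" where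
      "F2 p = indicator S (fst (fst p), s + fst (snd p), fst (fst p) + snd (snd p)) *
        (if snd (fst p) < fst (fst p) + snd (snd p) then 1 else 0)" for p
    have F1 [measurable]: "F1 \<in> borel_measurable ((borel \<Otimes>\<^sub>M borel \<Otimes>\<^sub>M borel) \<Otimes>\<^sub>M (borel \<Otimes>\<^sub>M borel \<Otimes>\<^sub>M borel))"
      unfolding F1_def[abs_def] by measurable
    have F2 [measurable]: "F2 \<in> borel_measurable ((borel \<Otimes>\<^sub>M borel) \<Otimes>\<^sub>M (borel \<Otimes>\<^sub>M borel))"
      unfolding F2_def[abs_def] by measurable
    have F2_sec: "(\<lambda>q. F2 (p, q)) \<in> borel_measurable (borel \<Otimes>\<^sub>M borel)" for p
      by (rule measurable_compose[OF measurable_Pair1' F2]) (simp add: space_pair_measure)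
    \<comment> \<open>What remains of the piece without the maximum: for \<open>H1\<close> the
      probability that the second piece rises by at most \<open>h - x\<close>, for \<open>H2\<close>
      the density of \<open>B s\<close> at \<open>x\<close> with the first piece staying below
      \<open>h\<close>.\<close>
    define H1 where "H1 x h = (if 0 < h - x then erf ((h - x) / sqrt (2 * (1 - s))) else 0)" for x h :: real
    define H2 where "H2 x h = (if 0 < h \<and> x < h then g s h (h - x) else 0)" for x h :: real
    have [measurable]: "(\<lambda>p. H1 (a p) (b p)) \<in> borel_measurable N" "(\<lambda>p. H2 (a p) (b p)) \<in> borel_measurable N"
      if [measurable]: "a \<in> borel_measurable N" "b \<in> borel_measurable N" for a b and N :: "'b measure"
      unfolding H1_def H2_def by measurable

    have "(\<integral>\<^sup>+\<omega>. F1 (Z1 \<omega>, W1 \<omega>) \<partial>M) = (\<integral>\<^sup>+\<omega>. (\<integral>\<^sup>+\<omega>'. F1 (Z1 \<omega>, W1 \<omega>') \<partial>M) \<partial>M)"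
      by (rule nn_integral_indep_var[OF ind1 F1])
    also have "\<dots> = (\<integral>\<^sup>+\<omega>. (\<lambda>(x, t, h). indicator S (x, t, h) * ennreal (H1 x h)) (Z1 \<omega>) \<partial>M)"
    proof (rule nn_integral_cong)
      fix \<omega>
      obtain x t h where z: "Z1 \<omega> = (x, t, h)" by (cases "Z1 \<omega>")
      have "(\<integral>\<^sup>+\<omega>'. F1 (Z1 \<omega>, W1 \<omega>') \<partial>M)
        = (\<integral>\<^sup>+\<omega>'. indicator S (x, t, h) * indicator {\<omega> \<in> space M. seg_max s 1 \<omega> \<le> h - x} \<omega>' \<partial>M)"
        by (intro nn_integral_cong) (simp add: z F1_def W1_def split: split_indicator)
      also have "\<dots> = indicator S (x, t, h) * emeasure M {\<omega> \<in> space M. seg_max s 1 \<omega> \<le> h - x}"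
        by (rule nn_integral_cmult_indicator) measurable
      finally show "(\<integral>\<^sup>+\<omega>'. F1 (Z1 \<omega>, W1 \<omega>') \<partial>M)
          = (\<lambda>(x, t, h). indicator S (x, t, h) * ennreal (H1 x h)) (Z1 \<omega>)"
        using s by (simp add: z emeasure_seg_max_le H1_def)
    qed
    also have "\<dots> = (\<integral>\<^sup>+x. (\<integral>\<^sup>+t. (\<integral>\<^sup>+h. ennreal (triple_density s x t h) *
        (indicator S (x, t, h) * ennreal (H1 x h)) \<partial>lborel) \<partial>lborel) \<partial>lborel)"
      unfolding Z1_def using s
      by (subst nn_integral_incr_argmax_max[where F = "\<lambda>(x, t, h). indicator S (x, t, h) * ennreal (H1 x h)"]) simp_all
    finally have 1: "(\<integral>\<^sup>+\<omega>. F1 (Z1 \<omega>, W1 \<omega>) \<partial>M) = \<dots>" .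

    have "(\<integral>\<^sup>+\<omega>. F2 (Z2 \<omega>, W \<omega>) \<partial>M) = (\<integral>\<^sup>+\<omega>. (\<integral>\<^sup>+\<omega>'. F2 (Z2 \<omega>, W \<omega>') \<partial>M) \<partial>M)"
      by (rule nn_integral_indep_var[OF ind2 F2])
    also have "\<dots> = (\<integral>\<^sup>+\<omega>. (\<lambda>p. \<integral>\<^sup>+t. (\<integral>\<^sup>+m. ennreal (pair_density (1 - s) t m) * F2 (p, t, m) \<partial>lborel) \<partial>lborel) (Z2 \<omega>) \<partial>M)"
      unfolding W_def using s by (intro nn_integral_cong nn_integral_argmax_max F2_sec) simp_all
    also have "\<dots> = (\<integral>\<^sup>+x. (\<integral>\<^sup>+m'. ennreal (max_density (s - 0) x m') *
        (\<integral>\<^sup>+t. (\<integral>\<^sup>+m. ennreal (pair_density (1 - s) t m) * F2 ((x, m'), t, m) \<partial>lborel) \<partial>lborel) \<partial>lborel) \<partial>lborel)"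
      unfolding Z2_def using s by (intro nn_integral_incr_max) (simp_all, measurable)
    \<comment> \<open>Translations in both inner variables turn the delay after \<open>s\<close>
      into an absolute time and the rise above \<open>x\<close> into an absolute height;
      \<open>m'\<close>, the maximum of the first piece, is then moved innermost and integrated
      out.\<close>
    also have "\<dots> = (\<integral>\<^sup>+x. (\<integral>\<^sup>+m'. (\<integral>\<^sup>+t. (\<integral>\<^sup>+h. ennreal (pair_density (1 - s) (t - s) (h - x)) *
        indicator S (x, t, h) * (ennreal (max_density s x m') * (if m' < h then 1 else 0)) \<partial>lborel) \<partial>lborel) \<partial>lborel) \<partial>lborel)"
    proof (intro nn_integral_cong)
      fix x m' :: real
      define k where "k t h = ennreal (pair_density (1 - s) (t - s) (h - x)) *
        indicator S (x, t, h) * (if m' < h then 1 else 0)" for t h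
      have [measurable]: "(\<lambda>p. k (a p) (b p)) \<in> borel_measurable N"
        if [measurable]: "a \<in> borel_measurable N" "b \<in> borel_measurable N" for a b and N :: "'c measure"
        unfolding k_def by measurable
      have "(\<integral>\<^sup>+t. (\<integral>\<^sup>+m. ennreal (pair_density (1 - s) t m) * F2 ((x, m'), t, m) \<partial>lborel) \<partial>lborel)
        = (\<integral>\<^sup>+t. (\<integral>\<^sup>+m. k (s + t) (x + m) \<partial>lborel) \<partial>lborel)"
        by (intro nn_integral_cong) (simp add: F2_def k_def mult.assoc)
      also have "\<dots> = (\<integral>\<^sup>+t. (\<integral>\<^sup>+h. k (s + t) h \<partial>lborel) \<partial>lborel)"
        by (intro nn_integral_cong nn_integral_lborel_shift) measurable
      also have "\<dots> = (\<integral>\<^sup>+t. (\<integral>\<^sup>+h. k t h \<partial>lborel) \<partial>lborel)"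
        by (rule nn_integral_lborel_shift) measurable
      finally have "ennreal (max_density (s - 0) x m') *
          (\<integral>\<^sup>+t. (\<integral>\<^sup>+m. ennreal (pair_density (1 - s) t m) * F2 ((x, m'), t, m) \<partial>lborel) \<partial>lborel)
        = ennreal (max_density s x m') * (\<integral>\<^sup>+t. (\<integral>\<^sup>+h. k t h \<partial>lborel) \<partial>lborel)"
        by simp
      also have "\<dots> = (\<integral>\<^sup>+t. ennreal (max_density s x m') * (\<integral>\<^sup>+h. k t h \<partial>lborel) \<partial>lborel)"
        by (rule nn_integral_cmult[symmetric]) measurable
      also have "\<dots> = (\<integral>\<^sup>+t. (\<integral>\<^sup>+h. ennreal (max_density s x m') * k t h \<partial>lborel) \<partial>lborel)"
        by (intro nn_integral_cong nn_integral_cmult[symmetric]) measurable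
      also have "\<dots> = (\<integral>\<^sup>+t. (\<integral>\<^sup>+h. ennreal (pair_density (1 - s) (t - s) (h - x)) *
        indicator S (x, t, h) * (ennreal (max_density s x m') * (if m' < h then 1 else 0)) \<partial>lborel) \<partial>lborel)"
        unfolding k_def by (simp only: ac_simps)
      finally show "ennreal (max_density (s - 0) x m') *
          (\<integral>\<^sup>+t. (\<integral>\<^sup>+m. ennreal (pair_density (1 - s) t m) * F2 ((x, m'), t, m) \<partial>lborel) \<partial>lborel)
        = (\<integral>\<^sup>+t. (\<integral>\<^sup>+h. ennreal (pair_density (1 - s) (t - s) (h - x)) *
        indicator S (x, t, h) * (ennreal (max_density s x m') * (if m' < h then 1 else 0)) \<partial>lborel) \<partial>lborel)" .
    qed
    also have "\<dots> = (\<integral>\<^sup>+x. (\<integral>\<^sup>+t. (\<integral>\<^sup>+m'. (\<integral>\<^sup>+h. ennreal (pair_density (1 - s) (t - s) (h - x)) *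
        indicator S (x, t, h) * (ennreal (max_density s x m') * (if m' < h then 1 else 0)) \<partial>lborel) \<partial>lborel) \<partial>lborel) \<partial>lborel)"
      by (intro nn_integral_cong nn_integral_lborel_swap) measurable
    also have "\<dots> = (\<integral>\<^sup>+x. (\<integral>\<^sup>+t. (\<integral>\<^sup>+h. (\<integral>\<^sup>+m'. ennreal (pair_density (1 - s) (t - s) (h - x)) *
        indicator S (x, t, h) * (ennreal (max_density s x m') * (if m' < h then 1 else 0)) \<partial>lborel) \<partial>lborel) \<partial>lborel) \<partial>lborel)"
      by (intro nn_integral_cong nn_integral_lborel_swap) measurable
    also have "\<dots> = (\<integral>\<^sup>+x. (\<integral>\<^sup>+t. (\<integral>\<^sup>+h. ennreal (pair_density (1 - s) (t - s) (h - x)) *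
        indicator S (x, t, h) * ennreal (H2 x h) \<partial>lborel) \<partial>lborel) \<partial>lborel)"
    proof (intro nn_integral_cong)
      fix x t h :: real
      have "(\<integral>\<^sup>+m'. ennreal (pair_density (1 - s) (t - s) (h - x)) *
          indicator S (x, t, h) * (ennreal (max_density s x m') * (if m' < h then 1 else 0)) \<partial>lborel)
        = ennreal (pair_density (1 - s) (t - s) (h - x)) * indicator S (x, t, h) *
          (\<integral>\<^sup>+m'. ennreal (max_density s x m') * (if m' < h then 1 else 0) \<partial>lborel)"
        by (rule nn_integral_cmult) measurable
      also have "(\<integral>\<^sup>+m'. ennreal (max_density s x m') * (if m' < h then 1 else 0) \<partial>lborel)
        = (\<integral>\<^sup>+m'. ennreal (max_density s x m') * indicator {..h} m' \<partial>lborel)"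
        using AE_lborel_singleton[of h]
        by (intro nn_integral_cong_AE) (auto elim!: eventually_mono split: split_indicator)
      also have "\<dots> = ennreal (H2 x h)"
        using nn_integral_max_density_max[OF \<open>0 < s\<close>] by (simp add: H2_def)
      finally show "(\<integral>\<^sup>+m'. ennreal (pair_density (1 - s) (t - s) (h - x)) *
          indicator S (x, t, h) * (ennreal (max_density s x m') * (if m' < h then 1 else 0)) \<partial>lborel)
        = ennreal (pair_density (1 - s) (t - s) (h - x)) * indicator S (x, t, h) * ennreal (H2 x h)" .
    qed
    finally have 2: "(\<integral>\<^sup>+\<omega>. F2 (Z2 \<omega>, W \<omega>) \<partial>M) = \<dots>" .

    have "emeasure (distr M (lborel \<Otimes>\<^sub>M lborel \<Otimes>\<^sub>M lborel) Z) S = (\<integral>\<^sup>+p. indicator S p \<partial>distr M (lborel \<Otimes>\<^sub>M lborel \<Otimes>\<^sub>M lborel) Z)"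
      by simp
    also have "\<dots> = (\<integral>\<^sup>+\<omega>. indicator S (Z \<omega>) \<partial>M)"
      by (rule nn_integral_distr) measurable
    also have "\<dots> = (\<integral>\<^sup>+\<omega>. F1 (Z1 \<omega>, W1 \<omega>) + F2 (Z2 \<omega>, W \<omega>) \<partial>M)"
    proof (rule nn_integral_cong)
      fix \<omega> assume "\<omega> \<in> space M"
      then have \<omega>: "\<omega> \<in> space M" "0 \<le> (0::real)" "0 \<le> s" "s \<le> 1" "1 \<le> (1::real)"
        using s by simp_all
      note split = seg_max_split[OF \<omega>] seg_argmax_split[OF \<omega>]
      show "indicator S (Z \<omega>) = F1 (Z1 \<omega>, W1 \<omega>) + F2 (Z2 \<omega>, W \<omega>)"
      proof (cases "B s \<omega> - B 0 \<omega> + seg_max s 1 \<omega> \<le> seg_max 0 s \<omega>")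
        case True
        then have "Z \<omega> = Z1 \<omega>" "seg_max s 1 \<omega> \<le> seg_max 0 s \<omega> - (B s \<omega> - B 0 \<omega>)"
          using split by (simp_all add: Z_def Z1_def)
        with True show ?thesis
          by (simp add: F1_def F2_def Z1_def Z2_def W_def W1_def)
      next
        case False
        then have "Z \<omega> = (B s \<omega> - B 0 \<omega>, s + (seg_argmax s 1 \<omega> - s), B s \<omega> - B 0 \<omega> + seg_max s 1 \<omega>)"
          "\<not> seg_max s 1 \<omega> \<le> seg_max 0 s \<omega> - (B s \<omega> - B 0 \<omega>)"
          using split by (simp_all add: Z_def)
        with False show ?thesis
          by (simp add: F1_def F2_def Z1_def Z2_def W_def W1_def)
      qed
    qed
    also have "\<dots> = (\<integral>\<^sup>+\<omega>. F1 (Z1 \<omega>, W1 \<omega>) \<partial>M) + (\<integral>\<^sup>+\<omega>. F2 (Z2 \<omega>, W \<omega>) \<partial>M)"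
      by (rule nn_integral_add; unfold Z1_def Z2_def W_def W1_def; measurable)
    also have "\<dots> = (\<integral>\<^sup>+x. (\<integral>\<^sup>+t. (\<integral>\<^sup>+h. ennreal (triple_density s x t h) * (indicator S (x, t, h) * ennreal (H1 x h))
        + ennreal (pair_density (1 - s) (t - s) (h - x)) * indicator S (x, t, h) * ennreal (H2 x h) \<partial>lborel) \<partial>lborel) \<partial>lborel)"
      unfolding 1 2
    proof -
      have "(\<integral>\<^sup>+x. (\<integral>\<^sup>+t. (\<integral>\<^sup>+h. k (x, t, h) + k' (x, t, h) \<partial>lborel) \<partial>lborel) \<partial>lborel)
        = (\<integral>\<^sup>+x. (\<integral>\<^sup>+t. (\<integral>\<^sup>+h. k (x, t, h) \<partial>lborel) \<partial>lborel) \<partial>lborel)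
          + (\<integral>\<^sup>+x. (\<integral>\<^sup>+t. (\<integral>\<^sup>+h. k' (x, t, h) \<partial>lborel) \<partial>lborel) \<partial>lborel)"
        if [measurable]: "k \<in> borel_measurable (borel \<Otimes>\<^sub>M borel \<Otimes>\<^sub>M borel)" "k' \<in> borel_measurable (borel \<Otimes>\<^sub>M borel \<Otimes>\<^sub>M borel)"
        for k k' :: "real \<times> real \<times> real \<Rightarrow> ennreal"
        by (simp add: nn_integral_add)
      from this[of "\<lambda>(x, t, h). ennreal (triple_density s x t h) * (indicator S (x, t, h) * ennreal (H1 x h))"
          "\<lambda>(x, t, h). ennreal (pair_density (1 - s) (t - s) (h - x)) * indicator S (x, t, h) * ennreal (H2 x h)"]
      show "(\<integral>\<^sup>+x. (\<integral>\<^sup>+t. (\<integral>\<^sup>+h. ennreal (triple_density s x t h) * (indicator S (x, t, h) * ennreal (H1 x h)) \<partial>lborel) \<partial>lborel) \<partial>lborel)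
        + (\<integral>\<^sup>+x. (\<integral>\<^sup>+t. (\<integral>\<^sup>+h. ennreal (pair_density (1 - s) (t - s) (h - x)) * indicator S (x, t, h) * ennreal (H2 x h) \<partial>lborel) \<partial>lborel) \<partial>lborel)
        = (\<integral>\<^sup>+x. (\<integral>\<^sup>+t. (\<integral>\<^sup>+h. ennreal (triple_density s x t h) * (indicator S (x, t, h) * ennreal (H1 x h))
        + ennreal (pair_density (1 - s) (t - s) (h - x)) * indicator S (x, t, h) * ennreal (H2 x h) \<partial>lborel) \<partial>lborel) \<partial>lborel)"
        by simp
    qed
    also have "\<dots> = (\<integral>\<^sup>+x. (\<integral>\<^sup>+t. (\<integral>\<^sup>+h. f (x, t, h) * indicator S (x, t, h) \<partial>lborel) \<partial>lborel) \<partial>lborel)"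
    proof (intro nn_integral_cong)
      fix x t h :: real
      have "f (x, t, h) = ennreal (triple_density s x t h) * ennreal (H1 x h)
          + ennreal (pair_density (1 - s) (t - s) (h - x)) * ennreal (H2 x h)"
        unfolding f_def H1_def H2_def by (simp only: prod.case ennreal_bm_density[OF s])
      then show "ennreal (triple_density s x t h) * (indicator S (x, t, h) * ennreal (H1 x h))
        + ennreal (pair_density (1 - s) (t - s) (h - x)) * indicator S (x, t, h) * ennreal (H2 x h)
        = f (x, t, h) * indicator S (x, t, h)"
        by (cases "(x, t, h) \<in> S") simp_all
    qed
    also have "\<dots> = (\<integral>\<^sup>+p. f p * indicator S p \<partial>(lborel \<Otimes>\<^sub>M lborel \<Otimes>\<^sub>M lborel))"
      by (rule nn_integral_lborel_triple[symmetric]) (unfold f_def, measurable)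
    also have "\<dots> = emeasure (density (lborel \<Otimes>\<^sub>M lborel \<Otimes>\<^sub>M lborel) f) S"
      by (rule emeasure_density[symmetric]) measurable
    finally show "emeasure (distr M (lborel \<Otimes>\<^sub>M lborel \<Otimes>\<^sub>M lborel) Z) S
        = emeasure (density (lborel \<Otimes>\<^sub>M lborel \<Otimes>\<^sub>M lborel) f) S" .
  qed simp
  moreover have "distr M (lborel \<Otimes>\<^sub>M lborel \<Otimes>\<^sub>M lborel) Z
      = distr M (lborel \<Otimes>\<^sub>M lborel \<Otimes>\<^sub>M lborel) (\<lambda>\<omega>. (B s \<omega>, path_argmax B \<omega>, path_max B \<omega>))"
    by (rule distr_cong) (simp_all add: Z_eq)
  moreover have "(\<lambda>\<omega>. (B s \<omega>, path_argmax B \<omega>, path_max B \<omega>)) \<in> measurable M (lborel \<Otimes>\<^sub>M lborel \<Otimes>\<^sub>M lborel)"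
    using Z by (rule measurable_cong[THEN iffD1, rotated]) (simp add: Z_eq)
  ultimately show ?thesis
    using f unfolding distributed_def f_def by simp
qed

end

section \<open>The conditional density\<close>

text \<open>A joint density divided by its marginal is a conditional density. The quotient has to be
  right only for almost every \<open>y\<close>, since the marginal law of \<open>Y\<close> is
  absolutely continuous.\<close>

lemma (in prob_space) is_conditional_density_joint:
  fixes f :: "real \<Rightarrow> 'b::euclidean_space \<Rightarrow> real"
  assumes dist: "distributed M (lborel \<Otimes>\<^sub>M lborel) (\<lambda>\<omega>. (X \<omega>, Y \<omega>)) (\<lambda>(x, y). ennreal (f x y))"
    and f [measurable]: "(\<lambda>(x, y). f x y) \<in> borel_measurable (borel \<Otimes>\<^sub>M borel)"
    and nonneg: "\<And>x y. 0 \<le> f x y"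
  shows "is_conditional_density M X borel Y (\<lambda>x y. f x y / (\<integral>z. f z y \<partial>lborel))"
proof -
  have XY [measurable]: "(\<lambda>\<omega>. (X \<omega>, Y \<omega>)) \<in> measurable M (lborel \<Otimes>\<^sub>M lborel)"
    using dist by (simp add: distributed_def)
  have X [measurable]: "X \<in> borel_measurable M"
    using measurable_compose[OF XY measurable_fst] by simp
  have Y [measurable]: "Y \<in> borel_measurable M"
    using measurable_compose[OF XY measurable_snd] by simp
  \<comment> \<open>\<open>R\<close> has the default value 0 where \<open>f\<close> is not
    integrable in its first argument, whereas \<open>r\<close> is infinite there. As
    \<open>r\<close> integrates to 1 it is finite almost everywhere, and where it is finite the two
    agree.\<close>
  define R where "R y = (\<integral>z. f z y \<partial>lborel)" for y
  define r where "r y = (\<integral>\<^sup>+z. ennreal (f z y) \<partial>lborel)" for y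
  have [measurable]: "(\<lambda>w. f (a w) (b w)) \<in> borel_measurable N"
    if [measurable]: "a \<in> borel_measurable N" "b \<in> borel_measurable N" for a b and N :: "'c measure"
    using measurable_compose[OF measurable_Pair[OF that] f] by simp
  have R [measurable]: "R \<in> borel_measurable borel"
    unfolding R_def by measurable
  have r [measurable]: "r \<in> borel_measurable borel"
    unfolding r_def by measurable
  have R_nonneg: "0 \<le> R y" for y
    unfolding R_def by (rule Bochner_Integration.integral_nonneg) (rule nonneg)
  have joint: "emeasure M {\<omega> \<in> space M. X \<omega> \<in> A \<and> Y \<omega> \<in> C}
      = (\<integral>\<^sup>+y. (\<integral>\<^sup>+x. ennreal (f x y) * indicator A x \<partial>lborel) * indicator C y \<partial>lborel)"
    if [measurable]: "A \<in> sets borel" "C \<in> sets borel" for A C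
  proof -
    have "emeasure M {\<omega> \<in> space M. X \<omega> \<in> A \<and> Y \<omega> \<in> C}
      = emeasure M ((\<lambda>\<omega>. (X \<omega>, Y \<omega>)) -` (A \<times> C) \<inter> space M)"
      by (rule arg_cong[where f = "emeasure M"]) auto
    also have "\<dots> = (\<integral>\<^sup>+p. (\<lambda>(x, y). ennreal (f x y)) p * indicator (A \<times> C) p \<partial>(lborel \<Otimes>\<^sub>M lborel))"
      by (rule distributed_emeasure[OF dist]) measurable
    also have "\<dots> = (\<integral>\<^sup>+p. (\<lambda>(x, y). ennreal (f x y) * indicator A x * indicator C y) p \<partial>(lborel \<Otimes>\<^sub>M lborel))"
      by (intro nn_integral_cong) (simp split: prod.split split_indicator)
    also have "\<dots> = (\<integral>\<^sup>+y. (\<integral>\<^sup>+x. ennreal (f x y) * indicator A x * indicator C y \<partial>lborel) \<partial>lborel)"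
      by (rule lborel_pair.nn_integral_snd[symmetric, where f = "\<lambda>(x, y). ennreal (f x y) * indicator A x * indicator C y", simplified]) measurable
    also have "\<dots> = (\<integral>\<^sup>+y. (\<integral>\<^sup>+x. ennreal (f x y) * indicator A x \<partial>lborel) * indicator C y \<partial>lborel)"
      by (intro nn_integral_cong nn_integral_multc) measurable
    finally show ?thesis .
  qed
  have marginal: "distr M borel Y = density lborel r"
  proof (rule measure_eqI)
    fix C assume "C \<in> sets (distr M borel Y)"
    then have C [measurable]: "C \<in> sets borel" by simp
    have "emeasure (distr M borel Y) C = emeasure M {\<omega> \<in> space M. X \<omega> \<in> UNIV \<and> Y \<omega> \<in> C}"
      by (subst emeasure_distr) (auto intro!: arg_cong[where f = "emeasure M"])
    also have "\<dots> = (\<integral>\<^sup>+y. r y * indicator C y \<partial>lborel)"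
      using joint[of UNIV C] by (simp add: r_def)
    also have "\<dots> = emeasure (density lborel r) C"
      by (rule emeasure_density[symmetric]) simp_all
    finally show "emeasure (distr M borel Y) C = emeasure (density lborel r) C" .
  qed simp
  have r_finite: "AE y in lborel. r y \<noteq> \<infinity>"
  proof (rule nn_integral_noteq_infinite)
    have "(\<integral>\<^sup>+y. r y \<partial>lborel) = emeasure M (space M)"
      using joint[of UNIV UNIV] by (simp add: r_def)
    then show "(\<integral>\<^sup>+y. r y \<partial>lborel) \<noteq> \<infinity>"
      by (simp add: emeasure_space_1)
  qed simp
  have disint: "r y * (\<integral>\<^sup>+x. ennreal (f x y / R y) * indicator A x \<partial>lborel)
      = (\<integral>\<^sup>+x. ennreal (f x y) * indicator A x \<partial>lborel)"
    if fin: "r y \<noteq> \<infinity>" and [measurable]: "A \<in> sets borel" for y A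
  proof -
    have "integrable lborel (\<lambda>z. f z y)"
      using fin nonneg by (intro integrableI_nonneg) (simp_all add: r_def top.not_eq_extremum)
    then have rR: "r y = ennreal (R y)"
      unfolding r_def R_def using nonneg by (intro nn_integral_eq_integral) simp_all
    show ?thesis
    proof (cases "R y = 0")
      \<comment> \<open>The quotient is 0 by division by zero, and the right-hand side vanishes too,
        being bounded by \<open>r y = 0\<close>.\<close>
      case True
      have "(\<integral>\<^sup>+x. ennreal (f x y) * indicator A x \<partial>lborel) \<le> r y"
        unfolding r_def by (intro nn_integral_mono) (simp split: split_indicator)
      with True rR show ?thesis by simp
    next
      case False
      with R_nonneg[of y] have "0 < R y" by simp
      have "r y * (\<integral>\<^sup>+x. ennreal (f x y / R y) * indicator A x \<partial>lborel)
        = (\<integral>\<^sup>+x. ennreal (R y) * (ennreal (f x y / R y) * indicator A x) \<partial>lborel)"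
        unfolding rR by (rule nn_integral_cmult[symmetric]) measurable
      also have "\<dots> = (\<integral>\<^sup>+x. ennreal (f x y) * indicator A x \<partial>lborel)"
        using \<open>0 < R y\<close> nonneg
        by (intro nn_integral_cong) (simp add: mult.assoc[symmetric] ennreal_mult'[symmetric])
      finally show ?thesis .
    qed
  qed
  show ?thesis
    unfolding is_conditional_density_def R_def[symmetric]
  proof (intro conjI ballI allI X Y)
    have "(\<lambda>p. f (fst p) (snd p) / R (snd p)) \<in> borel_measurable (lborel \<Otimes>\<^sub>M borel)"
      by measurable
    then show "(\<lambda>(x, y). f x y / R y) \<in> borel_measurable (lborel \<Otimes>\<^sub>M borel)"
      by (simp add: case_prod_beta')
    show "0 \<le> f x y / R y" for x y
      using nonneg R_nonneg by simp
    fix A :: "real set" and C :: "'b set" assume A [measurable]: "A \<in> sets borel" and C [measurable]: "C \<in> sets borel"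
    have "emeasure M {\<omega> \<in> space M. X \<omega> \<in> A \<and> Y \<omega> \<in> C}
      = (\<integral>\<^sup>+y. r y * ((\<integral>\<^sup>+x. ennreal (f x y / R y) * indicator A x \<partial>lborel) * indicator C y) \<partial>lborel)"
      unfolding joint[OF A C]
      by (rule nn_integral_cong_AE) (use r_finite in \<open>eventually_elim, simp add: disint[OF _ A, symmetric] mult.assoc\<close>)
    also have "\<dots> = (\<integral>\<^sup>+y. (\<integral>\<^sup>+x. ennreal (f x y / R y) * indicator A x \<partial>lborel) * indicator C y \<partial>density lborel r)"
      by (rule nn_integral_density[symmetric]) measurable
    finally show "emeasure M {\<omega> \<in> space M. X \<omega> \<in> A \<and> Y \<omega> \<in> C}
      = (\<integral>\<^sup>+y\<in>C. (\<integral>\<^sup>+x\<in>A. ennreal (f x y / R y) \<partial>lborel) \<partial>distr M borel Y)"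
      unfolding marginal .
  qed
qed

text \<open>The analytic content is the joint density, which has the formulas for
  \<open>s < \<theta>\<close> and \<open>\<theta> < s\<close>; the normalised conditional density
  follows from it by the general quotient construction.\<close>

theorem theorem5p1:
  fixes M :: "'a measure" and B :: "real \<Rightarrow> 'a \<Rightarrow> real" and s :: real
  assumes "brownian_motion_01 M B"
    and "0 < s" and "s < 1"
  shows "distributed M (lborel \<Otimes>\<^sub>M lborel \<Otimes>\<^sub>M lborel)
           (\<lambda>\<omega>. (B s \<omega>, path_argmax B \<omega>, path_max B \<omega>))
           (\<lambda>(x, \<theta>, h). ennreal (bm_density s x \<theta> h))
       \<and> is_conditional_density M (B s)
           (borel :: (real \<times> real) measure) (\<lambda>\<omega>. (path_argmax B \<omega>, path_max B \<omega>))
           (\<lambda>x (\<theta>, h). bm_conditional_density s x \<theta> h)"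
proof
  interpret bm01 M B
    using assms(1) by (simp add: bm01_def bm01_axioms_def brownian_motion_01_def)
  show *: "distributed M (lborel \<Otimes>\<^sub>M lborel \<Otimes>\<^sub>M lborel)
           (\<lambda>\<omega>. (B s \<omega>, path_argmax B \<omega>, path_max B \<omega>))
           (\<lambda>(x, \<theta>, h). ennreal (bm_density s x \<theta> h))"
    by (rule distributed_triple[OF assms(2,3)])
  have "is_conditional_density M (B s) borel (\<lambda>\<omega>. (path_argmax B \<omega>, path_max B \<omega>))
      (\<lambda>x p. bm_density s x (fst p) (snd p) / (\<integral>z. bm_density s z (fst p) (snd p) \<partial>lborel))"
  proof (rule is_conditional_density_joint)
    show "distributed M (lborel \<Otimes>\<^sub>M lborel) (\<lambda>\<omega>. (B s \<omega>, path_argmax B \<omega>, path_max B \<omega>))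
        (\<lambda>(x, p). ennreal (bm_density s x (fst p) (snd p)))"
      \<comment> \<open>The pair (location, height) is regarded as one variable in the Euclidean
        plane, whose Lebesgue measure is the product
        \<open>lborel \<Otimes>\<^sub>M lborel\<close>.\<close>
      using * by (simp add: lborel_prod case_prod_beta')
    show "(\<lambda>(x, p). bm_density s x (fst p) (snd p)) \<in> borel_measurable (borel \<Otimes>\<^sub>M borel)"
    proof -
      have "(\<lambda>(x, p). bm_density s x (fst p) (snd p)) \<in> borel_measurable (borel \<Otimes>\<^sub>M (borel \<Otimes>\<^sub>M borel))"
        by measurable
      then show ?thesis by (simp add: borel_prod)
    qed
    show "0 \<le> bm_density s x (fst p) (snd p)" for x p
      by (rule bm_density_nonneg[OF assms(2,3)])
  qed
  then show "is_conditional_density M (B s)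
           (borel :: (real \<times> real) measure) (\<lambda>\<omega>. (path_argmax B \<omega>, path_max B \<omega>))
           (\<lambda>x (\<theta>, h). bm_conditional_density s x \<theta> h)"
    by (simp add: bm_conditional_density_def case_prod_beta')
qed

end
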